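(* Let $\eta\in L^\infty(\mathbb T)$ be a nonnegative function, $\eta\not\equiv 0$. (a) There exists a $G$-extremal function $f\in H^\infty+C$ such that $\eta=|f|$ a.e. on $\mathbb T$. (b) There exists a $G$-extremal function $f\in H^\infty$ with $\eta=|f|$ a.e. on $\mathbb T$ if and only if $\int_{\mathbb T}\log\eta\,dm>-\infty$. (c) There exists a $G$-extremal function $f\in \mathrm{BMO}_{\mathrm{na}}\cap L^\infty$ with $\eta=|f|$ a.e. on $\mathbb T$ if and only if $\eta$ is (a.e. equal to) a constant.
   Context: $\mathbb D=\{z\in\mathbb C:|z|<1\}$, $\mathbb T=\partial\mathbb D$, $m$ is normalized arc length measure on $\mathbb T$, $L^p=L^p(\mathbb T,m)$ (complex-valued functions). For $f\in L^1$, the Poisson integral is $\mathcal Pf(z)=\int_{\mathbb T}f(\zeta)\frac{1-|z|^2}{|\zeta-z|^2}\,dm(\zeta)$, $z\in\mathbb D$. $H^p$ is the set of $f\in L^p$ with $\mathcal Pf$ analytic on $\mathbb D$. $C=C(\mathbb T)$ is the space of continuous functions on $\mathbb T$, and $H^\infty+C=\{g+h:g\in H^\infty,\ h\in C\}$. For $f\in L^2$ put $\Phi_f(z)=\mathcal P(|f|^2)(z)-|\mathcal Pf(z)|^2$, $z\in\mathbb D$, and $\|f\|_G=\sup_{z\in\mathbb D}\Phi_f(z)^{1/2}$ (the Garsia norm). $\mathrm{BMO}$ is the set of $f\in L^2$ with $\|f\|_G<\infty$; one has $L^\infty\subset\mathrm{BMO}$ and $\|f\|_G\le\|f\|_\infty$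 for $f\in L^\infty$. $\mathrm{BMO}_{\mathrm{na}}$ (norm-attaining functions) is the set of $f\in\mathrm{BMO}$ for which there is a point $z_0\in\mathbb D$ with $\|f\|_G^2=\Phi_f(z_0)$. A function $f\in L^\infty$ is called $G$-extremal if $\|f\|_G=\|f\|_\infty$ (with $\|\cdot\|_\infty$ the essential supremum norm). Here functions are treated as individual functions, not modulo constants. *)

theory Defs
  imports "HOL-Complex_Analysis.Complex_Analysis" "HOL-Probability.Probability_Measure"
    "HOL-Probability.Essential_Supremum"
begin

text \<open>
  Functions on the unit circle are functions on the type \<^typ>\<open>complex\<close>; as the space of
  the measure below is \<^term>\<open>sphere 0 1 :: complex set\<close>, their values elsewhere play no role.
  Elements of the $L^p$ spaces are represented by Borel functions, and equality of elements is
  almost-everywhere equality.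
\<close>

definition circle_measure :: "complex measure" where
  "circle_measure =
     distr (uniform_measure lborel {0..<2 * pi}) (restrict_space borel (sphere 0 1)) cis"

lemma cis_measurable_circle [measurable]:
  "cis \<in> measurable borel (restrict_space borel (sphere 0 1))"
  by (intro measurable_restrict_space2 borel_measurable_continuous_onI continuous_intros) auto

lemma space_circle_measure [simp]: "space circle_measure = sphere 0 1"
  by (simp add: circle_measure_def space_restrict_space)

lemma sets_circle_measure [measurable_cong, simp]:
  "sets circle_measure = sets (restrict_space borel (sphere 0 1))"
  by (simp add: circle_measure_def)

lemma prob_space_circle_measure: "prob_space circle_measure"
  unfolding circle_measure_def
  by (intro prob_space.prob_space_distr prob_space_uniform_measure) auto

definition poisson :: "(complex \<Rightarrow> 'a::{banach, second_countable_topology}) \<Rightarrow> complex \<Rightarrow> 'a" where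
  "poisson f z =
     (LINT \<zeta>|circle_measure. ((1 - (norm z)\<^sup>2) / (norm (\<zeta> - z))\<^sup>2) *\<^sub>R f \<zeta>)"

definition sup_norm :: "(complex \<Rightarrow> 'a::real_normed_vector) \<Rightarrow> ereal" where
  "sup_norm f = esssup circle_measure (\<lambda>\<zeta>. ereal (norm (f \<zeta>)))"

definition L2 :: "(complex \<Rightarrow> complex) set" where
  "L2 = {f \<in> borel_measurable circle_measure. integrable circle_measure (\<lambda>\<zeta>. (norm (f \<zeta>))\<^sup>2)}"

definition Linf :: "(complex \<Rightarrow> 'a::real_normed_vector) set" where
  "Linf = {f \<in> borel_measurable circle_measure. sup_norm f < \<infinity>}"

definition Hinf :: "(complex \<Rightarrow> complex) set" where
  "Hinf = {f \<in> Linf. poisson f analytic_on ball 0 1}"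

definition Hinf_plus_C :: "(complex \<Rightarrow> complex) set" where
  "Hinf_plus_C = {\<lambda>\<zeta>. g \<zeta> + h \<zeta> | g h. g \<in> Hinf \<and> continuous_on (sphere 0 1) h}"

definition garsia_fun :: "(complex \<Rightarrow> complex) \<Rightarrow> complex \<Rightarrow> real" where
  "garsia_fun f z = poisson (\<lambda>\<zeta>. (norm (f \<zeta>))\<^sup>2) z - (norm (poisson f z))\<^sup>2"

definition garsia_norm :: "(complex \<Rightarrow> complex) \<Rightarrow> ereal" where
  "garsia_norm f = (SUP z\<in>ball 0 1. ereal (sqrt (garsia_fun f z)))"

definition BMO :: "(complex \<Rightarrow> complex) set" where
  "BMO = {f \<in> L2. garsia_norm f < \<infinity>}"

definition BMO_na :: "(complex \<Rightarrow> complex) set" where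
  "BMO_na = {f \<in> BMO. \<exists>z0\<in>ball 0 1. (garsia_norm f)\<^sup>2 = ereal (garsia_fun f z0)}"

definition G_extremal :: "(complex \<Rightarrow> complex) \<Rightarrow> bool" where
  "G_extremal f \<longleftrightarrow> f \<in> Linf \<and> garsia_norm f = sup_norm f"

text \<open>
  The library has \<^prop>\<open>ln (0::real) = 0\<close> and assigns the Bochner integral 0 to
  non-integrable functions, so the logarithmic integral is formed in the extended reals.
\<close>

definition ext_ln :: "real \<Rightarrow> ereal" where
  "ext_ln x = (if x > 0 then ereal (ln x) else - \<infinity>)"

text \<open>
  Integral of the positive part minus integral of the negative part;
  \<^const>\<open>e2ennreal\<close> sends negative numbers to 0. The value is only meaningful if one of the two
  integrals is finite.
\<close>

definition ext_integral :: "'a measure \<Rightarrow> ('a \<Rightarrow> ereal) \<Rightarrow> ereal" where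
  "ext_integral M g =
     enn2ereal (\<integral>\<^sup>+ x. e2ennreal (g x) \<partial>M) - enn2ereal (\<integral>\<^sup>+ x. e2ennreal (- g x) \<partial>M)"

end

theory Submission
  imports Defs
begin

text \<open>
Throughout, \<open>\<mu>\<close> is normalized arc length, \<open>P\<close> the Poisson integral and \<open>M\<close> the essential supremum
of \<open>\<eta>\<close>.

\<^bold>\<open>Extremality.\<close> If \<open>\<bar>f\<bar> = \<eta>\<close>, then \<open>P(\<bar>f\<bar>\<^sup>2) - \<bar>P f\<bar>\<^sup>2 \<le> M\<^sup>2\<close> on the disc, so \<open>f\<close> is extremal as
soon as there are points \<open>z\<^sub>n\<close> with \<open>P \<eta> (z\<^sub>n) \<rightarrow> M\<close> and \<open>P f (z\<^sub>n) \<rightarrow> 0\<close> (\<open>G_extremalI\<close>). Dilations of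
\<open>P \<eta>\<close> converge to \<open>\<eta>\<close> in mean, hence \<open>P \<eta>\<close> comes close to \<open>M\<close> arbitrarily near the circle, and the
points \<open>z\<^sub>n\<close> can be chosen so near to it that a Blaschke product vanishes at all of them. Multiplication
by this product does not change the modulus and makes \<open>P f (z\<^sub>n)\<close> small. If \<open>f\<close> is extremal and
its Garsia norm is attained at \<open>z\<^sub>0\<close>, then \<open>P(M\<^sup>2 - \<bar>f\<bar>\<^sup>2)(z\<^sub>0) = 0\<close>, and positivity of the kernel gives \<open>\<bar>f\<bar> = M\<close>
almost everywhere; conversely \<open>f(\<zeta>) = c \<zeta>\<close> attains its norm at the origin. This is part (c).

\<^bold>\<open>Part (b).\<close> If \<open>log \<eta>\<close> is integrable, \<open>f\<close> is the outer function with modulus \<open>\<eta>\<close> times such a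
Blaschke product. Conversely, if \<open>f\<close> is a nonzero bounded analytic function, multiply it by the outer
function with modulus \<open>1 / max(\<bar>f\<bar>, t)\<close>: the product is bounded by 1, and its value at a point where \<open>f\<close>
does not vanish bounds \<open>\<integral> log max(\<bar>f\<bar>, t)\<close> from below, uniformly in \<open>t > 0\<close>
(\<open>Hinf_log_integral_finite\<close>).

\<^bold>\<open>Part (a).\<close> It remains to find an inner function \<open>U\<close> with \<open>U \<eta> \<in> H\<^sup>\<infinity> + C\<close>, where
\<open>log \<eta>\<close> may fail to be integrable; this is the case of a nonnegative function in Axler's
theorem on multiplication of bounded functions into \<open>H\<^sup>\<infinity> + C\<close>. Since
\<open>H\<^sup>\<infinity> + C\<close> is closed (\<open>Hinf_plus_continuous_closed\<close>), it suffices that \<open>U \<eta>\<close> is a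
uniform limit of functions \<open>\<zeta>\<^sup>-\<^sup>n h(\<zeta>)\<close> with \<open>h \<in> H\<^sup>\<infinity>\<close>. For one tolerance this is arranged by an inner
function \<open>\<phi>\<close> with \<open>\<phi>(0)\<close> as close to 1 as desired (\<open>inner_multiplier_approx\<close>): \<open>\<eta>\<close> is a trigonometric
polynomial plus an error that is small in mean, the error is up to a small uniform error a combination of
indicators of sets \<open>A\<close> of very small measure, and for such a set there is an explicit inner function \<open>\<phi>\<close> for
which \<open>\<phi> 1\<^sub>A\<close> is uniformly close to \<open>H\<^sup>\<infinity>\<close> (\<open>small_set_inner\<close>). Because the values at 0 tend to 1 fast, the
infinite product of all these inner functions and of the Blaschke factors converges
(\<open>contractive_product_converges\<close>), and it serves every tolerance at once.

\<^bold>\<open>Boundary values.\<close> Here \<open>H\<^sup>\<infinity>\<close> consists of functions on the circle, so analytic functions in the disc have to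
be traced to the boundary. Instead of pointwise boundary limits, everything is read off from the
convergence in mean of \<open>P f (r \<zeta>)\<close> to \<open>f\<close> as \<open>r \<rightarrow> 1\<close> (\<open>poisson_radial_L1\<close>), which makes \<open>P\<close> multiplicative
on \<open>H\<^sup>\<infinity>\<close>. Outer functions are obtained as limits in mean square of their dilations.
\<close>

section \<open>Integration over the circle and the mean value property\<close>

abbreviation circ :: "complex measure" ("\<mu>") where "\<mu> \<equiv> circle_measure"

interpretation circle: prob_space \<mu>
  by (rule prob_space_circle_measure)

lemma borel_measurable_circle_continuous:
  fixes g :: "complex \<Rightarrow> 'a::topological_space"
  assumes "continuous_on (sphere 0 1) g"
  shows "g \<in> borel_measurable \<mu>"
proof -
  have "g \<in> borel_measurable (restrict_space borel (sphere 0 1))"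
    using assms by (rule borel_measurable_continuous_on_restrict)
  then show ?thesis by (simp add: measurable_cong_sets[OF sets_circle_measure refl])
qed

lemma borel_measurable_circle_id [measurable]: "(\<lambda>\<zeta>. \<zeta>) \<in> borel_measurable \<mu>"
  by (intro borel_measurable_circle_continuous continuous_intros)

lemma AE_circle_norm: "AE \<zeta> in \<mu>. norm \<zeta> = 1"
  by (intro AE_I2) simp

lemma integrable_circle_bounded:
  fixes f :: "complex \<Rightarrow> 'a::{banach, second_countable_topology}"
  assumes "f \<in> borel_measurable \<mu>" "AE \<zeta> in \<mu>. norm (f \<zeta>) \<le> B"
  shows "integrable \<mu> f"
  using assms circle.integrable_const_bound by blast

lemma integrable_circle_continuous:
  fixes g :: "complex \<Rightarrow> 'a::{banach, second_countable_topology}"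
  assumes "continuous_on (sphere 0 1) g"
  shows "integrable \<mu> g"
proof -
  have "compact (g ` sphere 0 1)" using assms by (intro compact_continuous_image) auto
  then obtain B where "\<And>x. x \<in> sphere 0 1 \<Longrightarrow> norm (g x) \<le> B"
    using compact_imp_bounded bounded_iff by (metis imageI)
  then show ?thesis
    using assms by (intro integrable_circle_bounded[of _ B] borel_measurable_circle_continuous AE_I2) auto
qed

lemma circle_integral_eq_has_integral:
  fixes g :: "complex \<Rightarrow> complex"
  assumes g: "continuous_on (sphere 0 1) g"
  shows "((\<lambda>t. g (cis t)) has_integral (2 * pi * (LINT \<zeta>|\<mu>. g \<zeta>))) {0..2 * pi}"
proof -
  have gm: "g \<in> borel_measurable (restrict_space borel (sphere 0 1))"
    using g by (rule borel_measurable_continuous_on_restrict)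
  have cont: "continuous_on UNIV (\<lambda>t. g (cis t))"
    by (intro continuous_on_compose2[OF g]) (auto intro!: continuous_intros)
  then have cm: "(\<lambda>t. g (cis t)) \<in> borel_measurable borel"
    by (rule borel_measurable_continuous_onI)
  have "(LINT \<zeta>|\<mu>. g \<zeta>) = (LINT t|uniform_measure lborel {0..<2 * pi}. g (cis t))"
    unfolding circle_measure_def by (subst integral_distr[OF _ gm]) auto
  also have "uniform_measure lborel {0..<2 * pi}
     = density lborel (\<lambda>t. ennreal (indicator {0..<2*pi} t / (2*pi)))"
    unfolding uniform_measure_def
    by (intro density_cong) (auto simp: indicator_def divide_ennreal ennreal_1[symmetric] simp del: ennreal_1)
  also have "(LINT t|\<dots>. g (cis t)) = (LINT t|lborel. (indicator {0..<2*pi} t / (2*pi)) *\<^sub>R g (cis t))"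
    using cm by (subst integral_density) auto
  also have "\<dots> = (LINT t|lborel. (1 / (2*pi)) *\<^sub>R (indicator {0..<2*pi} t *\<^sub>R g (cis t)))"
    by (intro Bochner_Integration.integral_cong) auto
  also have "\<dots> = (1/(2*pi)) *\<^sub>R (LINT t:{0..<2*pi}|lborel. g (cis t))"
    unfolding set_lebesgue_integral_def by (subst integral_scaleR_right) auto
  also have "(LINT t:{0..<2*pi}|lborel. g (cis t)) = (LINT t:{0..2*pi}|lborel. g (cis t))"
    unfolding set_lebesgue_integral_def
    using AE_lborel_singleton[of "2*pi"] cm
    by (intro integral_cong_AE) (auto simp: indicator_def)
  finally have *: "2 * pi * (LINT \<zeta>|\<mu>. g \<zeta>) = (LINT t:{0..2*pi}|lborel. g (cis t))"
    by (simp add: scaleR_conv_of_real)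
  have "set_integrable lborel {0..2*pi} (\<lambda>t. g (cis t))"
    using cont continuous_on_subset by (intro borel_integrable_atLeastAtMost') blast
  from set_borel_integral_eq_integral[OF this] show ?thesis
    unfolding * by (simp add: has_integral_integrable_integral)
qed

text \<open>
On the circle \<open>dm = dw / (2 \<pi> i w)\<close>, so that Cauchy's theorems can be used to compute integrals
with respect to \<open>\<mu>\<close>.
\<close>

lemma circle_integral_eq_contour:
  fixes g :: "complex \<Rightarrow> complex"
  assumes "continuous_on (sphere 0 1) g"
    and "((\<lambda>w. g w / w) has_contour_integral (2 * of_real pi * \<i> * I)) (circlepath 0 1)"
  shows "(LINT \<zeta>|\<mu>. g \<zeta>) = I"
proof -
  have "((\<lambda>t. \<i> * g (cis t)) has_integral (2 * of_real pi * \<i> * I)) {0..2*pi}"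
    using assms(2) unfolding circlepath_def
    by (subst (asm) has_contour_integral_part_circlepath_iff) (auto simp: field_simps)
  moreover have "((\<lambda>t. \<i> * g (cis t)) has_integral (\<i> * (2 * pi * (LINT \<zeta>|\<mu>. g \<zeta>)))) {0..2*pi}"
    by (intro has_integral_mult_right circle_integral_eq_has_integral assms)
  ultimately have "2 * of_real pi * \<i> * I = \<i> * (2 * pi * (LINT \<zeta>|\<mu>. g \<zeta>))"
    by (rule has_integral_unique)
  then show ?thesis by simp
qed

lemma circle_mean_value:
  fixes g :: "complex \<Rightarrow> complex"
  assumes "continuous_on (cball 0 1) g" "g holomorphic_on ball 0 1"
  shows "(LINT \<zeta>|\<mu>. g \<zeta>) = g 0"
proof (rule circle_integral_eq_contour)
  show "continuous_on (sphere 0 1) g"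
    using assms(1) by (rule continuous_on_subset) auto
  show "((\<lambda>w. g w / w) has_contour_integral 2 * of_real pi * \<i> * g 0) (circlepath 0 1)"
    using Cauchy_integral_circlepath[OF assms, of 0] by simp
qed

section \<open>The Poisson kernel and the Poisson integral\<close>

definition poisson_kernel :: "complex \<Rightarrow> complex \<Rightarrow> real" where
  "poisson_kernel z \<zeta> = (1 - (norm z)\<^sup>2) / (norm (\<zeta> - z))\<^sup>2"

lemma poisson_eq_kernel: "poisson f z = (LINT \<zeta>|\<mu>. poisson_kernel z \<zeta> *\<^sub>R f \<zeta>)"
  by (simp add: poisson_def poisson_kernel_def)

lemma cnj_eq_inverse_circle:
  assumes "norm (\<zeta>::complex) = 1" shows "cnj \<zeta> = 1 / \<zeta>"
proof -
  have "\<zeta> * cnj \<zeta> = 1" using assms by (simp flip: complex_norm_square)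
  moreover have "\<zeta> \<noteq> 0" using assms by auto
  ultimately show ?thesis by (simp add: field_simps)
qed

lemma one_minus_mult_nonzero:
  fixes w z :: complex
  assumes "norm w < 1" "norm z \<le> 1" shows "1 - w * z \<noteq> 0"
proof -
  have "norm (w * z) \<le> norm w" unfolding norm_mult using assms by (intro mult_left_le) auto
  then have "norm (w * z) < 1" using assms by linarith
  then show ?thesis by auto
qed

text \<open>
The first summand is the Cauchy kernel for \<open>\<mu>\<close>; the second is, as a function of \<open>\<zeta>\<close>, analytic in
the closed disc and zero at the origin, so analytic functions integrate to zero against it.
\<close>

lemma poisson_kernel_eq_cauchy:
  assumes "norm z < 1" "norm \<zeta> = 1"
  shows "complex_of_real (poisson_kernel z \<zeta>) = \<zeta> / (\<zeta> - z) + cnj z * \<zeta> / (1 - cnj z * \<zeta>)"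
proof -
  have z: "\<zeta> \<noteq> 0" "\<zeta> \<noteq> z" using assms by auto
  have n: "1 - cnj z * \<zeta> \<noteq> 0" using assms by (intro one_minus_mult_nonzero) auto
  have c: "cnj \<zeta> = 1 / \<zeta>" using assms(2) by (rule cnj_eq_inverse_circle)
  have "complex_of_real ((norm (\<zeta> - z))\<^sup>2) = (\<zeta> - z) * (1 / \<zeta> - cnj z)"
    by (simp only: complex_norm_square complex_cnj_diff c)
  also have "\<dots> = (\<zeta> - z) * (1 - cnj z * \<zeta>) / \<zeta>"
    using z by (simp add: field_simps)
  finally have d: "complex_of_real ((norm (\<zeta> - z))\<^sup>2) = (\<zeta> - z) * (1 - cnj z * \<zeta>) / \<zeta>" .
  have "complex_of_real (poisson_kernel z \<zeta>) = (1 - z * cnj z) / ((\<zeta> - z) * (1 - cnj z * \<zeta>) / \<zeta>)"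
    unfolding poisson_kernel_def of_real_divide d by (simp add: complex_norm_square flip: of_real_power)
  also have "\<dots> = \<zeta> / (\<zeta> - z) + cnj z * \<zeta> / (1 - cnj z * \<zeta>)"
  proof -
    have "1 / (a * b / x) * y = x / a * c + w * x / b" if "y = c * b + w * a" "a \<noteq> 0" "b \<noteq> 0" "x \<noteq> 0" for a b c w x y :: complex
      using that by (simp add: field_simps)
    from this[where a = "\<zeta> - z" and b = "1 - cnj z * \<zeta>" and x = \<zeta> and y = "1 - z * cnj z" and c = 1 and w = "cnj z"]
    show ?thesis using z n by (simp add: algebra_simps)
  qed
  finally show ?thesis .
qed

lemma poisson_kernel_bounds:
  assumes "norm z < 1" "norm \<zeta> = 1"
  shows "0 < poisson_kernel z \<zeta>" "poisson_kernel z \<zeta> \<le> 2 / (1 - norm z)"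
proof -
  have 1: "(norm z)\<^sup>2 < 1" using assms by (simp add: power_less_one_iff abs_square_less_1)
  have 2: "1 - norm z \<le> norm (\<zeta> - z)" using norm_triangle_ineq2[of \<zeta> z] assms by simp
  then have 3: "0 < norm (\<zeta> - z)" using assms by linarith
  show "0 < poisson_kernel z \<zeta>" unfolding poisson_kernel_def using 1 3 by simp
  have "(1 - (norm z)\<^sup>2) * (1 - norm z) = (1 + norm z) * (1 - norm z)\<^sup>2"
    by (simp add: power2_eq_square algebra_simps)
  also have "\<dots> \<le> 2 * (norm (\<zeta> - z))\<^sup>2"
    using 2 assms by (intro mult_mono power_mono) auto
  finally show "poisson_kernel z \<zeta> \<le> 2 / (1 - norm z)"
    unfolding poisson_kernel_def using assms 3 by (simp add: divide_simps)
qed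

lemma continuous_on_poisson_kernel:
  assumes "norm z < 1"
  shows "continuous_on (sphere 0 1) (poisson_kernel z)"
  unfolding poisson_kernel_def using assms by (intro continuous_intros) auto

lemma poisson_kernel_measurable [measurable]:
  assumes [measurable]: "f \<in> borel_measurable M" "g \<in> borel_measurable M"
  shows "(\<lambda>x. poisson_kernel (f x) (g x)) \<in> borel_measurable M"
  unfolding poisson_kernel_def by measurable

lemma poisson_kernel_measurable_circle [measurable]: "poisson_kernel z \<in> borel_measurable \<mu>"
  using poisson_kernel_measurable[of "\<lambda>_. z" \<mu> "\<lambda>x. x"] by simp

lemma norm_poisson_kernel_scaleR_le:
  fixes x :: "'a::real_normed_vector"
  assumes "norm z < 1" "norm \<zeta> = 1"
  shows "norm (poisson_kernel z \<zeta> *\<^sub>R x) \<le> 2 / (1 - norm z) * norm x"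
proof -
  have "poisson_kernel z \<zeta> * norm x \<le> 2 / (1 - norm z) * norm x"
    using poisson_kernel_bounds[OF assms] by (intro mult_right_mono) auto
  then show ?thesis using poisson_kernel_bounds[OF assms] by simp
qed

lemma poisson_holomorphic:
  fixes g :: "complex \<Rightarrow> complex"
  assumes g: "continuous_on (cball 0 1) g" "g holomorphic_on ball 0 1" and z: "norm z < 1"
  shows "poisson g z = g z"
proof -
  define h where "h \<zeta> = g \<zeta> * (cnj z * \<zeta> / (1 - cnj z * \<zeta>))" for \<zeta>
  have nz: "1 - cnj z * \<zeta> \<noteq> 0" if "norm \<zeta> \<le> 1" for \<zeta>
    using that z by (intro one_minus_mult_nonzero) auto
  have gs: "continuous_on (sphere 0 1) g" using g(1) by (rule continuous_on_subset) auto
  have h: "continuous_on (cball 0 1) h" "h holomorphic_on ball 0 1"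
    unfolding h_def using nz by (auto intro!: continuous_intros holomorphic_intros g)
  have c1: "continuous_on (sphere 0 1) (\<lambda>\<zeta>. g \<zeta> * \<zeta> / (\<zeta> - z))"
    using z by (intro continuous_intros gs) auto
  have c2: "continuous_on (sphere 0 1) h" using h(1) by (rule continuous_on_subset) auto
  have "poisson g z = (LINT \<zeta>|\<mu>. g \<zeta> * \<zeta> / (\<zeta> - z) + h \<zeta>)"
    unfolding poisson_eq_kernel
    by (intro Bochner_Integration.integral_cong)
       (auto simp: scaleR_conv_of_real poisson_kernel_eq_cauchy z h_def algebra_simps)
  also have "\<dots> = (LINT \<zeta>|\<mu>. g \<zeta> * \<zeta> / (\<zeta> - z)) + (LINT \<zeta>|\<mu>. h \<zeta>)"
    using c1 c2 by (intro Bochner_Integration.integral_add integrable_circle_continuous)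
  also have "(LINT \<zeta>|\<mu>. h \<zeta>) = 0" by (subst circle_mean_value[OF h]) (simp add: h_def)
  also have "(LINT \<zeta>|\<mu>. g \<zeta> * \<zeta> / (\<zeta> - z)) = g z"
  proof (rule circle_integral_eq_contour[OF c1])
    have "((\<lambda>w. g w / (w - z)) has_contour_integral 2 * of_real pi * \<i> * g z) (circlepath 0 1)"
      using Cauchy_integral_circlepath[OF g, of z] z by simp
    then show "((\<lambda>w. g w * w / (w - z) / w) has_contour_integral 2 * of_real pi * \<i> * g z) (circlepath 0 1)"
      by (rule has_contour_integral_eq) auto
  qed
  finally show ?thesis by simp
qed

lemma poisson_0: "poisson f 0 = (LINT \<zeta>|\<mu>. f \<zeta>)"
  unfolding poisson_def by (intro Bochner_Integration.integral_cong) auto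

lemma poisson_const_real:
  assumes "norm z < 1" shows "poisson (\<lambda>_. c::real) z = c"
proof -
  have *: "integrable \<mu> (poisson_kernel z)"
    using assms by (intro integrable_circle_continuous continuous_on_poisson_kernel)
  have "complex_of_real (LINT \<zeta>|\<mu>. poisson_kernel z \<zeta>) = poisson (\<lambda>_. 1) z"
    unfolding poisson_eq_kernel by (simp add: scaleR_conv_of_real)
  also have "\<dots> = 1" using assms by (subst poisson_holomorphic) auto
  finally have "(LINT \<zeta>|\<mu>. poisson_kernel z \<zeta>) = 1" by simp
  then show ?thesis unfolding poisson_eq_kernel using * by simp
qed

lemma poisson_kernel_integral: "norm z < 1 \<Longrightarrow> (LINT \<zeta>|\<mu>. poisson_kernel z \<zeta>) = 1"
  using poisson_const_real[of z 1] by (simp add: poisson_eq_kernel)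

lemma integrable_poisson_kernel_mult:
  fixes f :: "complex \<Rightarrow> 'a::{banach, second_countable_topology}"
  assumes "integrable \<mu> f" "norm z < 1"
  shows "integrable \<mu> (\<lambda>\<zeta>. poisson_kernel z \<zeta> *\<^sub>R f \<zeta>)"
proof (rule Bochner_Integration.integrable_bound)
  show "integrable \<mu> (\<lambda>\<zeta>. (2 / (1 - norm z)) *\<^sub>R f \<zeta>)" using assms by simp
  show "(\<lambda>\<zeta>. poisson_kernel z \<zeta> *\<^sub>R f \<zeta>) \<in> borel_measurable \<mu>"
    using assms by measurable
  show "AE \<zeta> in \<mu>. norm (poisson_kernel z \<zeta> *\<^sub>R f \<zeta>) \<le> norm ((2 / (1 - norm z)) *\<^sub>R f \<zeta>)"
    using assms(2) norm_poisson_kernel_scaleR_le[OF assms(2), of _ "f _"] by (intro AE_I2) auto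
qed

lemma poisson_add:
  assumes "integrable \<mu> f" "integrable \<mu> g" "norm z < 1"
  shows "poisson (\<lambda>\<zeta>. f \<zeta> + g \<zeta>) z = poisson f z + poisson g z"
  unfolding poisson_eq_kernel scaleR_right_distrib
  by (intro Bochner_Integration.integral_add integrable_poisson_kernel_mult assms)

lemma poisson_diff:
  assumes "integrable \<mu> f" "integrable \<mu> g" "norm z < 1"
  shows "poisson (\<lambda>\<zeta>. f \<zeta> - g \<zeta>) z = poisson f z - poisson g z"
  unfolding poisson_eq_kernel scaleR_right_diff_distrib
  by (intro Bochner_Integration.integral_diff integrable_poisson_kernel_mult assms)

lemma poisson_bounded_linear:
  assumes "bounded_linear T" "integrable \<mu> f" "norm z < 1"
  shows "poisson (\<lambda>\<zeta>. T (f \<zeta>)) z = T (poisson f z)"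
proof -
  interpret bounded_linear T by fact
  show ?thesis unfolding poisson_eq_kernel scaleR[symmetric]
    by (intro integral_bounded_linear integrable_poisson_kernel_mult assms)
qed

lemma poisson_cong_AE:
  assumes "f \<in> borel_measurable \<mu>" "g \<in> borel_measurable \<mu>" "AE \<zeta> in \<mu>. f \<zeta> = g \<zeta>"
  shows "poisson f z = poisson g z"
  unfolding poisson_eq_kernel using assms by (intro integral_cong_AE) auto

lemma poisson_mono:
  fixes f g :: "complex \<Rightarrow> real"
  assumes "integrable \<mu> f" "integrable \<mu> g" "AE \<zeta> in \<mu>. f \<zeta> \<le> g \<zeta>" "norm z < 1"
  shows "poisson f z \<le> poisson g z"
  unfolding poisson_eq_kernel
proof (intro integral_mono_AE integrable_poisson_kernel_mult assms)
  show "AE \<zeta> in \<mu>. poisson_kernel z \<zeta> *\<^sub>R f \<zeta> \<le> poisson_kernel z \<zeta> *\<^sub>R g \<zeta>"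
    using assms(3) AE_circle_norm
    by eventually_elim (auto intro!: mult_left_mono less_imp_le[OF poisson_kernel_bounds(1)] assms)
qed

lemma norm_poisson_le:
  fixes f :: "complex \<Rightarrow> 'a::{banach, second_countable_topology}"
  assumes "norm z < 1"
  shows "norm (poisson f z) \<le> poisson (\<lambda>\<zeta>. norm (f \<zeta>)) z"
proof -
  have "norm (poisson f z) \<le> (LINT \<zeta>|\<mu>. norm (poisson_kernel z \<zeta> *\<^sub>R f \<zeta>))"
    unfolding poisson_eq_kernel by (rule integral_norm_bound)
  also have "\<dots> = poisson (\<lambda>\<zeta>. norm (f \<zeta>)) z"
    unfolding poisson_eq_kernel using assms
    by (intro Bochner_Integration.integral_cong) (auto simp: abs_of_pos poisson_kernel_bounds)
  finally show ?thesis .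
qed

lemma norm_poisson_le_bound:
  fixes f :: "complex \<Rightarrow> 'a::{banach, second_countable_topology}"
  assumes "f \<in> borel_measurable \<mu>" "AE \<zeta> in \<mu>. norm (f \<zeta>) \<le> B" "norm z < 1"
  shows "norm (poisson f z) \<le> B"
proof -
  have "integrable \<mu> f" using integrable_circle_bounded assms by blast
  then have "poisson (\<lambda>\<zeta>. norm (f \<zeta>)) z \<le> poisson (\<lambda>_. B) z"
    using assms by (intro poisson_mono) auto
  then show ?thesis using norm_poisson_le[of z f] poisson_const_real[of z B] assms by simp
qed

lemma norm_poisson_le_L1:
  fixes f :: "complex \<Rightarrow> 'a::{banach, second_countable_topology}"
  assumes "integrable \<mu> f" "norm z < 1"
  shows "norm (poisson f z) \<le> 2 / (1 - norm z) * (LINT \<zeta>|\<mu>. norm (f \<zeta>))"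
proof -
  have "norm (poisson f z) \<le> (LINT \<zeta>|\<mu>. norm (poisson_kernel z \<zeta> *\<^sub>R f \<zeta>))"
    unfolding poisson_eq_kernel by (rule integral_norm_bound)
  also have "\<dots> \<le> (LINT \<zeta>|\<mu>. 2 / (1 - norm z) * norm (f \<zeta>))"
    using assms norm_poisson_kernel_scaleR_le[OF assms(2), of _ "f _"]
    by (intro integral_mono integrable_norm integrable_poisson_kernel_mult) auto
  finally show ?thesis by simp
qed

section \<open>Convergence in mean of dilated Poisson integrals\<close>

lemma norm_radial_less:
  assumes "0 \<le> r" "r < 1" "norm (\<zeta>::complex) = 1" shows "norm (of_real r * \<zeta>) < 1"
  using assms by (simp add: norm_mult)

text \<open>
For two points of the circle \<open>\<bar>\<xi> - r \<zeta>\<bar> = \<bar>\<zeta> - r \<xi>\<bar>\<close>. This symmetry turns the total mass 1 of the kernel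
in one variable into the contraction estimate below.
\<close>

lemma poisson_kernel_swap:
  assumes "norm \<zeta> = 1" "norm \<xi> = 1"
  shows "poisson_kernel (of_real r * \<zeta>) \<xi> = poisson_kernel (of_real r * \<xi>) \<zeta>"
proof -
  have 1: "w * cnj w = 1" if "norm w = 1" for w :: complex using that by (simp add: complex_norm_square[symmetric])
  have "\<xi> - of_real r * \<zeta> = \<xi> * \<zeta> * cnj (\<zeta> - of_real r * \<xi>)"
    using 1[OF assms(1)] 1[OF assms(2)] by (simp add: algebra_simps)
  then have "norm (\<xi> - of_real r * \<zeta>) = norm (\<zeta> - of_real r * \<xi>)"
    using assms by (simp add: norm_mult del: complex_cnj_diff)
  then show ?thesis using assms by (simp add: poisson_kernel_def norm_mult)
qed

lemma measurable_poisson_radial [measurable]: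
  fixes f :: "complex \<Rightarrow> 'a::{banach, second_countable_topology}"
  assumes [measurable]: "f \<in> borel_measurable \<mu>"
  shows "(\<lambda>\<zeta>. poisson f (of_real r * \<zeta>)) \<in> borel_measurable \<mu>"
proof -
  have "(\<lambda>(\<zeta>, \<xi>). poisson_kernel (of_real r * \<zeta>) \<xi> *\<^sub>R f \<xi>) \<in> borel_measurable (\<mu> \<Otimes>\<^sub>M \<mu>)"
    unfolding split_beta by measurable
  then show ?thesis unfolding poisson_eq_kernel
    by (rule circle.borel_measurable_lebesgue_integral)
qed

lemma integrable_poisson_radial:
  fixes f :: "complex \<Rightarrow> 'a::{banach, second_countable_topology}"
  assumes "integrable \<mu> f" "0 \<le> r" "r < 1"
  shows "integrable \<mu> (\<lambda>\<zeta>. poisson f (of_real r * \<zeta>))"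
proof (rule integrable_circle_bounded)
  show "(\<lambda>\<zeta>. poisson f (of_real r * \<zeta>)) \<in> borel_measurable \<mu>" using assms by measurable
  show "AE \<zeta> in \<mu>. norm (poisson f (of_real r * \<zeta>)) \<le> 2 / (1 - r) * (LINT \<zeta>|\<mu>. norm (f \<zeta>))"
  proof (rule AE_I2)
    fix \<zeta> assume "\<zeta> \<in> space \<mu>"
    then have "norm (of_real r * \<zeta>) = r" using assms by (simp add: norm_mult)
    then show "norm (poisson f (of_real r * \<zeta>)) \<le> 2 / (1 - r) * (LINT \<zeta>|\<mu>. norm (f \<zeta>))"
      using norm_poisson_le_L1[OF assms(1), of "of_real r * \<zeta>"] assms by simp
  qed
qed

lemma poisson_radial_L1_le:
  fixes f :: "complex \<Rightarrow> 'a::{banach, second_countable_topology}"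
  assumes f: "integrable \<mu> f" and r: "0 \<le> r" "r < 1"
  shows "(LINT \<zeta>|\<mu>. norm (poisson f (of_real r * \<zeta>))) \<le> (LINT \<zeta>|\<mu>. norm (f \<zeta>))"
proof -
  interpret pair_sigma_finite \<mu> \<mu> ..
  let ?g = "\<lambda>\<zeta> \<xi>. poisson_kernel (of_real r * \<zeta>) \<xi> * norm (f \<xi>)"
  have [measurable]: "f \<in> borel_measurable \<mu>" using f by simp
  have fn: "integrable \<mu> (\<lambda>\<xi>. norm (f \<xi>))" using f by simp
  have gp: "?g \<zeta> \<xi> = poisson_kernel (of_real r * \<zeta>) \<xi> *\<^sub>R norm (f \<xi>)" for \<zeta> \<xi> by simp
  have nr: "norm (of_real r * \<zeta>) < 1" if "norm \<zeta> = 1" for \<zeta> :: complex using norm_radial_less[OF r that] .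
  have int: "integrable (\<mu> \<Otimes>\<^sub>M \<mu>) (\<lambda>(\<zeta>, \<xi>). ?g \<zeta> \<xi>)"
  proof (rule Fubini_integrable)
    show "(\<lambda>(\<zeta>, \<xi>). ?g \<zeta> \<xi>) \<in> borel_measurable (\<mu> \<Otimes>\<^sub>M \<mu>)" unfolding split_beta by measurable
    have "integrable \<mu> (\<lambda>\<zeta>. poisson (\<lambda>\<xi>. norm (f \<xi>)) (of_real r * \<zeta>))"
      using fn r by (rule integrable_poisson_radial)
    also have "?this \<longleftrightarrow> integrable \<mu> (\<lambda>\<zeta>. LINT \<xi>|\<mu>. norm (?g \<zeta> \<xi>))"
    proof (intro Bochner_Integration.integrable_cong refl)
      fix \<zeta> assume "\<zeta> \<in> space \<mu>"
      then have "\<bar>poisson_kernel (of_real r * \<zeta>) \<xi>\<bar> = poisson_kernel (of_real r * \<zeta>) \<xi>" if "\<xi> \<in> space \<mu>" for \<xi>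
        using poisson_kernel_bounds(1)[OF nr, of \<zeta> \<xi>] that by simp
      then show "poisson (\<lambda>\<xi>. norm (f \<xi>)) (of_real r * \<zeta>) = (LINT \<xi>|\<mu>. norm (?g \<zeta> \<xi>))"
        unfolding poisson_eq_kernel
        by (intro Bochner_Integration.integral_cong refl) (simp add: abs_mult)
    qed
    finally show "integrable \<mu> (\<lambda>\<zeta>. LINT \<xi>|\<mu>. norm (case (\<zeta>, \<xi>) of (\<zeta>, \<xi>) \<Rightarrow> ?g \<zeta> \<xi>))"
      by simp
    show "AE \<zeta> in \<mu>. integrable \<mu> (\<lambda>\<xi>. case (\<zeta>, \<xi>) of (\<zeta>, \<xi>) \<Rightarrow> ?g \<zeta> \<xi>)"
      using fn nr by (intro AE_I2) (auto simp: gp simp del: real_scaleR_def intro!: integrable_poisson_kernel_mult)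
  qed
  have "(LINT \<zeta>|\<mu>. norm (poisson f (of_real r * \<zeta>))) \<le> (LINT \<zeta>|\<mu>. (LINT \<xi>|\<mu>. ?g \<zeta> \<xi>))"
  proof (rule integral_mono)
    show "integrable \<mu> (\<lambda>\<zeta>. norm (poisson f (of_real r * \<zeta>)))"
      by (intro integrable_norm integrable_poisson_radial assms)
    show "integrable \<mu> (\<lambda>\<zeta>. LINT \<xi>|\<mu>. ?g \<zeta> \<xi>)" using integrable_fst[OF int] by simp
    fix \<zeta> assume "\<zeta> \<in> space \<mu>"
    then show "norm (poisson f (of_real r * \<zeta>)) \<le> (LINT \<xi>|\<mu>. ?g \<zeta> \<xi>)"
      using norm_poisson_le[OF nr[of \<zeta>], of f] by (simp add: poisson_eq_kernel)
  qed
  also have "\<dots> = (LINT \<xi>|\<mu>. (LINT \<zeta>|\<mu>. ?g \<zeta> \<xi>))" by (rule Fubini_integral[OF int, symmetric])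
  also have "\<dots> = (LINT \<xi>|\<mu>. norm (f \<xi>))"
  proof (intro Bochner_Integration.integral_cong refl)
    fix \<xi> assume x: "\<xi> \<in> space \<mu>"
    have "(LINT \<zeta>|\<mu>. poisson_kernel (of_real r * \<zeta>) \<xi>) = (LINT \<zeta>|\<mu>. poisson_kernel (of_real r * \<xi>) \<zeta>)"
      using x by (intro Bochner_Integration.integral_cong poisson_kernel_swap) auto
    then show "(LINT \<zeta>|\<mu>. ?g \<zeta> \<xi>) = norm (f \<xi>)" using x by (simp add: poisson_kernel_integral nr)
  qed
  finally show ?thesis .
qed

text \<open>
The approximate identity argument: near \<open>\<zeta>\<close> the function varies little, and away from \<open>\<zeta>\<close> the kernel is at
most \<open>4 (1 - r\<^sup>2) / d\<^sup>2\<close>.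
\<close>

lemma poisson_radial_tendsto_continuous:
  fixes \<theta> :: "complex \<Rightarrow> real"
  assumes \<theta>: "continuous_on UNIV \<theta>" "\<And>x. \<bar>\<theta> x\<bar> \<le> B" and \<zeta>: "norm \<zeta> = 1"
    and r: "\<And>k. 0 \<le> r k" "\<And>k. r k < 1" "r \<longlonglongrightarrow> 1"
  shows "(\<lambda>k. poisson \<theta> (of_real (r k) * \<zeta>)) \<longlonglongrightarrow> \<theta> \<zeta>"
proof (rule LIMSEQ_I)
  fix e :: real assume e: "e > 0"
  obtain d where d: "d > 0" "\<And>\<xi>. dist \<xi> \<zeta> < d \<Longrightarrow> \<bar>\<theta> \<xi> - \<theta> \<zeta>\<bar> < e/2"
    using \<theta>(1) e half_gt_zero unfolding continuous_on_iff dist_real_def by (metis UNIV_I)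
  have B: "B \<ge> 0" using \<theta>(2)[of 0] by linarith
  \<comment> \<open>Beyond distance \<open>d\<close> the kernel at \<open>z\<close> is at most \<open>(1 - r\<^sup>2) / (d/2)\<^sup>2\<close> once \<open>1 - r \<le> d/2\<close>.\<close>
  have "(\<lambda>k. 8 * B * (1 - (r k)\<^sup>2) / d\<^sup>2) \<longlonglongrightarrow> 8 * B * (1 - 1\<^sup>2) / d\<^sup>2"
    using d by (intro tendsto_intros r) auto
  then have "eventually (\<lambda>k. 8 * B * (1 - (r k)\<^sup>2) / d\<^sup>2 < e / 2) sequentially"
    using e by (intro order_tendstoD) auto
  moreover have "eventually (\<lambda>k. r k > 1 - d / 2) sequentially"
    using d r(3) by (intro order_tendstoD(1)[of r 1]) auto
  ultimately have "eventually (\<lambda>k. norm (poisson \<theta> (of_real (r k) * \<zeta>) - \<theta> \<zeta>) < e) sequentially"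
  proof eventually_elim
    fix k assume k: "8 * B * (1 - (r k)\<^sup>2) / d\<^sup>2 < e / 2" "r k > 1 - d / 2"
    define z where "z = of_real (r k) * \<zeta>"
    have z: "norm z < 1" "norm z = r k" unfolding z_def using r \<zeta> by (auto simp: norm_mult)
    have i\<theta>: "integrable \<mu> \<theta>" using \<theta>(1) by (intro integrable_circle_continuous) (rule continuous_on_subset, auto)
    have pk: "poisson_kernel z \<xi> * \<bar>\<theta> \<xi> - \<theta> \<zeta>\<bar> \<le> e / 2 * poisson_kernel z \<xi> + 8 * B * (1 - (r k)\<^sup>2) / d\<^sup>2"
      if x: "norm \<xi> = 1" for \<xi>
    proof (cases "dist \<xi> \<zeta> < d")
      case True
      then have "poisson_kernel z \<xi> * \<bar>\<theta> \<xi> - \<theta> \<zeta>\<bar> \<le> poisson_kernel z \<xi> * (e/2)"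
        using d(2)[of \<xi>] poisson_kernel_bounds[OF z(1) x] by (intro mult_left_mono) auto
      moreover have "0 \<le> 8 * B * (1 - (r k)\<^sup>2) / d\<^sup>2"
        using B r(1,2)[of k] by (auto intro!: divide_nonneg_nonneg mult_nonneg_nonneg simp: power_le_one)
      ultimately show ?thesis by (simp add: mult.commute)
    next
      case False
      have "norm (\<zeta> - z) = 1 - r k"
      proof -
        have "\<zeta> - z = of_real (1 - r k) * \<zeta>" by (simp add: z_def algebra_simps)
        then show ?thesis using \<zeta> r(2)[of k] by (simp only: norm_mult norm_of_real) simp
      qed
      moreover have "norm (\<xi> - \<zeta>) \<le> norm (\<xi> - z) + norm (\<zeta> - z)"
        using norm_triangle_ineq4[of "\<xi> - z" "\<zeta> - z"] by simp
      ultimately have "d / 2 \<le> norm (\<xi> - z)" using False k(2) by (simp add: dist_norm)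
      then have "(d/2)\<^sup>2 \<le> (norm (\<xi> - z))\<^sup>2" using d by (intro power_mono) auto
      then have "poisson_kernel z \<xi> \<le> (1 - (r k)\<^sup>2) / (d/2)\<^sup>2"
        unfolding poisson_kernel_def z(2) using r(1,2)[of k] d by (intro divide_left_mono) (auto simp: power_le_one intro!: mult_pos_pos zero_less_power)
      then have "poisson_kernel z \<xi> * \<bar>\<theta> \<xi> - \<theta> \<zeta>\<bar> \<le> (1 - (r k)\<^sup>2) / (d/2)\<^sup>2 * (2 * B)"
        using \<theta>(2)[of \<xi>] \<theta>(2)[of \<zeta>] poisson_kernel_bounds[OF z(1) x] r(1,2)[of k]
        by (intro mult_mono) auto
      also have "\<dots> = 8 * B * (1 - (r k)\<^sup>2) / d\<^sup>2" using d by (simp add: field_simps power2_eq_square)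
      finally show ?thesis using poisson_kernel_bounds[OF z(1) x] e by (simp add: add_increasing)
    qed
    have "\<bar>poisson \<theta> z - \<theta> \<zeta>\<bar> = \<bar>poisson (\<lambda>\<xi>. \<theta> \<xi> - \<theta> \<zeta>) z\<bar>"
      using i\<theta> z by (simp add: poisson_diff poisson_const_real)
    also have "\<dots> \<le> poisson (\<lambda>\<xi>. \<bar>\<theta> \<xi> - \<theta> \<zeta>\<bar>) z" using norm_poisson_le[OF z(1), of "\<lambda>\<xi>. \<theta> \<xi> - \<theta> \<zeta>"] by simp
    also have "\<dots> \<le> (LINT \<xi>|\<mu>. e / 2 * poisson_kernel z \<xi> + 8 * B * (1 - (r k)\<^sup>2) / d\<^sup>2)"
      unfolding poisson_eq_kernel
      using pk z i\<theta> integrable_circle_continuous[OF continuous_on_poisson_kernel[OF z(1)]]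
      by (intro integral_mono integrable_poisson_kernel_mult) auto
    also have "\<dots> = e / 2 + 8 * B * (1 - (r k)\<^sup>2) / d\<^sup>2"
      using z integrable_circle_continuous[OF continuous_on_poisson_kernel[OF z(1)]]
      by (subst Bochner_Integration.integral_add) (auto simp: poisson_kernel_integral circle.prob_space[simplified])
    finally show "norm (poisson \<theta> (of_real (r k) * \<zeta>) - \<theta> \<zeta>) < e" using k(1) by (simp add: z_def)
  qed
  then show "\<exists>no. \<forall>n\<ge>no. norm (poisson \<theta> (of_real (r n) * \<zeta>) - \<theta> \<zeta>) < e"
    by (simp add: eventually_sequentially)
qed

definition radial_L1 :: "(nat \<Rightarrow> real) \<Rightarrow> (complex \<Rightarrow> 'a::{banach, second_countable_topology}) \<Rightarrow> bool" where
  "radial_L1 r f \<longleftrightarrow>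
     (\<lambda>k. LINT \<zeta>|\<mu>. norm (poisson f (of_real (r k) * \<zeta>) - f \<zeta>)) \<longlonglongrightarrow> 0"

text \<open>
Dilated Poisson integrals are contractions in mean, so the set of functions for which they converge is closed
in mean.
\<close>

lemma radial_L1_limit:
  fixes f :: "complex \<Rightarrow> 'a::{banach, second_countable_topology}"
  assumes r: "\<And>k. 0 \<le> r k" "\<And>k. r k < 1"
    and s: "\<And>i. radial_L1 r (s i)" "\<And>i. integrable \<mu> (s i)" and f: "integrable \<mu> f"
    and lim: "(\<lambda>i. LINT \<zeta>|\<mu>. norm (s i \<zeta> - f \<zeta>)) \<longlonglongrightarrow> 0"
  shows "radial_L1 r f"
  unfolding radial_L1_def
proof (rule LIMSEQ_I)
  fix e :: real assume e: "e > 0"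
  obtain i where i: "(LINT \<zeta>|\<mu>. norm (s i \<zeta> - f \<zeta>)) < e / 3"
    using order_tendstoD(2)[OF lim, of "e/3"] e by (auto simp: eventually_sequentially)
  have "eventually (\<lambda>k. (LINT \<zeta>|\<mu>. norm (poisson (s i) (of_real (r k) * \<zeta>) - s i \<zeta>)) < e / 3) sequentially"
    using s(1)[of i] e unfolding radial_L1_def by (intro order_tendstoD(2)) auto
  then have "eventually (\<lambda>k. (LINT \<zeta>|\<mu>. norm (poisson f (of_real (r k) * \<zeta>) - f \<zeta>)) < e) sequentially"
  proof eventually_elim
    fix k assume k: "(LINT \<zeta>|\<mu>. norm (poisson (s i) (of_real (r k) * \<zeta>) - s i \<zeta>)) < e / 3"
    define d where "d \<zeta> = s i \<zeta> - f \<zeta>" for \<zeta>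
    have d: "integrable \<mu> d" unfolding d_def using s f by simp
    note I = integrable_poisson_radial[OF _ r, of _ k]
    have "(LINT \<zeta>|\<mu>. norm (poisson f (of_real (r k) * \<zeta>) - f \<zeta>))
      \<le> (LINT \<zeta>|\<mu>. norm (poisson d (of_real (r k) * \<zeta>))
           + norm (poisson (s i) (of_real (r k) * \<zeta>) - s i \<zeta>) + norm (d \<zeta>))"
    proof (rule integral_mono)
      show "integrable \<mu> (\<lambda>\<zeta>. norm (poisson f (of_real (r k) * \<zeta>) - f \<zeta>))"
        using I[OF f] f by simp
      show "integrable \<mu> (\<lambda>\<zeta>. norm (poisson d (of_real (r k) * \<zeta>))
           + norm (poisson (s i) (of_real (r k) * \<zeta>) - s i \<zeta>) + norm (d \<zeta>))"
        using I[OF d] I[OF s(2)] d s by (intro Bochner_Integration.integrable_add integrable_norm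
          Bochner_Integration.integrable_diff) auto
      fix \<zeta> assume "\<zeta> \<in> space \<mu>"
      then have "poisson d (of_real (r k) * \<zeta>) = poisson (s i) (of_real (r k) * \<zeta>) - poisson f (of_real (r k) * \<zeta>)"
        unfolding d_def using s f r norm_radial_less[OF r, of \<zeta>] by (intro poisson_diff) auto
      then have "poisson f (of_real (r k) * \<zeta>) - f \<zeta> =
        - poisson d (of_real (r k) * \<zeta>) + (poisson (s i) (of_real (r k) * \<zeta>) - s i \<zeta>) + d \<zeta>"
        by (simp add: d_def)
      then show "norm (poisson f (of_real (r k) * \<zeta>) - f \<zeta>) \<le> norm (poisson d (of_real (r k) * \<zeta>))
           + norm (poisson (s i) (of_real (r k) * \<zeta>) - s i \<zeta>) + norm (d \<zeta>)"
        by (metis norm_triangle_mono norm_minus_cancel order_refl)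
    qed
    also have "\<dots> = (LINT \<zeta>|\<mu>. norm (poisson d (of_real (r k) * \<zeta>)))
       + (LINT \<zeta>|\<mu>. norm (poisson (s i) (of_real (r k) * \<zeta>) - s i \<zeta>)) + (LINT \<zeta>|\<mu>. norm (d \<zeta>))"
      using I[OF d] I[OF s(2)] d s by (simp add: integrable_norm)
    also have "\<dots> < e"
      using k i poisson_radial_L1_le[OF d r, of k] unfolding d_def[symmetric] by linarith
    finally show "(LINT \<zeta>|\<mu>. norm (poisson f (of_real (r k) * \<zeta>) - f \<zeta>)) < e" .
  qed
  then show "\<exists>no. \<forall>n\<ge>no. norm ((LINT \<zeta>|\<mu>. norm (poisson f (of_real (r n) * \<zeta>) - f \<zeta>)) - 0) < e"
    by (simp add: eventually_sequentially)
qed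

lemma L1_tendsto_dominated:
  fixes f :: "complex \<Rightarrow> 'a::{banach, second_countable_topology}"
  assumes [measurable]: "f \<in> borel_measurable \<mu>" "\<And>i. s i \<in> borel_measurable \<mu>" and w: "integrable \<mu> w"
    and lim: "AE \<zeta> in \<mu>. (\<lambda>i. s i \<zeta>) \<longlonglongrightarrow> f \<zeta>"
    and b: "\<And>i. AE \<zeta> in \<mu>. norm (s i \<zeta> - f \<zeta>) \<le> w \<zeta>"
  shows "(\<lambda>i. LINT \<zeta>|\<mu>. norm (s i \<zeta> - f \<zeta>)) \<longlonglongrightarrow> 0"
proof -
  have "(\<lambda>i. LINT \<zeta>|\<mu>. norm (s i \<zeta> - f \<zeta>)) \<longlonglongrightarrow> (LINT \<zeta>|\<mu>. 0)"
  proof (rule integral_dominated_convergence[where w = w])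
    show "AE \<zeta> in \<mu>. (\<lambda>i. norm (s i \<zeta> - f \<zeta>)) \<longlonglongrightarrow> 0"
      using lim by eventually_elim (simp add: LIM_zero_iff tendsto_norm_zero_iff)
  qed (use b w in auto)
  then show ?thesis by simp
qed

lemma radial_L1_continuous:
  fixes \<theta> :: "complex \<Rightarrow> real"
  assumes \<theta>: "continuous_on UNIV \<theta>" "\<And>x. \<bar>\<theta> x\<bar> \<le> B"
    and r: "\<And>k. 0 \<le> r k" "\<And>k. r k < 1" "r \<longlonglongrightarrow> 1"
  shows "radial_L1 r \<theta>"
  unfolding radial_L1_def
proof (rule L1_tendsto_dominated[where w = "\<lambda>_. 2 * B"])
  have m[measurable]: "\<theta> \<in> borel_measurable \<mu>"
    using \<theta>(1) by (intro borel_measurable_circle_continuous) (rule continuous_on_subset, auto)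
  then show "\<theta> \<in> borel_measurable \<mu>" .
  show "(\<lambda>\<zeta>. poisson \<theta> (of_real (r i) * \<zeta>)) \<in> borel_measurable \<mu>" for i by measurable
  show "AE \<zeta> in \<mu>. (\<lambda>k. poisson \<theta> (of_real (r k) * \<zeta>)) \<longlonglongrightarrow> \<theta> \<zeta>"
    using poisson_radial_tendsto_continuous[OF \<theta> _ r] by (intro AE_I2) auto
  show "AE \<zeta> in \<mu>. norm (poisson \<theta> (of_real (r i) * \<zeta>) - \<theta> \<zeta>) \<le> 2 * B" for i
  proof (rule AE_I2)
    fix \<zeta> assume "\<zeta> \<in> space \<mu>"
    then have "norm (poisson \<theta> (of_real (r i) * \<zeta>)) \<le> B"
      using norm_radial_less[OF r(1,2), of \<zeta> i] \<theta>(2) by (intro norm_poisson_le_bound m) auto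
    then show "norm (poisson \<theta> (of_real (r i) * \<zeta>) - \<theta> \<zeta>) \<le> 2 * B"
      using \<theta>(2)[of \<zeta>] norm_triangle_ineq4[of "poisson \<theta> (of_real (r i) * \<zeta>)" "\<theta> \<zeta>"] by simp
  qed
qed simp

lemma radial_L1_add:
  fixes f g :: "complex \<Rightarrow> 'a::{banach, second_countable_topology}"
  assumes r: "\<And>k. 0 \<le> r k" "\<And>k. r k < 1"
    and f: "integrable \<mu> f" "radial_L1 r f" and g: "integrable \<mu> g" "radial_L1 r g"
  shows "radial_L1 r (\<lambda>\<zeta>. f \<zeta> + g \<zeta>)"
  unfolding radial_L1_def
proof (rule tendsto_sandwich[of "\<lambda>_. 0"])
  note I = integrable_poisson_radial[OF _ r]
  show "(\<lambda>k. (LINT \<zeta>|\<mu>. norm (poisson f (of_real (r k) * \<zeta>) - f \<zeta>))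
     + (LINT \<zeta>|\<mu>. norm (poisson g (of_real (r k) * \<zeta>) - g \<zeta>))) \<longlonglongrightarrow> 0"
    using tendsto_add[OF f(2)[unfolded radial_L1_def] g(2)[unfolded radial_L1_def]] by simp
  have "(LINT \<zeta>|\<mu>. norm (poisson (\<lambda>\<zeta>. f \<zeta> + g \<zeta>) (of_real (r k) * \<zeta>) - (f \<zeta> + g \<zeta>)))
     \<le> (LINT \<zeta>|\<mu>. norm (poisson f (of_real (r k) * \<zeta>) - f \<zeta>) + norm (poisson g (of_real (r k) * \<zeta>) - g \<zeta>))" for k
  proof (rule integral_mono)
    show "integrable \<mu> (\<lambda>\<zeta>. norm (poisson (\<lambda>\<zeta>. f \<zeta> + g \<zeta>) (of_real (r k) * \<zeta>) - (f \<zeta> + g \<zeta>)))"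
      using f g by (intro integrable_norm Bochner_Integration.integrable_diff I) auto
    show "integrable \<mu> (\<lambda>\<zeta>. norm (poisson f (of_real (r k) * \<zeta>) - f \<zeta>) + norm (poisson g (of_real (r k) * \<zeta>) - g \<zeta>))"
      using f g by (intro Bochner_Integration.integrable_add integrable_norm Bochner_Integration.integrable_diff I) auto
    fix \<zeta> assume "\<zeta> \<in> space \<mu>"
    then have "poisson (\<lambda>\<zeta>. f \<zeta> + g \<zeta>) (of_real (r k) * \<zeta>) = poisson f (of_real (r k) * \<zeta>) + poisson g (of_real (r k) * \<zeta>)"
      using f g norm_radial_less[OF r, of \<zeta>] by (intro poisson_add) auto
    then show "norm (poisson (\<lambda>\<zeta>. f \<zeta> + g \<zeta>) (of_real (r k) * \<zeta>) - (f \<zeta> + g \<zeta>))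
       \<le> norm (poisson f (of_real (r k) * \<zeta>) - f \<zeta>) + norm (poisson g (of_real (r k) * \<zeta>) - g \<zeta>)"
      by (simp add: norm_diff_triangle_ineq)
  qed
  also have "(LINT \<zeta>|\<mu>. norm (poisson f (of_real (r k) * \<zeta>) - f \<zeta>) + norm (poisson g (of_real (r k) * \<zeta>) - g \<zeta>)) =
    (LINT \<zeta>|\<mu>. norm (poisson f (of_real (r k) * \<zeta>) - f \<zeta>))
     + (LINT \<zeta>|\<mu>. norm (poisson g (of_real (r k) * \<zeta>) - g \<zeta>))" for k
    using f g by (intro Bochner_Integration.integral_add integrable_norm Bochner_Integration.integrable_diff I) auto
  finally show "eventually (\<lambda>k. (LINT \<zeta>|\<mu>. norm (poisson (\<lambda>\<zeta>. f \<zeta> + g \<zeta>) (of_real (r k) * \<zeta>) - (f \<zeta> + g \<zeta>)))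
    \<le> (LINT \<zeta>|\<mu>. norm (poisson f (of_real (r k) * \<zeta>) - f \<zeta>))
     + (LINT \<zeta>|\<mu>. norm (poisson g (of_real (r k) * \<zeta>) - g \<zeta>))) sequentially"
    by (intro always_eventually allI)
qed auto

lemma radial_L1_cmult:
  fixes f :: "complex \<Rightarrow> real"
  assumes r: "\<And>k. 0 \<le> r k" "\<And>k. r k < 1" and f: "integrable \<mu> f" "radial_L1 r f"
  shows "radial_L1 r (\<lambda>\<zeta>. f \<zeta> *\<^sub>R (c :: 'a::{banach, second_countable_topology}))"
proof -
  have "(LINT \<zeta>|\<mu>. norm (poisson (\<lambda>\<zeta>. f \<zeta> *\<^sub>R c) (of_real (r k) * \<zeta>) - f \<zeta> *\<^sub>R c)) =
      (LINT \<zeta>|\<mu>. norm (poisson f (of_real (r k) * \<zeta>) - f \<zeta>) * norm c)" for k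
  proof (intro Bochner_Integration.integral_cong refl)
    fix \<zeta> assume "\<zeta> \<in> space \<mu>"
    then have "poisson (\<lambda>\<zeta>. f \<zeta> *\<^sub>R c) (of_real (r k) * \<zeta>) = poisson f (of_real (r k) * \<zeta>) *\<^sub>R c"
      using f norm_radial_less[OF r, of \<zeta>] by (intro poisson_bounded_linear bounded_linear_scaleR_left) auto
    then show "norm (poisson (\<lambda>\<zeta>. f \<zeta> *\<^sub>R c) (of_real (r k) * \<zeta>) - f \<zeta> *\<^sub>R c) =
       norm (poisson f (of_real (r k) * \<zeta>) - f \<zeta>) * norm c"
      by (simp flip: scaleR_left_diff_distrib)
  qed
  then show ?thesis using tendsto_mult_left_zero[OF f(2)[unfolded radial_L1_def], of "norm c"]
    unfolding radial_L1_def by simp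
qed

text \<open>
The indicator of an open set is a limit of continuous functions; the general Borel set is reached by Dynkin's
theorem, open sets being stable under intersection.
\<close>

lemma radial_L1_indicator:
  assumes r: "\<And>k. 0 \<le> r k" "\<And>k. r k < 1" "r \<longlonglongrightarrow> 1" and A: "A \<in> sets borel"
  shows "radial_L1 r (indicator A :: complex \<Rightarrow> real)"
proof -
  have int: "integrable \<mu> (indicator B :: complex \<Rightarrow> real)" if "B \<in> sets borel" for B
    using that by (intro integrable_circle_bounded[of _ 1]) (auto simp: indicator_def)
  have lim: "radial_L1 r (indicator B :: complex \<Rightarrow> real)"
    if "\<And>i. radial_L1 r (s i)" "\<And>i. s i \<in> borel_measurable borel" "\<And>i x. \<bar>s i x\<bar> \<le> 1"
      "\<And>x. (\<lambda>i. s i x) \<longlonglongrightarrow> indicator B x" "B \<in> sets borel" for s :: "nat \<Rightarrow> complex \<Rightarrow> real" and B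
  proof (rule radial_L1_limit[OF r(1,2) that(1)])
    have [measurable]: "s i \<in> borel_measurable borel" "B \<in> sets borel" for i using that by auto
    show "integrable \<mu> (s i)" for i using that(3) by (intro integrable_circle_bounded[of _ 1]) auto
    show "integrable \<mu> (indicator B :: complex \<Rightarrow> real)" using that by (intro int)
    have "\<bar>s i x - indicator B x\<bar> \<le> 2" for i x using that(3)[of i x] by (auto simp: indicator_def)
    then show "(\<lambda>i. LINT \<zeta>|\<mu>. norm (s i \<zeta> - indicator B \<zeta>)) \<longlonglongrightarrow> 0"
      using that(4) by (intro L1_tendsto_dominated[where w = "\<lambda>_. 2"]) auto
  qed
  have "Int_stable {S :: complex set. open S}" by (auto simp: Int_stable_def)
  moreover have "{S :: complex set. open S} \<subseteq> Pow UNIV" by simp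
  moreover have "A \<in> sigma_sets UNIV {S. open S}" using A by (simp add: borel_def)
  ultimately show ?thesis
  proof (induction rule: sigma_sets_induct_disjoint)
    case (basic U)
    then have U: "open U" by simp
    show ?case
    proof (cases "U = UNIV")
      case True
      then have "indicator U = (\<lambda>_::complex. 1::real)" by auto
      then show ?thesis using radial_L1_continuous[of "\<lambda>_. 1" 1 r] r by simp
    next
      case False
      \<comment> \<open>The distance to the empty set is 0 by convention, so \<open>U = UNIV\<close> is a case of its own.\<close>
      define s where "s i x = min 1 (real i * infdist x (- U))" for i x
      have s: "continuous_on UNIV (s i)" "\<bar>s i x\<bar> \<le> 1" for i x
        unfolding s_def by (auto intro!: continuous_intros simp: infdist_nonneg)
      show ?thesis
      proof (rule lim[of s])
        show "radial_L1 r (s i)" for i using s by (intro radial_L1_continuous r)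
        show "s i \<in> borel_measurable borel" for i using s(1) by (rule borel_measurable_continuous_onI)
        show "(\<lambda>i. s i x) \<longlonglongrightarrow> indicator U x" for x
        proof (cases "x \<in> U")
          case True
          have "infdist x (- U) \<noteq> 0"
            using in_closed_iff_infdist_zero[of "- U" x] True U False by auto
          then have p: "infdist x (- U) > 0" using infdist_nonneg[of x "- U"] by linarith
          have "eventually (\<lambda>i. real i \<ge> 1 / infdist x (- U)) sequentially"
            using filterlim_real_sequentially unfolding filterlim_at_top by blast
          then have "eventually (\<lambda>i. s i x = 1) sequentially"
            by eventually_elim (use p in \<open>auto simp: s_def field_simps min_def\<close>)
          then show ?thesis using True by (simp add: tendsto_eventually)
        next
          case False
          then have "infdist x (- U) = 0" by (intro infdist_zero) auto
          then show ?thesis using False by (simp add: s_def)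
        qed
      qed (use s U in auto)
    qed
  next
    case empty
    show ?case using radial_L1_continuous[of "\<lambda>_. 0" 1 r] r by (simp add: indicator_def[abs_def])
  next
    case (compl B)
    then have B: "B \<in> sets borel" by (simp add: borel_def)
    have "radial_L1 r (\<lambda>x. 1 + indicator B x *\<^sub>R (- 1 :: real))"
      using compl int[OF B] r radial_L1_continuous[of "\<lambda>_. 1" 1 r]
      by (intro radial_L1_add radial_L1_cmult) auto
    also have "(\<lambda>x. 1 + indicator B x *\<^sub>R (- 1 :: real)) = indicator (UNIV - B)"
      by (auto simp: indicator_def)
    finally show ?case .
  next
    case (union F)
    then have F: "F i \<in> sets borel" for i by (auto simp: borel_def)
    define s where "s n x = (\<Sum>i<n. indicator (F i) x :: real)" for n x
    have s: "s n x = indicator (\<Union>i<n. F i) x" for n x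
      unfolding s_def using union.hyps(1)
      by (subst indicator_UN_disjoint) (auto simp: disjoint_family_on_def)
    show ?case
    proof (rule lim[of s])
      show "radial_L1 r (s n)" for n
      proof (induction n)
        case 0
        then show ?case using radial_L1_continuous[of "\<lambda>_. 0" 1 r] r by (simp add: s_def[abs_def])
      next
        case (Suc n)
        have "integrable \<mu> (s n)" unfolding s_def using F int by simp
        then have "radial_L1 r (\<lambda>x. s n x + indicator (F n) x)"
          using Suc union int F r by (intro radial_L1_add) auto
        then show ?case by (simp add: s_def[abs_def])
      qed
      show "s i \<in> borel_measurable borel" for i unfolding s_def using F by measurable
      show "(\<lambda>i. s i x) \<longlonglongrightarrow> indicator (\<Union> (range F)) x" for x
        unfolding s using LIMSEQ_indicator_UN[of F x] by simp
    qed (use F in \<open>auto simp: s indicator_def\<close>)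
  qed
qed

theorem poisson_radial_L1:
  fixes f :: "complex \<Rightarrow> 'a::{banach, second_countable_topology}"
  assumes f: "integrable \<mu> f" and r: "\<And>k. 0 \<le> r k" "\<And>k. r k < 1" "r \<longlonglongrightarrow> 1"
  shows "(\<lambda>k. LINT \<zeta>|\<mu>. norm (poisson f (of_real (r k) * \<zeta>) - f \<zeta>)) \<longlonglongrightarrow> 0"
proof -
  have "radial_L1 r f" using f
  proof (induction f rule: integrable_induct)
    case (base A c)
    then have A: "A \<in> sets borel" by (auto simp: sets_restrict_space_iff)
    then have "integrable \<mu> (indicator A :: complex \<Rightarrow> real)"
      by (intro integrable_circle_bounded[of _ 1]) (auto simp: indicator_def)
    then show ?case using A r by (intro radial_L1_cmult radial_L1_indicator) auto
  next
    case (add f g)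
    then show ?case using r by (intro radial_L1_add) auto
  next
    case (lim f s)
    show ?case
    proof (rule radial_L1_limit[OF r(1,2) lim(5,1,4)])
      have "norm (s i x - f x) \<le> 3 * norm (f x)" if "x \<in> space \<mu>" for i x
        using norm_triangle_ineq4[of "s i x" "f x"] lim(3)[OF that, of i] by linarith
      then show "(\<lambda>i. LINT \<zeta>|\<mu>. norm (s i \<zeta> - f \<zeta>)) \<longlonglongrightarrow> 0"
        using lim by (intro L1_tendsto_dominated[where w = "\<lambda>x. 3 * norm (f x)"] AE_I2) auto
    qed
  qed
  then show ?thesis by (simp add: radial_L1_def)
qed

section \<open>Bounded functions and the essential supremum\<close>

lemma sup_norm_le_ereal_iff:
  fixes f :: "complex \<Rightarrow> 'a::{banach, second_countable_topology}"
  assumes [measurable]: "f \<in> borel_measurable \<mu>"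
  shows "sup_norm f \<le> ereal B \<longleftrightarrow> (AE \<zeta> in \<mu>. norm (f \<zeta>) \<le> B)"
proof
  assume *: "sup_norm f \<le> ereal B"
  have "AE \<zeta> in \<mu>. ereal (norm (f \<zeta>)) \<le> sup_norm f"
    unfolding sup_norm_def by (rule esssup_AE)
  then show "AE \<zeta> in \<mu>. norm (f \<zeta>) \<le> B"
    by eventually_elim (metis * ereal_less_eq(3) order_trans)
next
  assume "AE \<zeta> in \<mu>. norm (f \<zeta>) \<le> B"
  then show "sup_norm f \<le> ereal B"
    unfolding sup_norm_def by (intro esssup_I) auto
qed

lemma Linf_iff:
  fixes f :: "complex \<Rightarrow> 'a::{banach, second_countable_topology}"
  shows "f \<in> Linf \<longleftrightarrow> f \<in> borel_measurable \<mu> \<and> (\<exists>B. AE \<zeta> in \<mu>. norm (f \<zeta>) \<le> B)"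
proof (cases "f \<in> borel_measurable \<mu>")
  case True
  have "sup_norm f < \<infinity> \<longleftrightarrow> (\<exists>B. sup_norm f \<le> ereal B)"
    by (metis ereal_infty_less(1) less_ereal.simps(4) less_PInf_Ex_of_nat linorder_not_less order_le_less order_less_le_trans)
  then show ?thesis using True by (simp add: Linf_def sup_norm_le_ereal_iff)
qed (simp add: Linf_def)

lemma LinfI:
  fixes f :: "complex \<Rightarrow> 'a::{banach, second_countable_topology}"
  assumes "f \<in> borel_measurable \<mu>" "AE \<zeta> in \<mu>. norm (f \<zeta>) \<le> B"
  shows "f \<in> Linf"
  using assms Linf_iff by blast

lemma LinfE:
  fixes f :: "complex \<Rightarrow> 'a::{banach, second_countable_topology}"
  assumes "f \<in> Linf"
  obtains B where "B > 0" "AE \<zeta> in \<mu>. norm (f \<zeta>) \<le> B"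
proof -
  obtain B where B: "AE \<zeta> in \<mu>. norm (f \<zeta>) \<le> B" using assms Linf_iff by blast
  then have "AE \<zeta> in \<mu>. norm (f \<zeta>) \<le> max 1 B" by eventually_elim simp
  then show ?thesis by (intro that[of "max 1 B"]) auto
qed

lemma Linf_measurable [measurable_dest]:
  "f \<in> Linf \<Longrightarrow> f \<in> borel_measurable \<mu>"
  by (simp add: Linf_def)

lemma Linf_integrable:
  fixes f :: "complex \<Rightarrow> 'a::{banach, second_countable_topology}"
  assumes "f \<in> Linf" shows "integrable \<mu> f"
  using assms LinfE integrable_circle_bounded Linf_measurable by metis

lemma Hinf_Linf: "f \<in> Hinf \<Longrightarrow> f \<in> Linf"
  by (simp add: Hinf_def)

lemma Hinf_measurable [measurable_dest]: "f \<in> Hinf \<Longrightarrow> f \<in> borel_measurable \<mu>"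
  by (simp add: Hinf_Linf Linf_measurable)

lemma Hinf_integrable: "f \<in> Hinf \<Longrightarrow> integrable \<mu> f"
  by (simp add: Hinf_Linf Linf_integrable)

lemma Hinf_iff: "f \<in> Hinf \<longleftrightarrow> f \<in> Linf \<and> poisson f holomorphic_on ball 0 1"
  by (simp add: Hinf_def analytic_on_open)

lemma Hinf_holomorphic: "f \<in> Hinf \<Longrightarrow> poisson f holomorphic_on ball 0 1"
  by (simp add: Hinf_iff)

section \<open>The algebra of bounded analytic functions\<close>

text \<open>
A fixed sequence of radii increasing to 1; the bound \<open>1/2\<close> allows division by it.
\<close>

definition rad :: "nat \<Rightarrow> real" where "rad k = 1 - inverse (real (k + 2))"

lemma rad: "0 \<le> rad k" "rad k < 1" "1 / 2 \<le> rad k" "rad \<longlonglongrightarrow> 1"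
proof -
  show "1 / 2 \<le> rad k" unfolding rad_def by (simp add: field_simps)
  then show "0 \<le> rad k" by linarith
  show "rad k < 1" unfolding rad_def by simp
  have "(\<lambda>k. 1 - inverse (real (k + 2))) \<longlonglongrightarrow> 1 - 0"
    by (intro tendsto_intros LIMSEQ_ignore_initial_segment lim_inverse_n)
  then show "rad \<longlonglongrightarrow> 1" by (simp add: rad_def[abs_def])
qed

lemma holomorphic_dilation:
  assumes "F holomorphic_on ball 0 1" "0 \<le> r" "r < 1"
  shows "continuous_on (cball 0 1) (\<lambda>\<zeta>. F (of_real r * \<zeta>))"
    and "(\<lambda>\<zeta>. F (of_real r * \<zeta>)) holomorphic_on ball 0 1"
proof -
  have 1: "(\<lambda>\<zeta>. of_real r * \<zeta>) ` cball 0 1 \<subseteq> ball (0::complex) 1"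
  proof clarsimp
    fix x :: complex assume "norm x \<le> 1"
    then have "r * norm x \<le> r" using assms by (simp add: mult_left_le)
    then show "norm (of_real r * x) < 1" using assms by (simp add: norm_mult)
  qed
  have "F \<circ> (\<lambda>\<zeta>. of_real r * \<zeta>) holomorphic_on cball 0 1"
    by (rule holomorphic_on_compose_gen[OF _ assms(1) 1]) (intro holomorphic_intros)
  then have *: "(\<lambda>\<zeta>. F (of_real r * \<zeta>)) holomorphic_on cball 0 1" by (simp add: o_def)
  show "continuous_on (cball 0 1) (\<lambda>\<zeta>. F (of_real r * \<zeta>))"
    using * by (rule holomorphic_on_imp_continuous_on)
  show "(\<lambda>\<zeta>. F (of_real r * \<zeta>)) holomorphic_on ball 0 1"
    using * by (rule holomorphic_on_subset) auto
qed

lemma integrable_dilation: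
  assumes "F holomorphic_on ball 0 1" "0 \<le> r" "r < 1"
  shows "integrable \<mu> (\<lambda>\<zeta>. F (of_real r * \<zeta>) :: complex)"
  by (rule integrable_circle_continuous, rule continuous_on_subset[OF holomorphic_dilation(1)[OF assms]]) auto

lemma poisson_dilation:
  assumes "F holomorphic_on ball 0 1" "0 \<le> r" "r < 1" "norm z < 1"
  shows "poisson (\<lambda>\<zeta>. F (of_real r * \<zeta>)) z = F (of_real r * z)"
  using holomorphic_dilation[OF assms(1-3)] assms(4) by (rule poisson_holomorphic)

lemma tendsto_poisson_L1:
  fixes f :: "complex \<Rightarrow> 'a::{banach, second_countable_topology}"
  assumes "integrable \<mu> f" "\<And>k. integrable \<mu> (s k)" "norm z < 1"
    and "(\<lambda>k. LINT \<zeta>|\<mu>. norm (s k \<zeta> - f \<zeta>)) \<longlonglongrightarrow> 0"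
  shows "(\<lambda>k. poisson (s k) z) \<longlonglongrightarrow> poisson f z"
proof (rule LIM_zero_cancel, rule tendsto_norm_zero_cancel, rule tendsto_sandwich[of "\<lambda>_. 0"])
  show "(\<lambda>k. 2 / (1 - norm z) * (LINT \<zeta>|\<mu>. norm (s k \<zeta> - f \<zeta>))) \<longlonglongrightarrow> 0"
    using assms(4) by (rule tendsto_mult_right_zero)
  have "norm (poisson (s k) z - poisson f z) \<le> 2 / (1 - norm z) * (LINT \<zeta>|\<mu>. norm (s k \<zeta> - f \<zeta>))" for k
    using norm_poisson_le_L1[of "\<lambda>\<zeta>. s k \<zeta> - f \<zeta>" z] assms(1-3) by (simp add: poisson_diff)
  then show "eventually (\<lambda>k. norm (poisson (s k) z - poisson f z) \<le>
      2 / (1 - norm z) * (LINT \<zeta>|\<mu>. norm (s k \<zeta> - f \<zeta>))) sequentially"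
    by (intro always_eventually allI)
qed auto

text \<open>
The way from the disc to the circle: \<open>f\<close> is the boundary function of the analytic function \<open>F\<close> as soon as some
sequence of dilations of \<open>F\<close> converges to \<open>f\<close> in mean. Indeed Poisson integrals at a fixed point are continuous
in mean, and \<open>F\<close> reproduces itself on smaller discs.
\<close>

lemma Hinf_boundary:
  assumes F: "F holomorphic_on ball 0 1" and f: "f \<in> Linf"
    and r: "\<And>k. 0 \<le> r k" "\<And>k. r k < 1" "r \<longlonglongrightarrow> 1"
    and lim: "(\<lambda>k. LINT \<zeta>|\<mu>. norm (F (of_real (r k) * \<zeta>) - f \<zeta>)) \<longlonglongrightarrow> 0"
  shows "f \<in> Hinf" and "norm z < 1 \<Longrightarrow> poisson f z = F z"
proof -
  have *: "poisson f z = F z" if z: "norm z < 1" for z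
  proof -
    have "(\<lambda>k. poisson (\<lambda>\<zeta>. F (of_real (r k) * \<zeta>)) z) \<longlonglongrightarrow> poisson f z"
      by (intro tendsto_poisson_L1 Linf_integrable f z lim integrable_dilation F r)
    then have 1: "(\<lambda>k. F (of_real (r k) * z)) \<longlonglongrightarrow> poisson f z"
      by (simp add: poisson_dilation F r z)
    have "isCont F z"
      using F z continuous_on_eq_continuous_at[of "ball 0 1" F] holomorphic_on_imp_continuous_on by auto
    moreover have "(\<lambda>k. of_real (r k) * z) \<longlonglongrightarrow> of_real 1 * z"
      by (intro tendsto_intros r)
    ultimately have "(\<lambda>k. F (of_real (r k) * z)) \<longlonglongrightarrow> F z"
      using isCont_tendsto_compose by fastforce
    with 1 show ?thesis by (rule LIMSEQ_unique)
  qed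
  then show "norm z < 1 \<Longrightarrow> poisson f z = F z" .
  have "poisson f holomorphic_on ball 0 1"
    using F by (subst holomorphic_cong[OF refl, of _ _ F]) (auto simp: *)
  then show "f \<in> Hinf" using f by (simp add: Hinf_iff)
qed

lemma Hinf_continuous_holomorphic:
  assumes "continuous_on (cball 0 1) F" "F holomorphic_on ball 0 1"
  shows "F \<in> Hinf"
proof -
  have "continuous_on (sphere 0 1) F" using assms(1) by (rule continuous_on_subset) auto
  moreover have "bounded (F ` cball 0 1)"
    using assms(1) by (intro compact_imp_bounded compact_continuous_image) auto
  then obtain B where "\<And>x. norm x \<le> 1 \<Longrightarrow> norm (F x) \<le> B"
    unfolding bounded_iff by (metis imageI mem_cball_0)
  ultimately have "F \<in> Linf" by (intro LinfI[of _ B] borel_measurable_circle_continuous AE_I2) auto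
  moreover have "poisson F holomorphic_on ball 0 1"
    using assms by (subst holomorphic_cong[OF refl, of _ _ F]) (auto simp: poisson_holomorphic)
  ultimately show ?thesis by (simp add: Hinf_iff)
qed

lemma Hinf_dilation: "F holomorphic_on ball 0 1 \<Longrightarrow> 0 \<le> r \<Longrightarrow> r < 1 \<Longrightarrow> (\<lambda>\<zeta>. F (of_real r * \<zeta>)) \<in> Hinf"
  by (intro Hinf_continuous_holomorphic holomorphic_dilation)

lemma Hinf_const: "(\<lambda>_. c) \<in> Hinf"
  by (intro Hinf_continuous_holomorphic) auto

lemma Hinf_cong_AE:
  assumes "f \<in> Hinf" "g \<in> borel_measurable \<mu>" "AE \<zeta> in \<mu>. f \<zeta> = g \<zeta>"
  shows "g \<in> Hinf"
proof -
  obtain B where "AE \<zeta> in \<mu>. norm (f \<zeta>) \<le> B" using LinfE[OF Hinf_Linf[OF assms(1)]] by metis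
  with assms(3) have "AE \<zeta> in \<mu>. norm (g \<zeta>) \<le> B" by eventually_elim simp
  then have "g \<in> Linf" using assms by (intro LinfI)
  moreover have "poisson f = poisson g"
    using assms Hinf_measurable[OF assms(1)] by (intro ext poisson_cong_AE)
  ultimately show ?thesis using assms by (simp add: Hinf_iff)
qed

lemma Hinf_add:
  assumes f: "f \<in> Hinf" and g: "g \<in> Hinf"
  shows "(\<lambda>\<zeta>. f \<zeta> + g \<zeta>) \<in> Hinf"
proof -
  obtain A B where A: "AE \<zeta> in \<mu>. norm (f \<zeta>) \<le> A" and B: "AE \<zeta> in \<mu>. norm (g \<zeta>) \<le> B"
    using LinfE[OF Hinf_Linf[OF f]] LinfE[OF Hinf_Linf[OF g]] by metis
  have "AE \<zeta> in \<mu>. norm (f \<zeta> + g \<zeta>) \<le> A + B"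
    using A B by eventually_elim (rule norm_triangle_mono)
  then have "(\<lambda>\<zeta>. f \<zeta> + g \<zeta>) \<in> Linf" using f g by (intro LinfI) (auto dest: Hinf_measurable)
  moreover have "poisson (\<lambda>\<zeta>. f \<zeta> + g \<zeta>) holomorphic_on ball 0 1"
    using Hinf_holomorphic[OF f] Hinf_holomorphic[OF g]
    by (subst holomorphic_cong[OF refl, of _ _ "\<lambda>z. poisson f z + poisson g z"])
       (auto intro!: holomorphic_intros poisson_add Hinf_integrable f g)
  ultimately show ?thesis by (simp add: Hinf_iff)
qed

text \<open>
The product of the dilations of \<open>P f\<close> and \<open>P g\<close> converges in mean to \<open>f g\<close>, because both are bounded. So the
boundary criterion applies to the analytic function \<open>P f \<cdot> P g\<close>.
\<close>

lemma Hinf_mult_poisson: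
  assumes f: "f \<in> Hinf" and g: "g \<in> Hinf"
  shows "(\<lambda>\<zeta>. f \<zeta> * g \<zeta>) \<in> Hinf"
    and "norm z < 1 \<Longrightarrow> poisson (\<lambda>\<zeta>. f \<zeta> * g \<zeta>) z = poisson f z * poisson g z"
proof -
  obtain A B where A: "A > 0" "AE \<zeta> in \<mu>. norm (f \<zeta>) \<le> A" and B: "B > 0" "AE \<zeta> in \<mu>. norm (g \<zeta>) \<le> B"
    using LinfE[OF Hinf_Linf[OF f]] LinfE[OF Hinf_Linf[OF g]] by metis
  note fm[measurable] = Hinf_measurable[OF f] and gm[measurable] = Hinf_measurable[OF g]
  have AB: "AE \<zeta> in \<mu>. norm (f \<zeta> * g \<zeta>) \<le> A * B"
    using A(2) B(2) by eventually_elim (use A(1) in \<open>auto simp: norm_mult intro!: mult_mono\<close>)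
  have L: "(\<lambda>\<zeta>. f \<zeta> * g \<zeta>) \<in> Linf" using AB by (intro LinfI) auto
  have H: "(\<lambda>z. poisson f z * poisson g z) holomorphic_on ball 0 1"
    by (intro holomorphic_intros Hinf_holomorphic f g)
  let ?F = "\<lambda>k \<zeta>. poisson f (of_real (rad k) * \<zeta>)" and ?G = "\<lambda>k \<zeta>. poisson g (of_real (rad k) * \<zeta>)"
  note If = Hinf_integrable[OF f] and Ig = Hinf_integrable[OF g]
  have lim: "(\<lambda>k. LINT \<zeta>|\<mu>. norm (?F k \<zeta> * ?G k \<zeta> - f \<zeta> * g \<zeta>)) \<longlonglongrightarrow> 0"
  proof (rule tendsto_sandwich[of "\<lambda>_. 0"])
    have "(\<lambda>k. A * (LINT \<zeta>|\<mu>. norm (?G k \<zeta> - g \<zeta>)) + B * (LINT \<zeta>|\<mu>. norm (?F k \<zeta> - f \<zeta>))) \<longlonglongrightarrow> A * 0 + B * 0"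
      by (intro tendsto_intros poisson_radial_L1 If Ig rad)
    then show "(\<lambda>k. A * (LINT \<zeta>|\<mu>. norm (?G k \<zeta> - g \<zeta>)) + B * (LINT \<zeta>|\<mu>. norm (?F k \<zeta> - f \<zeta>))) \<longlonglongrightarrow> 0" by simp
    have "(LINT \<zeta>|\<mu>. norm (?F k \<zeta> * ?G k \<zeta> - f \<zeta> * g \<zeta>))
      \<le> A * (LINT \<zeta>|\<mu>. norm (?G k \<zeta> - g \<zeta>)) + B * (LINT \<zeta>|\<mu>. norm (?F k \<zeta> - f \<zeta>))" for k
    proof -
      have i: "integrable \<mu> (\<lambda>\<zeta>. A * norm (?G k \<zeta> - g \<zeta>))" "integrable \<mu> (\<lambda>\<zeta>. B * norm (?F k \<zeta> - f \<zeta>))"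
        by (intro integrable_mult_right integrable_norm Bochner_Integration.integrable_diff
          integrable_poisson_radial If Ig rad)+
      have n: "norm (?F k \<zeta>) \<le> A" "norm (?G k \<zeta>) \<le> B" if "norm \<zeta> = 1" for \<zeta>
        using norm_poisson_le_bound[OF fm A(2) norm_radial_less] norm_poisson_le_bound[OF gm B(2) norm_radial_less] that rad by auto
      have b: "AE \<zeta> in \<mu>. norm (?F k \<zeta> * ?G k \<zeta> - f \<zeta> * g \<zeta>) \<le> A * norm (?G k \<zeta> - g \<zeta>) + B * norm (?F k \<zeta> - f \<zeta>)"
        using AE_circle_norm B(2)
      proof eventually_elim
        case (elim \<zeta>)
        have "?F k \<zeta> * ?G k \<zeta> - f \<zeta> * g \<zeta> = ?F k \<zeta> * (?G k \<zeta> - g \<zeta>) + g \<zeta> * (?F k \<zeta> - f \<zeta>)"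
          by (simp add: algebra_simps)
        also have "norm \<dots> \<le> A * norm (?G k \<zeta> - g \<zeta>) + B * norm (?F k \<zeta> - f \<zeta>)"
          using n[of \<zeta>] elim by (intro norm_triangle_mono) (auto simp: norm_mult intro!: mult_right_mono)
        finally show ?case .
      qed
      have "(LINT \<zeta>|\<mu>. norm (?F k \<zeta> * ?G k \<zeta> - f \<zeta> * g \<zeta>))
        \<le> (LINT \<zeta>|\<mu>. A * norm (?G k \<zeta> - g \<zeta>) + B * norm (?F k \<zeta> - f \<zeta>))"
      proof (rule integral_mono_AE)
        show "integrable \<mu> (\<lambda>\<zeta>. norm (?F k \<zeta> * ?G k \<zeta> - f \<zeta> * g \<zeta>))"
        proof (rule Bochner_Integration.integrable_bound[OF Bochner_Integration.integrable_add[OF i]])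
          show "(\<lambda>\<zeta>. norm (?F k \<zeta> * ?G k \<zeta> - f \<zeta> * g \<zeta>)) \<in> borel_measurable \<mu>" by measurable
          show "AE \<zeta> in \<mu>. norm (norm (?F k \<zeta> * ?G k \<zeta> - f \<zeta> * g \<zeta>))
            \<le> norm (A * norm (?G k \<zeta> - g \<zeta>) + B * norm (?F k \<zeta> - f \<zeta>))"
            using b by eventually_elim (unfold real_norm_def abs_norm_cancel, rule order_trans[OF _ abs_ge_self])
        qed
      qed (use i b in auto)
      also have "\<dots> = A * (LINT \<zeta>|\<mu>. norm (?G k \<zeta> - g \<zeta>)) + B * (LINT \<zeta>|\<mu>. norm (?F k \<zeta> - f \<zeta>))"
        using i by simp
      finally show ?thesis .
    qed
    then show "eventually (\<lambda>k. (LINT \<zeta>|\<mu>. norm (?F k \<zeta> * ?G k \<zeta> - f \<zeta> * g \<zeta>))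
      \<le> A * (LINT \<zeta>|\<mu>. norm (?G k \<zeta> - g \<zeta>)) + B * (LINT \<zeta>|\<mu>. norm (?F k \<zeta> - f \<zeta>))) sequentially"
      by (intro always_eventually allI)
  qed auto
  show "(\<lambda>\<zeta>. f \<zeta> * g \<zeta>) \<in> Hinf" by (rule Hinf_boundary(1)[OF H L rad(1,2,4) lim])
  show "norm z < 1 \<Longrightarrow> poisson (\<lambda>\<zeta>. f \<zeta> * g \<zeta>) z = poisson f z * poisson g z"
    by (rule Hinf_boundary(2)[OF H L rad(1,2,4) lim])
qed

lemmas Hinf_mult = Hinf_mult_poisson(1) and poisson_mult = Hinf_mult_poisson(2)

lemma Hinf_cmult: "f \<in> Hinf \<Longrightarrow> (\<lambda>\<zeta>. c * f \<zeta>) \<in> Hinf"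
  by (intro Hinf_mult Hinf_const)

lemma Hinf_diff: "f \<in> Hinf \<Longrightarrow> g \<in> Hinf \<Longrightarrow> (\<lambda>\<zeta>. f \<zeta> - g \<zeta>) \<in> Hinf"
  using Hinf_add[of f "\<lambda>\<zeta>. (-1) * g \<zeta>"] Hinf_cmult[of g "-1"] by simp

lemma Hinf_sum:
  "(\<And>i. i \<in> I \<Longrightarrow> f i \<in> Hinf) \<Longrightarrow> (\<lambda>\<zeta>. \<Sum>i\<in>I. f i \<zeta>) \<in> Hinf"
  by (induction I rule: infinite_finite_induct) (auto intro: Hinf_add Hinf_const)

lemma Hinf_power: "(\<lambda>\<zeta>. \<zeta> ^ n) \<in> Hinf"
  by (intro Hinf_continuous_holomorphic) (auto intro!: continuous_intros holomorphic_intros)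

text \<open>
The Poisson kernel is bounded on smaller discs, so convergence in mean on the circle entails locally uniform
convergence of the analytic functions in the disc.
\<close>

lemma Hinf_L1_limit:
  assumes s: "\<And>j. s j \<in> Hinf" and f: "f \<in> Linf"
    and lim: "(\<lambda>j. LINT \<zeta>|\<mu>. norm (s j \<zeta> - f \<zeta>)) \<longlonglongrightarrow> 0"
  shows "f \<in> Hinf"
proof -
  have "poisson f holomorphic_on ball 0 1"
  proof (rule holomorphic_uniform_sequence[of _ "\<lambda>j. poisson (s j)"])
    show "poisson (s j) holomorphic_on ball 0 1" for j using s by (rule Hinf_holomorphic)
    fix x :: complex assume "x \<in> ball 0 1"
    then have x: "norm x < 1" by simp
    define d where "d = (1 - norm x) / 2"
    have d: "d > 0" using x by (simp add: d_def)
    have n: "norm z \<le> 1 - d" if "z \<in> cball x d" for z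
      using norm_triangle_ineq2[of z x] that unfolding d_def by (simp add: dist_norm norm_minus_commute field_simps)
    have "uniform_limit (cball x d) (\<lambda>j. poisson (s j)) (poisson f) sequentially"
    proof (rule uniform_limitI)
      fix e :: real assume e: "e > 0"
      have "eventually (\<lambda>j. 2 / d * (LINT \<zeta>|\<mu>. norm (s j \<zeta> - f \<zeta>)) < e) sequentially"
        using tendsto_mult_right_zero[OF lim, of "2/d"] e by (intro order_tendstoD) auto
      then show "eventually (\<lambda>j. \<forall>z\<in>cball x d. dist (poisson (s j) z) (poisson f z) < e) sequentially"
      proof eventually_elim
        case (elim j)
        show ?case
        proof
          fix z assume "z \<in> cball x d"
          then have z: "norm z \<le> 1 - d" by (rule n)
          have "dist (poisson (s j) z) (poisson f z) = norm (poisson (\<lambda>\<zeta>. s j \<zeta> - f \<zeta>) z)"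
            using z d by (simp add: dist_norm poisson_diff Hinf_integrable s Linf_integrable f)
          also have "\<dots> \<le> 2 / (1 - norm z) * (LINT \<zeta>|\<mu>. norm (s j \<zeta> - f \<zeta>))"
            using z d by (intro norm_poisson_le_L1 Bochner_Integration.integrable_diff Hinf_integrable s Linf_integrable f) auto
          also have "\<dots> \<le> 2 / d * (LINT \<zeta>|\<mu>. norm (s j \<zeta> - f \<zeta>))"
            using z d by (intro mult_right_mono divide_left_mono Bochner_Integration.integral_nonneg) auto
          finally show "dist (poisson (s j) z) (poisson f z) < e" using elim by simp
        qed
      qed
    qed
    moreover have "cball x d \<subseteq> ball 0 1" using n d by fastforce
    ultimately show "\<exists>d>0. cball x d \<subseteq> ball 0 1 \<and> uniform_limit (cball x d) (\<lambda>j. poisson (s j)) (poisson f) sequentially"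
      using d by blast
  qed auto
  then show ?thesis using f by (simp add: Hinf_iff)
qed

text \<open>
Division by the coordinate function, after removing the value at the origin, stays in \<open>H\<^sup>\<infinity>\<close>. Iterated, it
separates the finitely many negative frequencies of \<open>\<zeta>\<^sup>-\<^sup>n h(\<zeta>)\<close>.
\<close>

lemma Hinf_divide_id:
  assumes f: "f \<in> Hinf"
  shows "(\<lambda>\<zeta>. (f \<zeta> - poisson f 0) / \<zeta>) \<in> Hinf"
proof -
  let ?a = "poisson f 0"
  define F where "F z = (if z = 0 then deriv (poisson f) 0 else (poisson f z - ?a) / (z - 0))" for z
  have F: "F holomorphic_on ball 0 1"
    unfolding F_def using Hinf_holomorphic[OF f] by (intro pole_lemma_open) auto
  obtain B where B: "B > 0" "AE \<zeta> in \<mu>. norm (f \<zeta>) \<le> B" using LinfE[OF Hinf_Linf[OF f]] by metis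
  note fm[measurable] = Hinf_measurable[OF f]
  have Pb: "norm (poisson f z) \<le> B" if "norm z < 1" for z
    using norm_poisson_le_bound[OF fm B(2) that] .
  have L: "(\<lambda>\<zeta>. (f \<zeta> - ?a) / \<zeta>) \<in> Linf"
  proof (rule LinfI[of _ "B + B"])
    show "AE \<zeta> in \<mu>. norm ((f \<zeta> - ?a) / \<zeta>) \<le> B + B"
      using B(2) AE_circle_norm
    proof eventually_elim
      case (elim \<zeta>)
      then have "norm (f \<zeta> - ?a) \<le> B + B"
        using Pb[of 0] norm_triangle_ineq4[of "f \<zeta>" ?a] by simp
      then show ?case using elim by (simp add: norm_divide)
    qed
  qed simp
  let ?F = "\<lambda>k \<zeta>. poisson f (of_real (rad k) * \<zeta>)"
  have i: "integrable \<mu> (\<lambda>\<zeta>. norm (?F k \<zeta> - f \<zeta>))" for k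
    by (intro integrable_norm Bochner_Integration.integrable_diff integrable_poisson_radial Hinf_integrable f rad)
  show ?thesis
  proof (rule Hinf_boundary(1)[OF F L rad(1,2,4)], rule tendsto_sandwich[of "\<lambda>_. 0"])
    have "(\<lambda>k. (LINT \<zeta>|\<mu>. norm (?F k \<zeta> - f \<zeta>)) + (B + B) * (1 / rad k - 1)) \<longlonglongrightarrow> 0 + (B + B) * (1 / 1 - 1)"
      by (intro tendsto_intros poisson_radial_L1 Hinf_integrable f rad) simp
    then show "(\<lambda>k. (LINT \<zeta>|\<mu>. norm (?F k \<zeta> - f \<zeta>)) + (B + B) * (1 / rad k - 1)) \<longlonglongrightarrow> 0" by simp
    have "(LINT \<zeta>|\<mu>. norm (F (of_real (rad k) * \<zeta>) - (f \<zeta> - ?a) / \<zeta>))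
       \<le> (LINT \<zeta>|\<mu>. norm (?F k \<zeta> - f \<zeta>) + (B + B) * (1 / rad k - 1))" for k
    proof (rule integral_mono)
      show "integrable \<mu> (\<lambda>\<zeta>. norm (F (of_real (rad k) * \<zeta>) - (f \<zeta> - ?a) / \<zeta>))"
        by (intro integrable_norm Bochner_Integration.integrable_diff integrable_dilation F rad Linf_integrable L)
      show "integrable \<mu> (\<lambda>\<zeta>. norm (?F k \<zeta> - f \<zeta>) + (B + B) * (1 / rad k - 1))" using i by simp
      fix \<zeta> assume "\<zeta> \<in> space \<mu>"
      then have z: "norm \<zeta> = 1" "\<zeta> \<noteq> 0" by auto
      have r: "rad k > 0" using rad(3)[of k] by linarith
      have "F (of_real (rad k) * \<zeta>) - (f \<zeta> - ?a) / \<zeta> =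
         ((?F k \<zeta> - f \<zeta>) + of_real (1 / rad k - 1) * (?F k \<zeta> - ?a)) / \<zeta>"
        using z r by (simp add: F_def field_simps)
      also have "norm \<dots> \<le> norm (?F k \<zeta> - f \<zeta>) + (1 / rad k - 1) * norm (?F k \<zeta> - ?a)"
        using z norm_triangle_ineq[of "?F k \<zeta> - f \<zeta>" "of_real (1 / rad k - 1) * (?F k \<zeta> - ?a)"] r rad(2)[of k]
        by (simp add: norm_divide norm_mult del: of_real_diff of_real_divide)
      also have "\<dots> \<le> norm (?F k \<zeta> - f \<zeta>) + (1 / rad k - 1) * (B + B)"
      proof -
        have "norm (?F k \<zeta> - ?a) \<le> B + B"
          using Pb[OF norm_radial_less[OF rad(1,2) z(1)], of k] Pb[of 0] norm_triangle_ineq4[of "?F k \<zeta>" ?a] by simp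
        then show ?thesis using r rad(2)[of k] by (intro add_left_mono mult_left_mono) auto
      qed
      finally show "norm (F (of_real (rad k) * \<zeta>) - (f \<zeta> - ?a) / \<zeta>)
        \<le> norm (?F k \<zeta> - f \<zeta>) + (B + B) * (1 / rad k - 1)" by (simp add: mult.commute)
    qed
    also have "(LINT \<zeta>|\<mu>. norm (?F k \<zeta> - f \<zeta>) + (B + B) * (1 / rad k - 1)) =
      (LINT \<zeta>|\<mu>. norm (?F k \<zeta> - f \<zeta>)) + (B + B) * (1 / rad k - 1)" for k
      using i by (simp add: circle.prob_space[simplified])
    finally show "eventually (\<lambda>k. (LINT \<zeta>|\<mu>. norm (F (of_real (rad k) * \<zeta>) - (f \<zeta> - ?a) / \<zeta>)) \<le>
      (LINT \<zeta>|\<mu>. norm (?F k \<zeta> - f \<zeta>)) + (B + B) * (1 / rad k - 1)) sequentially"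
      by (intro always_eventually allI)
  qed auto
qed

lemma AE_eq_0_if_poisson_0:
  fixes f :: "complex \<Rightarrow> 'a::{banach, second_countable_topology}"
  assumes f: "integrable \<mu> f" and 0: "\<And>z. norm z < 1 \<Longrightarrow> poisson f z = 0"
  shows "AE \<zeta> in \<mu>. f \<zeta> = 0"
proof -
  have "(LINT \<zeta>|\<mu>. norm (poisson f (of_real (rad k) * \<zeta>) - f \<zeta>)) = (LINT \<zeta>|\<mu>. norm (f \<zeta>))" for k
    using 0 norm_radial_less[OF rad(1,2)] by (intro Bochner_Integration.integral_cong) auto
  then have "(LINT \<zeta>|\<mu>. norm (f \<zeta>)) = 0"
    using poisson_radial_L1[OF f rad(1,2,4)] by (simp add: LIMSEQ_const_iff)
  then show ?thesis using f by (subst (asm) integral_nonneg_eq_0_iff_AE) auto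
qed

section \<open>The Schwarz integral\<close>

definition cauchy_transform :: "(complex \<Rightarrow> real) \<Rightarrow> complex \<Rightarrow> complex" where
  "cauchy_transform u z = (LINT \<zeta>|\<mu>. of_real (u \<zeta>) / (1 - z * cnj \<zeta>))"

definition fourier_coeff :: "(complex \<Rightarrow> real) \<Rightarrow> nat \<Rightarrow> complex" where
  "fourier_coeff u n = (LINT \<zeta>|\<mu>. of_real (u \<zeta>) * cnj \<zeta> ^ n)"

lemma integrable_mult_continuous:
  fixes u :: "complex \<Rightarrow> real" and g :: "complex \<Rightarrow> complex"
  assumes u: "integrable \<mu> u" and g: "continuous_on (sphere 0 1) g"
  shows "integrable \<mu> (\<lambda>\<zeta>. of_real (u \<zeta>) * g \<zeta>)"
proof -
  have "compact (g ` sphere 0 1)" using g by (intro compact_continuous_image) auto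
  then obtain B where B: "\<And>x. x \<in> sphere 0 1 \<Longrightarrow> norm (g x) \<le> B"
    using compact_imp_bounded bounded_iff by (metis imageI)
  have [measurable]: "g \<in> borel_measurable \<mu>" using g by (rule borel_measurable_circle_continuous)
  show ?thesis
  proof (rule Bochner_Integration.integrable_bound)
    show "integrable \<mu> (\<lambda>\<zeta>. B * u \<zeta>)" using u by simp
    show "(\<lambda>\<zeta>. of_real (u \<zeta>) * g \<zeta>) \<in> borel_measurable \<mu>" using u by measurable
    show "AE \<zeta> in \<mu>. norm (of_real (u \<zeta>) * g \<zeta>) \<le> norm (B * u \<zeta>)"
    proof (rule AE_I2)
      fix \<zeta> assume "\<zeta> \<in> space \<mu>"
      then have "norm (g \<zeta>) \<le> \<bar>B\<bar>" using B[of \<zeta>] by auto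
      then show "norm (of_real (u \<zeta>) * g \<zeta>) \<le> norm (B * u \<zeta>)"
        by (simp add: norm_mult abs_mult) (metis abs_ge_zero mult.commute mult_left_mono)
    qed
  qed
qed

text \<open>
A quantitative expansion into a power series. Besides analyticity it yields the uniform approximation of
\<open>P u (r \<zeta>)\<close> by trigonometric polynomials.
\<close>

lemma cauchy_transform_remainder:
  assumes u: "integrable \<mu> u" and z: "norm z < 1"
  shows "norm (cauchy_transform u z - (\<Sum>n<N. fourier_coeff u n * z ^ n)) \<le>
           norm z ^ N / (1 - norm z) * (LINT \<zeta>|\<mu>. \<bar>u \<zeta>\<bar>)"
proof -
  have c1: "continuous_on (sphere 0 1) (\<lambda>\<zeta>. inverse (1 - z * cnj \<zeta>))"
    using one_minus_mult_nonzero[OF z] by (intro continuous_intros) auto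
  have i1: "integrable \<mu> (\<lambda>\<zeta>. of_real (u \<zeta>) / (1 - z * cnj \<zeta>))"
    using integrable_mult_continuous[OF u c1] by (simp add: divide_inverse)
  have i2: "integrable \<mu> (\<lambda>\<zeta>. of_real (u \<zeta>) * cnj \<zeta> ^ n * z ^ n)" for n
    by (intro integrable_mult_left integrable_mult_continuous u continuous_intros)
  have "cauchy_transform u z - (\<Sum>n<N. fourier_coeff u n * z ^ n) =
     (LINT \<zeta>|\<mu>. of_real (u \<zeta>) / (1 - z * cnj \<zeta>) - (\<Sum>n<N. of_real (u \<zeta>) * cnj \<zeta> ^ n * z ^ n))"
    unfolding cauchy_transform_def fourier_coeff_def using i1 i2
    by (simp add: Bochner_Integration.integral_sum)
  also have "norm \<dots> \<le> (LINT \<zeta>|\<mu>. norm z ^ N / (1 - norm z) * \<bar>u \<zeta>\<bar>)"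
  proof (rule Bochner_Integration.integral_norm_bound_integral)
    show "integrable \<mu> (\<lambda>\<zeta>. of_real (u \<zeta>) / (1 - z * cnj \<zeta>) - (\<Sum>n<N. of_real (u \<zeta>) * cnj \<zeta> ^ n * z ^ n))"
      using i1 i2 by (intro Bochner_Integration.integrable_diff Bochner_Integration.integrable_sum)
    show "integrable \<mu> (\<lambda>\<zeta>. norm z ^ N / (1 - norm z) * \<bar>u \<zeta>\<bar>)" using u by simp
    fix \<zeta> assume "\<zeta> \<in> space \<mu>"
    then have n: "norm \<zeta> = 1" by simp
    define w where "w = z * cnj \<zeta>"
    have w: "norm w = norm z" "1 - w \<noteq> 0" using n one_minus_mult_nonzero[OF z, of "cnj \<zeta>"] by (auto simp: w_def norm_mult)
    have "(\<Sum>n<N. of_real (u \<zeta>) * cnj \<zeta> ^ n * z ^ n) = of_real (u \<zeta>) * (\<Sum>n<N. w ^ n)"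
      by (simp add: w_def power_mult_distrib sum_distrib_left mult_ac)
    also have "(\<Sum>n<N. w ^ n) = (1 - w ^ N) / (1 - w)"
      using w by (subst sum_gp_strict) auto
    also have "of_real (u \<zeta>) / (1 - z * cnj \<zeta>) - of_real (u \<zeta>) * ((1 - w ^ N) / (1 - w)) = of_real (u \<zeta>) * (w ^ N / (1 - w))"
      unfolding w_def[symmetric] by (simp add: diff_divide_distrib right_diff_distrib)
    also have "norm \<dots> = \<bar>u \<zeta>\<bar> * (norm z ^ N / norm (1 - w))"
      using w by (simp add: norm_mult norm_divide norm_power)
    also have "\<dots> \<le> \<bar>u \<zeta>\<bar> * (norm z ^ N / (1 - norm z))"
      using norm_triangle_ineq2[of 1 w] w z
      by (intro mult_left_mono divide_left_mono mult_pos_pos) auto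
    finally show "norm (of_real (u \<zeta>) / (1 - z * cnj \<zeta>) - (\<Sum>n<N. of_real (u \<zeta>) * cnj \<zeta> ^ n * z ^ n))
       \<le> norm z ^ N / (1 - norm z) * \<bar>u \<zeta>\<bar>" by (simp add: mult.commute)
  qed
  finally show ?thesis by simp
qed

lemma cauchy_transform_sums:
  assumes u: "integrable \<mu> u" and z: "norm z < 1"
  shows "(\<lambda>n. fourier_coeff u n * z ^ n) sums cauchy_transform u z"
  unfolding sums_def
proof (rule LIM_zero_cancel, rule tendsto_norm_zero_cancel, rule tendsto_sandwich[of "\<lambda>_. 0"])
  have "(\<lambda>N. norm z ^ N * (1 / (1 - norm z) * (LINT \<zeta>|\<mu>. \<bar>u \<zeta>\<bar>))) \<longlonglongrightarrow> 0"
    using z by (intro tendsto_mult_left_zero LIMSEQ_power_zero) auto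
  then show "(\<lambda>N. norm z ^ N / (1 - norm z) * (LINT \<zeta>|\<mu>. \<bar>u \<zeta>\<bar>)) \<longlonglongrightarrow> 0" by simp
  show "eventually (\<lambda>N. norm ((\<Sum>n<N. fourier_coeff u n * z ^ n) - cauchy_transform u z) \<le>
      norm z ^ N / (1 - norm z) * (LINT \<zeta>|\<mu>. \<bar>u \<zeta>\<bar>)) sequentially"
    using cauchy_transform_remainder[OF u z] by (intro always_eventually allI) (simp add: norm_minus_commute)
qed auto

lemma cauchy_transform_holomorphic:
  assumes "integrable \<mu> u" shows "cauchy_transform u holomorphic_on ball 0 1"
  using cauchy_transform_sums[OF assms] by (intro power_series_holomorphic[where a = "fourier_coeff u"]) auto

text \<open>
The integral of \<open>u(\<zeta>) (\<zeta> + z) / (\<zeta> - z)\<close>, since this kernel equals \<open>2 / (1 - z cnj \<zeta>) - 1\<close> on the circle.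
\<close>

definition schwarz_integral :: "(complex \<Rightarrow> real) \<Rightarrow> complex \<Rightarrow> complex" where
  "schwarz_integral u z = 2 * cauchy_transform u z - of_real (LINT \<zeta>|\<mu>. u \<zeta>)"

lemma schwarz_integral_holomorphic:
  "integrable \<mu> u \<Longrightarrow> schwarz_integral u holomorphic_on ball 0 1"
  unfolding schwarz_integral_def[abs_def] by (intro holomorphic_intros cauchy_transform_holomorphic)

lemma schwarz_integral_0: "schwarz_integral u 0 = of_real (LINT \<zeta>|\<mu>. u \<zeta>)"
  by (simp add: schwarz_integral_def cauchy_transform_def)

lemma Re_schwarz_integral:
  assumes u: "integrable \<mu> u" and z: "norm z < 1"
  shows "Re (schwarz_integral u z) = poisson u z"
proof -
  have c1: "continuous_on (sphere 0 1) (\<lambda>\<zeta>. inverse (1 - z * cnj \<zeta>))"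
    using one_minus_mult_nonzero[OF z] by (intro continuous_intros) auto
  have i1: "integrable \<mu> (\<lambda>\<zeta>. of_real (u \<zeta>) / (1 - z * cnj \<zeta>))"
    using integrable_mult_continuous[OF u c1] by (simp add: divide_inverse)
  have "Re (schwarz_integral u z) = 2 * Re (cauchy_transform u z) - (LINT \<zeta>|\<mu>. u \<zeta>)"
    by (simp add: schwarz_integral_def)
  also have "Re (cauchy_transform u z) = (LINT \<zeta>|\<mu>. Re (of_real (u \<zeta>) / (1 - z * cnj \<zeta>)))"
    unfolding cauchy_transform_def using i1 by simp
  also have "2 * \<dots> - (LINT \<zeta>|\<mu>. u \<zeta>) = (LINT \<zeta>|\<mu>. 2 * Re (of_real (u \<zeta>) / (1 - z * cnj \<zeta>)) - u \<zeta>)"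
    using i1 u by simp
  also have "\<dots> = poisson u z"
    unfolding poisson_eq_kernel
  proof (intro Bochner_Integration.integral_cong refl)
    fix \<zeta> assume "\<zeta> \<in> space \<mu>"
    then have n: "norm \<zeta> = 1" by simp
    define w where "w = z * cnj \<zeta>"
    have w: "norm w = norm z" "1 - w \<noteq> 0" using n one_minus_mult_nonzero[OF z, of "cnj \<zeta>"] by (auto simp: w_def norm_mult)
    have "\<zeta> - z = \<zeta> * (1 - w)"
      using n unfolding w_def
      by (simp add: algebra_simps complex_norm_square[symmetric])
    then have d: "norm (\<zeta> - z) = norm (1 - w)" using n by (simp add: norm_mult)
    have "2 * Re (1 / (1 - w)) - 1 = (1 - (norm w)\<^sup>2) / (norm (1 - w))\<^sup>2"
    proof -
      have p: "(norm (1 - w))\<^sup>2 = (1 - Re w)\<^sup>2 + (Im w)\<^sup>2" by (simp add: cmod_power2)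
      have nz: "(1 - Re w)\<^sup>2 + (Im w)\<^sup>2 \<noteq> 0" using w(2) p by (metis norm_eq_zero power_eq_0_iff)
      have "Re (1 / (1 - w)) = (1 - Re w) / ((1 - Re w)\<^sup>2 + (Im w)\<^sup>2)" by (simp add: Re_divide)
      then have "2 * Re (1 / (1 - w)) - 1 = (2 * (1 - Re w) - ((1 - Re w)\<^sup>2 + (Im w)\<^sup>2)) / ((1 - Re w)\<^sup>2 + (Im w)\<^sup>2)"
      proof -
        have "2 * x - 1 = (2 * a - D) / D" if "x = a / D" "D \<noteq> 0" for x a D :: real
          using that by (simp add: field_simps)
        then show ?thesis using nz \<open>Re (1 / (1 - w)) = _\<close> by blast
      qed
      also have "2 * (1 - Re w) - ((1 - Re w)\<^sup>2 + (Im w)\<^sup>2) = 1 - (norm w)\<^sup>2"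
        unfolding cmod_power2 by (simp add: power2_eq_square algebra_simps)
      finally show ?thesis using p by simp
    qed
    then have "2 * Re (1 / (1 - w)) - 1 = poisson_kernel z \<zeta>"
      unfolding poisson_kernel_def d w(1) by simp
    moreover have "Re (of_real (u \<zeta>) / (1 - w)) = u \<zeta> * Re (1 / (1 - w))"
      by (simp add: Re_divide)
    ultimately show "2 * Re (of_real (u \<zeta>) / (1 - z * cnj \<zeta>)) - u \<zeta> = poisson_kernel z \<zeta> *\<^sub>R u \<zeta>"
      unfolding w_def[symmetric] by (simp add: algebra_simps flip: \<open>2 * Re (1 / (1 - w)) - 1 = poisson_kernel z \<zeta>\<close>)
  qed
  finally show ?thesis .
qed

section \<open>Outer functions\<close>

lemma L1_le_sqrt_L2:
  fixes h :: "complex \<Rightarrow> real"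
  assumes "integrable \<mu> h" "integrable \<mu> (\<lambda>\<zeta>. (h \<zeta>)\<^sup>2)"
  shows "(LINT \<zeta>|\<mu>. h \<zeta>) \<le> sqrt (LINT \<zeta>|\<mu>. (h \<zeta>)\<^sup>2)"
proof -
  have "0 \<le> circle.variance h" by (rule circle.variance_positive)
  also have "\<dots> = (LINT \<zeta>|\<mu>. (h \<zeta>)\<^sup>2) - (LINT \<zeta>|\<mu>. h \<zeta>)\<^sup>2"
    using assms by (rule circle.variance_eq)
  finally show ?thesis by (intro real_le_rsqrt) simp
qed

lemma AE_summable_norm:
  fixes f :: "nat \<Rightarrow> complex \<Rightarrow> 'a::{banach, second_countable_topology}"
  assumes f: "\<And>i. integrable \<mu> (f i)" and s: "summable (\<lambda>i. LINT \<zeta>|\<mu>. norm (f i \<zeta>))"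
  shows "AE \<zeta> in \<mu>. summable (\<lambda>i. norm (f i \<zeta>))"
proof -
  have [measurable]: "f i \<in> borel_measurable \<mu>" for i using f by (rule borel_measurable_integrable)
  have "(\<integral>\<^sup>+\<zeta>. (\<Sum>i. ennreal (norm (f i \<zeta>))) \<partial>\<mu>) = (\<Sum>i. \<integral>\<^sup>+\<zeta>. ennreal (norm (f i \<zeta>)) \<partial>\<mu>)"
    by (intro nn_integral_suminf) measurable
  also have "\<dots> = (\<Sum>i. ennreal (LINT \<zeta>|\<mu>. norm (f i \<zeta>)))"
    using f by (intro suminf_cong nn_integral_eq_integral) auto
  also have "\<dots> = ennreal (\<Sum>i. LINT \<zeta>|\<mu>. norm (f i \<zeta>))"
    using s by (intro suminf_ennreal2) auto
  finally have "(\<integral>\<^sup>+\<zeta>. (\<Sum>i. ennreal (norm (f i \<zeta>))) \<partial>\<mu>) \<noteq> \<infinity>" by simp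
  then have "AE \<zeta> in \<mu>. (\<Sum>i. ennreal (norm (f i \<zeta>))) \<noteq> \<infinity>"
    by (intro nn_integral_noteq_infinite) measurable
  then show ?thesis
    by eventually_elim (auto intro: summable_suminf_not_top)
qed

lemma L1_fast_cauchy:
  fixes g :: "nat \<Rightarrow> complex \<Rightarrow> complex"
  assumes [measurable]: "\<And>k. g k \<in> borel_measurable \<mu>" and B: "\<And>k. AE \<zeta> in \<mu>. norm (g k \<zeta>) \<le> B"
    and s: "summable (\<lambda>k. LINT \<zeta>|\<mu>. norm (g (Suc k) \<zeta> - g k \<zeta>))"
  obtains f where "f \<in> Linf" "AE \<zeta> in \<mu>. norm (f \<zeta>) \<le> B" "AE \<zeta> in \<mu>. (\<lambda>k. g k \<zeta>) \<longlonglongrightarrow> f \<zeta>"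
    "(\<lambda>k. LINT \<zeta>|\<mu>. norm (g k \<zeta> - f \<zeta>)) \<longlonglongrightarrow> 0"
proof -
  define f where "f \<zeta> = lim (\<lambda>k. g k \<zeta>)" for \<zeta>
  have fm[measurable]: "f \<in> borel_measurable \<mu>" unfolding f_def by measurable
  have gi: "integrable \<mu> (g k)" for k using B by (intro integrable_circle_bounded) auto
  have "AE \<zeta> in \<mu>. summable (\<lambda>k. norm (g (Suc k) \<zeta> - g k \<zeta>))"
    using s gi by (intro AE_summable_norm) auto
  then have conv: "AE \<zeta> in \<mu>. (\<lambda>k. g k \<zeta>) \<longlonglongrightarrow> f \<zeta>"
  proof eventually_elim
    case (elim \<zeta>)
    then have "summable (\<lambda>k. g (Suc k) \<zeta> - g k \<zeta>)" by (rule summable_norm_cancel)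
    then have "convergent (\<lambda>n. \<Sum>k<n. g (Suc k) \<zeta> - g k \<zeta>)" by (simp add: summable_iff_convergent)
    then have "convergent (\<lambda>n. g n \<zeta> - g 0 \<zeta>)" by (simp only: sum_lessThan_telescope[of "\<lambda>n. g n \<zeta>"])
    then have "convergent (\<lambda>n. (g n \<zeta> - g 0 \<zeta>) + g 0 \<zeta>)" by (intro convergent_add convergent_const)
    then show ?case by (simp add: f_def convergent_LIMSEQ_iff)
  qed
  have B': "AE \<zeta> in \<mu>. \<forall>k. norm (g k \<zeta>) \<le> B" using B by (simp add: AE_all_countable)
  with conv have fB: "AE \<zeta> in \<mu>. norm (f \<zeta>) \<le> B"
    by eventually_elim (auto intro: LIMSEQ_le_const2[OF tendsto_norm])
  have "AE \<zeta> in \<mu>. norm (g k \<zeta> - f \<zeta>) \<le> B + B" for k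
    using B[of k] fB by eventually_elim (rule order_trans[OF norm_triangle_ineq4], simp)
  then have "(\<lambda>k. LINT \<zeta>|\<mu>. norm (g k \<zeta> - f \<zeta>)) \<longlonglongrightarrow> 0"
    by (intro L1_tendsto_dominated[where w = "\<lambda>_. B + B"] conv) auto
  then show ?thesis using that conv fB LinfI[OF fm fB] by blast
qed

lemma exp_minus_one_le: "\<bar>x\<bar> \<le> K \<Longrightarrow> exp x - 1 \<le> exp K * \<bar>x::real\<bar>"
proof -
  assume x: "\<bar>x\<bar> \<le> K"
  \<comment> \<open>From \<open>1 - x \<le> exp (-x)\<close>.\<close>
  have "exp x * (1 - x) \<le> exp x * exp (- x)"
    using exp_ge_add_one_self[of "- x"] by (intro mult_left_mono) auto
  then have "exp x - 1 \<le> exp x * x" by (simp add: algebra_simps flip: exp_add)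
  also have "\<dots> \<le> exp x * \<bar>x\<bar>" by (intro mult_left_mono) auto
  also have "\<dots> \<le> exp K * \<bar>x\<bar>" using x by (intro mult_right_mono) auto
  finally show ?thesis .
qed

text \<open>
Convergence in mean square of the dilations of an outer function, without Fourier series. The quotient \<open>Q\<close> of two
dilations is analytic in the closed disc with \<open>Q(0) = 1\<close>, so it has mean 1 and
\<open>\<integral> \<bar>Q - 1\<bar>\<^sup>2 = \<integral> \<bar>Q\<bar>\<^sup>2 - 1\<close>. The right-hand side involves only \<open>\<bar>Q\<bar>\<close>, that is, only Poisson integrals
of \<open>u\<close>.
\<close>

lemma exp_schwarz_dilation_L2:
  fixes u :: "complex \<Rightarrow> real"
  assumes u: "integrable \<mu> u" "AE \<zeta> in \<mu>. \<bar>u \<zeta>\<bar> \<le> M"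
    and r: "0 \<le> r" "r < 1" and s: "0 \<le> s" "s < 1"
  defines "F \<equiv> \<lambda>z. exp (schwarz_integral u z)"
  shows "(LINT \<zeta>|\<mu>. (norm (F (of_real r * \<zeta>) - F (of_real s * \<zeta>)))\<^sup>2) \<le>
    2 * exp (6 * M) * ((LINT \<zeta>|\<mu>. \<bar>poisson u (of_real r * \<zeta>) - u \<zeta>\<bar>)
      + (LINT \<zeta>|\<mu>. \<bar>poisson u (of_real s * \<zeta>) - u \<zeta>\<bar>))"
proof -
  let ?V = "schwarz_integral u"
  have V: "?V holomorphic_on ball 0 1" using u(1) by (rule schwarz_integral_holomorphic)
  note Vr = holomorphic_dilation[OF V r] and Vs = holomorphic_dilation[OF V s]
  define Q where "Q \<zeta> = exp (?V (of_real r * \<zeta>) - ?V (of_real s * \<zeta>))" for \<zeta>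
  have Qc: "continuous_on (cball 0 1) Q" and Qh: "Q holomorphic_on ball 0 1"
    unfolding Q_def by (auto intro!: continuous_intros holomorphic_intros Vr Vs)
  have Qs: "continuous_on (sphere 0 1) Q" using Qc by (rule continuous_on_subset) auto
  have Q1: "(LINT \<zeta>|\<mu>. Q \<zeta>) = 1" using circle_mean_value[OF Qc Qh] by (simp add: Q_def)
  have iQ: "integrable \<mu> Q" "integrable \<mu> (\<lambda>\<zeta>. (norm (Q \<zeta>))\<^sup>2)" "integrable \<mu> (\<lambda>\<zeta>. (norm (Q \<zeta> - 1))\<^sup>2)"
    using Qs by (auto intro!: integrable_circle_continuous continuous_intros)
  let ?p = "\<lambda>r \<zeta>. poisson u (of_real r * \<zeta>)"
  have um: "u \<in> borel_measurable \<mu>" using u by simp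
  have Pb: "\<bar>?p r \<zeta>\<bar> \<le> M" if "0 \<le> r" "r < 1" "norm \<zeta> = 1" for r \<zeta>
    using norm_poisson_le_bound[OF um, of M] u(2) norm_radial_less[OF that] by simp
  have ip: "integrable \<mu> (\<lambda>\<zeta>. \<bar>?p r \<zeta> - u \<zeta>\<bar>)" "integrable \<mu> (\<lambda>\<zeta>. \<bar>?p s \<zeta> - u \<zeta>\<bar>)"
    by (intro integrable_abs Bochner_Integration.integrable_diff integrable_poisson_radial u r s)+
  have "(LINT \<zeta>|\<mu>. (norm (F (of_real r * \<zeta>) - F (of_real s * \<zeta>)))\<^sup>2)
    \<le> (LINT \<zeta>|\<mu>. (exp M)\<^sup>2 * (norm (Q \<zeta> - 1))\<^sup>2)"
  proof (rule integral_mono)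
    have "continuous_on (cball 0 1) (\<lambda>\<zeta>. (norm (F (of_real r * \<zeta>) - F (of_real s * \<zeta>)))\<^sup>2)"
      unfolding F_def by (intro continuous_intros Vr Vs)
    then show "integrable \<mu> (\<lambda>\<zeta>. (norm (F (of_real r * \<zeta>) - F (of_real s * \<zeta>)))\<^sup>2)"
      by (intro integrable_circle_continuous) (rule continuous_on_subset, auto)
    show "integrable \<mu> (\<lambda>\<zeta>. (exp M)\<^sup>2 * (norm (Q \<zeta> - 1))\<^sup>2)" using iQ by simp
    fix \<zeta> assume "\<zeta> \<in> space \<mu>"
    then have \<zeta>: "norm \<zeta> = 1" by simp
    have "F (of_real r * \<zeta>) - F (of_real s * \<zeta>) = F (of_real s * \<zeta>) * (Q \<zeta> - 1)"
      unfolding F_def Q_def by (simp add: algebra_simps flip: exp_add)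
    moreover have "norm (F (of_real s * \<zeta>)) \<le> exp M"
      unfolding F_def using Pb[OF s \<zeta>] Re_schwarz_integral[OF u(1) norm_radial_less[OF s \<zeta>]] by simp
    ultimately show "(norm (F (of_real r * \<zeta>) - F (of_real s * \<zeta>)))\<^sup>2 \<le> (exp M)\<^sup>2 * (norm (Q \<zeta> - 1))\<^sup>2"
      by (simp add: norm_mult power_mult_distrib mult_right_mono power_mono)
  qed
  also have "\<dots> = (exp M)\<^sup>2 * (LINT \<zeta>|\<mu>. (norm (Q \<zeta> - 1))\<^sup>2)" by simp
  also have "(LINT \<zeta>|\<mu>. (norm (Q \<zeta> - 1))\<^sup>2) = (LINT \<zeta>|\<mu>. (norm (Q \<zeta>))\<^sup>2 - 2 * Re (Q \<zeta>) + 1)"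
    by (intro Bochner_Integration.integral_cong refl) (unfold cmod_power2, simp add: power2_eq_square algebra_simps)
  also have "\<dots> = (LINT \<zeta>|\<mu>. (norm (Q \<zeta>))\<^sup>2) - 1"
    using iQ Q1 by (simp add: circle.prob_space[simplified])
  also have "\<dots> = (LINT \<zeta>|\<mu>. (norm (Q \<zeta>))\<^sup>2 - 1)"
    using iQ by (simp add: circle.prob_space[simplified])
  also have "\<dots> \<le> (LINT \<zeta>|\<mu>. 2 * exp (4 * M) * (\<bar>?p r \<zeta> - u \<zeta>\<bar> + \<bar>?p s \<zeta> - u \<zeta>\<bar>))"
  proof (rule integral_mono)
    show "integrable \<mu> (\<lambda>\<zeta>. (norm (Q \<zeta>))\<^sup>2 - 1)" using iQ by simp
    show "integrable \<mu> (\<lambda>\<zeta>. 2 * exp (4 * M) * (\<bar>?p r \<zeta> - u \<zeta>\<bar> + \<bar>?p s \<zeta> - u \<zeta>\<bar>))" using ip by simp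
    fix \<zeta> assume "\<zeta> \<in> space \<mu>"
    then have \<zeta>: "norm \<zeta> = 1" by simp
    have "norm (Q \<zeta>) = exp (?p r \<zeta> - ?p s \<zeta>)"
      unfolding Q_def using Re_schwarz_integral[OF u(1)] norm_radial_less[OF r \<zeta>] norm_radial_less[OF s \<zeta>] by simp
    then have "(norm (Q \<zeta>))\<^sup>2 = exp (2 * (?p r \<zeta> - ?p s \<zeta>))" by (simp add: power2_eq_square flip: exp_add)
    then have "(norm (Q \<zeta>))\<^sup>2 - 1 \<le> exp (4 * M) * \<bar>2 * (?p r \<zeta> - ?p s \<zeta>)\<bar>"
      using exp_minus_one_le[of "2 * (?p r \<zeta> - ?p s \<zeta>)" "4 * M"] Pb[OF r \<zeta>] Pb[OF s \<zeta>] by simp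
    also have "\<dots> \<le> exp (4 * M) * (2 * (\<bar>?p r \<zeta> - u \<zeta>\<bar> + \<bar>?p s \<zeta> - u \<zeta>\<bar>))"
    proof -
      have "\<bar>2 * (a - b)\<bar> \<le> 2 * (\<bar>a - c\<bar> + \<bar>b - c\<bar>)" for a b c :: real
      proof -
        have "\<bar>a - b\<bar> \<le> \<bar>a - c\<bar> + \<bar>b - c\<bar>"
          using abs_triangle_ineq4[of "a - c" "b - c"] by simp
        then show ?thesis by (simp only: abs_mult abs_numeral mult_left_mono zero_le_numeral)
      qed
      then show ?thesis by (rule mult_left_mono) simp
    qed
    finally show "(norm (Q \<zeta>))\<^sup>2 - 1 \<le> 2 * exp (4 * M) * (\<bar>?p r \<zeta> - u \<zeta>\<bar> + \<bar>?p s \<zeta> - u \<zeta>\<bar>)"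
      by (simp only: mult.assoc mult.left_commute[of "exp (4 * M)" 2])
  qed
  also have "\<dots> = 2 * exp (4 * M) * ((LINT \<zeta>|\<mu>. \<bar>?p r \<zeta> - u \<zeta>\<bar>) + (LINT \<zeta>|\<mu>. \<bar>?p s \<zeta> - u \<zeta>\<bar>))"
    using ip by simp
  finally have "(LINT \<zeta>|\<mu>. (norm (F (of_real r * \<zeta>) - F (of_real s * \<zeta>)))\<^sup>2) \<le> (exp M)\<^sup>2 *
     (2 * exp (4 * M) * ((LINT \<zeta>|\<mu>. \<bar>?p r \<zeta> - u \<zeta>\<bar>) + (LINT \<zeta>|\<mu>. \<bar>?p s \<zeta> - u \<zeta>\<bar>)))"
    by (simp add: mult_left_mono)
  also have "(exp M)\<^sup>2 * (2 * exp (4 * M) * X) = 2 * exp (6 * M) * X" for X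
    by (simp add: power2_eq_square flip: exp_add)
  finally show ?thesis .
qed

text \<open>
The boundary function of \<open>exp\<close> of the Schwarz integral. Radii converging fast enough make the dilations converge
almost everywhere, and along the same radii \<open>P u\<close> converges to \<open>u\<close>, which identifies the modulus.
\<close>

theorem outer_function_exists:
  fixes u :: "complex \<Rightarrow> real"
  assumes um[measurable]: "u \<in> borel_measurable \<mu>" and M: "AE \<zeta> in \<mu>. \<bar>u \<zeta>\<bar> \<le> M"
  obtains f where "f \<in> Hinf" "AE \<zeta> in \<mu>. norm (f \<zeta>) = exp (u \<zeta>)"
    "\<And>z. norm z < 1 \<Longrightarrow> norm (poisson f z) = exp (poisson u z)"
    "poisson f 0 = of_real (exp (LINT \<zeta>|\<mu>. u \<zeta>))"
proof -
  have u: "integrable \<mu> u" using M by (intro integrable_circle_bounded) auto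
  let ?e = "\<lambda>r. LINT \<zeta>|\<mu>. \<bar>poisson u (of_real r * \<zeta>) - u \<zeta>\<bar>"
  have e0: "0 \<le> ?e r" for r by simp
  have "(\<lambda>k. ?e (rad k)) \<longlonglongrightarrow> 0"
    using poisson_radial_L1[OF u rad(1,2,4)] by simp
  \<comment> \<open>The square root in passing from mean square to mean leaves \<open>4\<^sup>-\<^sup>k\<close>, which is summable.\<close>
  then have "\<exists>n\<ge>k. ?e (rad n) < (1/16) ^ k" for k
    using order_tendstoD(2)[of _ 0 sequentially "(1/16) ^ k"]
    unfolding eventually_sequentially by (meson nle_le zero_less_divide_1_iff zero_less_numeral zero_less_power)
  then obtain \<sigma> where \<sigma>: "\<And>k. \<sigma> k \<ge> k" "\<And>k. ?e (rad (\<sigma> k)) < (1/16) ^ k" by metis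
  define r where "r k = rad (\<sigma> k)" for k
  have r: "0 \<le> r k" "r k < 1" for k unfolding r_def by (rule rad)+
  have "filterlim \<sigma> at_top sequentially"
    using \<sigma>(1) by (intro filterlim_at_top_mono[OF filterlim_ident]) auto
  then have r1: "r \<longlonglongrightarrow> 1"
    unfolding r_def by (rule filterlim_compose[OF rad(4)])
  let ?V = "schwarz_integral u"
  define F where "F z = exp (?V z)" for z
  have F: "F holomorphic_on ball 0 1"
    unfolding F_def by (intro holomorphic_intros schwarz_integral_holomorphic u)
  let ?F = "\<lambda>k \<zeta>. F (of_real (r k) * \<zeta>)"
  have normF: "norm (F z) = exp (poisson u z)" if "norm z < 1" for z
    unfolding F_def using Re_schwarz_integral[OF u that] by simp
  have FB: "norm (F z) \<le> exp M" if "norm z < 1" for z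
    using normF[OF that] norm_poisson_le_bound[OF um _ that, of M] M by simp
  have Fi: "integrable \<mu> (?F k)" for k by (intro integrable_dilation F r)
  then have Fm[measurable]: "?F k \<in> borel_measurable \<mu>" for k by (rule borel_measurable_integrable)
  have FBk: "AE \<zeta> in \<mu>. norm (?F k \<zeta>) \<le> exp M" for k
    using FB norm_radial_less[OF r] by (intro AE_I2) auto
  have step: "(LINT \<zeta>|\<mu>. norm (?F (Suc k) \<zeta> - ?F k \<zeta>)) \<le> sqrt (4 * exp (6 * M)) * (1/4) ^ k" for k
  proof -
    let ?h = "\<lambda>\<zeta>. ?F (Suc k) \<zeta> - ?F k \<zeta>"
    have hi: "integrable \<mu> ?h" using Fi by simp
    have hb: "AE \<zeta> in \<mu>. norm (?h \<zeta>) \<le> exp M + exp M"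
      using FBk[of k] FBk[of "Suc k"] by eventually_elim (rule order_trans[OF norm_triangle_ineq4], simp)
    have "(LINT \<zeta>|\<mu>. norm (?h \<zeta>)) \<le> sqrt (LINT \<zeta>|\<mu>. (norm (?h \<zeta>))\<^sup>2)"
    proof (rule L1_le_sqrt_L2)
      show "integrable \<mu> (\<lambda>\<zeta>. (norm (?h \<zeta>))\<^sup>2)"
      proof (rule integrable_circle_bounded)
        show "AE \<zeta> in \<mu>. norm ((norm (?h \<zeta>))\<^sup>2) \<le> (exp M + exp M)\<^sup>2"
          using hb by eventually_elim (unfold real_norm_def power_abs abs_norm_cancel, rule power_mono, auto)
      qed measurable
    qed (use hi in simp)
    also have "\<dots> \<le> sqrt (2 * exp (6 * M) * (?e (r (Suc k)) + ?e (r k)))"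
      unfolding F_def by (intro real_sqrt_le_mono exp_schwarz_dilation_L2 u M r)
    also have "\<dots> \<le> sqrt (2 * exp (6 * M) * ((1/16) ^ k + (1/16) ^ k))"
    proof -
      have "?e (r (Suc k)) \<le> (1/16) ^ k"
        using \<sigma>(2)[of "Suc k"] unfolding r_def by (simp add: field_simps) 
      then show ?thesis
        using \<sigma>(2)[of k] unfolding r_def by (intro real_sqrt_le_mono mult_left_mono add_mono) auto
    qed
    also have "\<dots> = sqrt (4 * exp (6 * M) * ((1/4) ^ k)\<^sup>2)"
      by (simp add: power2_eq_square flip: power_mult_distrib)
    also have "\<dots> = sqrt (4 * exp (6 * M)) * (1/4) ^ k"
      by (simp add: real_sqrt_mult)
    finally show ?thesis .
  qed
  have sm: "summable (\<lambda>k. LINT \<zeta>|\<mu>. norm (?F (Suc k) \<zeta> - ?F k \<zeta>))"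
  proof (rule summable_comparison_test')
    show "summable (\<lambda>k. sqrt (4 * exp (6 * M)) * (1/4) ^ k)" by (intro summable_mult summable_geometric) simp
    show "norm (LINT \<zeta>|\<mu>. norm (?F (Suc k) \<zeta> - ?F k \<zeta>)) \<le> sqrt (4 * exp (6 * M)) * (1/4) ^ k" if "k \<ge> 0" for k
      using step[of k] by simp
  qed
  obtain f where f: "f \<in> Linf" and "AE \<zeta> in \<mu>. norm (f \<zeta>) \<le> exp M" and flim: "AE \<zeta> in \<mu>. (\<lambda>k. ?F k \<zeta>) \<longlonglongrightarrow> f \<zeta>"
    and fL1: "(\<lambda>k. LINT \<zeta>|\<mu>. norm (?F k \<zeta> - f \<zeta>)) \<longlonglongrightarrow> 0"
    by (rule L1_fast_cauchy[OF Fm FBk sm])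
  note H = Hinf_boundary[OF F f r r1 fL1]
  have "AE \<zeta> in \<mu>. summable (\<lambda>k. norm (poisson u (of_real (r k) * \<zeta>) - u \<zeta>))"
  proof (rule AE_summable_norm)
    show "integrable \<mu> (\<lambda>\<zeta>. poisson u (of_real (r k) * \<zeta>) - u \<zeta>)" for k
      by (intro Bochner_Integration.integrable_diff integrable_poisson_radial u r)
    show "summable (\<lambda>k. LINT \<zeta>|\<mu>. norm (poisson u (of_real (r k) * \<zeta>) - u \<zeta>))"
    proof (rule summable_comparison_test')
      show "summable (\<lambda>k. (1/16::real) ^ k)" by (intro summable_geometric) simp
      show "norm (LINT \<zeta>|\<mu>. norm (poisson u (of_real (r k) * \<zeta>) - u \<zeta>)) \<le> (1/16) ^ k" if "k \<ge> 0" for k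
        using less_imp_le[OF \<sigma>(2)[of k]] unfolding r_def by simp
    qed
  qed
  then have "AE \<zeta> in \<mu>. norm (f \<zeta>) = exp (u \<zeta>)"
    using flim AE_circle_norm
  proof eventually_elim
    case (elim \<zeta>)
    have "(\<lambda>k. poisson u (of_real (r k) * \<zeta>)) \<longlonglongrightarrow> u \<zeta>"
      using summable_LIMSEQ_zero[OF elim(1)] by (simp add: LIM_zero_iff tendsto_norm_zero_iff tendsto_rabs_zero_iff)
    then have "(\<lambda>k. norm (?F k \<zeta>)) \<longlonglongrightarrow> exp (u \<zeta>)"
      using normF norm_radial_less[OF r elim(3)] by (simp add: tendsto_exp)
    then show ?case using tendsto_norm[OF elim(2)] LIMSEQ_unique by blast
  qed
  moreover have "norm (poisson f z) = exp (poisson u z)" if "norm z < 1" for z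
    using H(2)[OF that] normF[OF that] by simp
  moreover have "poisson f 0 = of_real (exp (LINT \<zeta>|\<mu>. u \<zeta>))"
    using H(2)[of 0] by (simp add: F_def schwarz_integral_0 exp_of_real)
  ultimately show ?thesis by (rule that[OF H(1)])
qed

section \<open>Infinite products\<close>

text \<open>
The mean square of the difference of consecutive partial products is at most \<open>\<integral> \<bar>b\<^sub>N - 1\<bar>\<^sup>2 \<le> 2 - 2 Re \<integral> b\<^sub>N\<close>, and
\<open>\<integral> b\<^sub>N\<close> is the value at the origin. Hence factors whose values at 0 tend to 1 geometrically have a convergent
product; Blaschke factors are one instance, quotients of outer functions another.
\<close>

lemma contractive_product_converges:
  fixes b :: "nat \<Rightarrow> complex \<Rightarrow> complex"
  assumes b: "\<And>j. b j \<in> Hinf" and b1: "\<And>j. AE \<zeta> in \<mu>. norm (b j \<zeta>) \<le> 1"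
    and b0: "\<And>j. 1 - (1/4) ^ j \<le> Re (poisson (b j) 0)"
  obtains B where "B \<in> Hinf" "AE \<zeta> in \<mu>. norm (B \<zeta>) \<le> 1"
    "AE \<zeta> in \<mu>. (\<lambda>N. \<Prod>j<N. b j \<zeta>) \<longlonglongrightarrow> B \<zeta>"
proof -
  let ?g = "\<lambda>N \<zeta>. \<Prod>j<N. b j \<zeta>"
  have bm[measurable]: "b j \<in> borel_measurable \<mu>" for j using b by (rule Hinf_measurable)
  have bi: "integrable \<mu> (b j)" for j using b by (rule Hinf_integrable)
  have gm[measurable]: "?g N \<in> borel_measurable \<mu>" for N by measurable
  have ball1: "AE \<zeta> in \<mu>. \<forall>j. norm (b j \<zeta>) \<le> 1" using b1 by (simp add: AE_all_countable)
  have g1: "AE \<zeta> in \<mu>. norm (?g N \<zeta>) \<le> 1" for N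
    using ball1 by eventually_elim (auto simp: prod_norm[symmetric] intro!: prod_le_1)
  have gH: "?g N \<in> Hinf" for N
    by (induction N) (auto intro: Hinf_const Hinf_mult b)
  have step: "(LINT \<zeta>|\<mu>. norm (?g (Suc N) \<zeta> - ?g N \<zeta>)) \<le> sqrt 2 * (1/2) ^ N" for N
  proof -
    have hb: "AE \<zeta> in \<mu>. norm (b N \<zeta> - 1) \<le> 2"
      using b1[of N] by eventually_elim (rule order_trans[OF norm_triangle_ineq4], simp)
    have i2: "integrable \<mu> (\<lambda>\<zeta>. (norm (b N \<zeta> - 1))\<^sup>2)"
    proof (rule integrable_circle_bounded)
      show "AE \<zeta> in \<mu>. norm ((norm (b N \<zeta> - 1))\<^sup>2) \<le> 2\<^sup>2"
        using hb by eventually_elim (unfold real_norm_def power_abs abs_norm_cancel, rule power_mono, auto)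
    qed measurable
    have "(LINT \<zeta>|\<mu>. norm (?g (Suc N) \<zeta> - ?g N \<zeta>)) \<le> (LINT \<zeta>|\<mu>. norm (b N \<zeta> - 1))"
    proof (rule integral_mono_AE)
      show "integrable \<mu> (\<lambda>\<zeta>. norm (?g (Suc N) \<zeta> - ?g N \<zeta>))"
        by (intro integrable_norm Bochner_Integration.integrable_diff Hinf_integrable gH)
      show "integrable \<mu> (\<lambda>\<zeta>. norm (b N \<zeta> - 1))" using bi by simp
      show "AE \<zeta> in \<mu>. norm (?g (Suc N) \<zeta> - ?g N \<zeta>) \<le> norm (b N \<zeta> - 1)"
        using g1[of N]
      proof eventually_elim
        case (elim \<zeta>)
        have "?g (Suc N) \<zeta> - ?g N \<zeta> = ?g N \<zeta> * (b N \<zeta> - 1)" by (simp add: algebra_simps)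
        then show ?case using elim mult_right_mono[of _ 1 "norm (b N \<zeta> - 1)"] by (simp only: norm_mult) simp
      qed
    qed
    also have "\<dots> \<le> sqrt (LINT \<zeta>|\<mu>. (norm (b N \<zeta> - 1))\<^sup>2)"
      using bi i2 by (intro L1_le_sqrt_L2) auto
    also have "\<dots> \<le> sqrt (2 * (1/4) ^ N)"
    proof (rule real_sqrt_le_mono)
      have "(LINT \<zeta>|\<mu>. (norm (b N \<zeta> - 1))\<^sup>2) \<le> (LINT \<zeta>|\<mu>. 2 - 2 * Re (b N \<zeta>))"
      proof (rule integral_mono_AE[OF i2])
        show "integrable \<mu> (\<lambda>\<zeta>. 2 - 2 * Re (b N \<zeta>))" using bi by simp
        show "AE \<zeta> in \<mu>. (norm (b N \<zeta> - 1))\<^sup>2 \<le> 2 - 2 * Re (b N \<zeta>)"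
          using b1[of N]
        proof eventually_elim
          case (elim \<zeta>)
          have "(norm (b N \<zeta> - 1))\<^sup>2 = (norm (b N \<zeta>))\<^sup>2 + 1 - 2 * Re (b N \<zeta>)"
            unfolding cmod_power2 by (simp add: power2_eq_square algebra_simps)
          moreover have "(norm (b N \<zeta>))\<^sup>2 \<le> 1\<^sup>2" using elim by (intro power_mono) auto
          ultimately show ?case by simp
        qed
      qed
      also have "\<dots> = 2 - 2 * Re (LINT \<zeta>|\<mu>. b N \<zeta>)"
        using bi by (simp add: circle.prob_space[simplified])
      also have "\<dots> \<le> 2 * (1/4) ^ N" using b0[of N] by (simp add: poisson_0)
      finally show "(LINT \<zeta>|\<mu>. (norm (b N \<zeta> - 1))\<^sup>2) \<le> 2 * (1/4) ^ N" .
    qed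
    also have "(1/4::real) ^ N = ((1/2) ^ N)\<^sup>2"
      by (simp add: power2_eq_square flip: power_mult_distrib)
    then have "sqrt (2 * (1/4) ^ N) = sqrt 2 * (1/2) ^ N" by (simp only: real_sqrt_mult real_sqrt_abs) simp
    finally show ?thesis .
  qed
  have sm: "summable (\<lambda>N. LINT \<zeta>|\<mu>. norm (?g (Suc N) \<zeta> - ?g N \<zeta>))"
  proof (rule summable_comparison_test')
    show "summable (\<lambda>k. sqrt 2 * (1/2) ^ k)" by (intro summable_mult summable_geometric) simp
    show "norm (LINT \<zeta>|\<mu>. norm (?g (Suc N) \<zeta> - ?g N \<zeta>)) \<le> sqrt 2 * (1/2) ^ N" if "N \<ge> 0" for N
      using step[of N] by simp
  qed
  obtain B where B: "B \<in> Linf" "AE \<zeta> in \<mu>. norm (B \<zeta>) \<le> 1" "AE \<zeta> in \<mu>. (\<lambda>N. ?g N \<zeta>) \<longlonglongrightarrow> B \<zeta>"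
    "(\<lambda>N. LINT \<zeta>|\<mu>. norm (?g N \<zeta> - B \<zeta>)) \<longlonglongrightarrow> 0"
    by (rule L1_fast_cauchy[OF gm g1 sm])
  show ?thesis by (rule that[OF Hinf_L1_limit[OF gH B(1,4)] B(2,3)])
qed

text \<open>
The cofactor is the product of the remaining factors, to which the same convergence theorem applies.
\<close>

lemma contractive_product_factor:
  fixes b :: "nat \<Rightarrow> complex \<Rightarrow> complex"
  assumes b: "\<And>j. b j \<in> Hinf" and b1: "\<And>j. AE \<zeta> in \<mu>. norm (b j \<zeta>) \<le> 1"
    and b0: "\<And>j. 1 - (1/4) ^ j \<le> Re (poisson (b j) 0)"
    and B: "AE \<zeta> in \<mu>. (\<lambda>N. \<Prod>j<N. b j \<zeta>) \<longlonglongrightarrow> B \<zeta>"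
  obtains k where "k \<in> Hinf" "AE \<zeta> in \<mu>. norm (k \<zeta>) \<le> 1" "AE \<zeta> in \<mu>. B \<zeta> = b m \<zeta> * k \<zeta>"
proof -
  let ?c = "\<lambda>j. if j = m then (\<lambda>_. 1) else b j"
  obtain k where k: "k \<in> Hinf" "AE \<zeta> in \<mu>. norm (k \<zeta>) \<le> 1" "AE \<zeta> in \<mu>. (\<lambda>N. \<Prod>j<N. ?c j \<zeta>) \<longlonglongrightarrow> k \<zeta>"
  proof (rule contractive_product_converges[of ?c])
    show "?c j \<in> Hinf" for j using b by (simp add: Hinf_const)
    show "AE \<zeta> in \<mu>. norm (?c j \<zeta>) \<le> 1" for j using b1 by simp
    show "1 - (1/4) ^ j \<le> Re (poisson (?c j) 0)" for j
      using b0 by (simp add: poisson_0 circle.prob_space[simplified])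
  qed blast
  have "AE \<zeta> in \<mu>. B \<zeta> = b m \<zeta> * k \<zeta>"
    using B k(3)
  proof eventually_elim
    case (elim \<zeta>)
    have X: "(\<Prod>j<N. b j \<zeta>) = b m \<zeta> * (\<Prod>j<N. ?c j \<zeta>)" if "N > m" for N
    proof -
      have "(\<Prod>j<N. b j \<zeta>) = b m \<zeta> * (\<Prod>j\<in>{..<N} - {m}. b j \<zeta>)"
        using that by (subst prod.remove[of _ m]) auto
      also have "(\<Prod>j\<in>{..<N} - {m}. b j \<zeta>) = (\<Prod>j\<in>{..<N} - {m}. ?c j \<zeta>)"
        by (intro prod.cong) auto
      also have "\<dots> = (\<Prod>j<N. ?c j \<zeta>)"
        using that by (subst (2) prod.remove[of _ m]) auto
      finally show ?thesis .
    qed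
    have "eventually (\<lambda>N. b m \<zeta> * (\<Prod>j<N. ?c j \<zeta>) = (\<Prod>j<N. b j \<zeta>)) sequentially"
      by (rule eventually_mono[OF eventually_gt_at_top[of m]], rule X[symmetric])
    moreover have "(\<lambda>N. b m \<zeta> * (\<Prod>j<N. ?c j \<zeta>)) \<longlonglongrightarrow> b m \<zeta> * k \<zeta>"
      by (intro tendsto_mult_left elim(2))
    ultimately have "(\<lambda>N. \<Prod>j<N. b j \<zeta>) \<longlonglongrightarrow> b m \<zeta> * k \<zeta>"
      by (rule Lim_transform_eventually[rotated])
    with elim(1) show ?case by (rule LIMSEQ_unique)
  qed
  with k that show ?thesis by blast
qed

section \<open>Blaschke factors\<close>

text \<open>
Normalized to be positive at the origin, as the convergence of products requires.
\<close>

definition blaschke_factor :: "complex \<Rightarrow> complex \<Rightarrow> complex" where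
  "blaschke_factor a z = of_real (norm a) / a * ((a - z) / (1 - cnj a * z))"

lemma blaschke_factor:
  assumes a: "norm a < 1" "a \<noteq> 0"
  shows "blaschke_factor a \<in> Hinf" "norm \<zeta> = 1 \<Longrightarrow> norm (blaschke_factor a \<zeta>) = 1"
    "poisson (blaschke_factor a) 0 = of_real (norm a)" "poisson (blaschke_factor a) a = 0"
proof -
  have nz: "1 - cnj a * z \<noteq> 0" if "norm z \<le> 1" for z
    using that a by (intro one_minus_mult_nonzero) auto
  have c: "continuous_on (cball 0 1) (blaschke_factor a)" "blaschke_factor a holomorphic_on ball 0 1"
    unfolding blaschke_factor_def[abs_def] using nz a by (auto intro!: continuous_intros holomorphic_intros)
  show "blaschke_factor a \<in> Hinf" using c by (rule Hinf_continuous_holomorphic)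
  show "poisson (blaschke_factor a) 0 = of_real (norm a)" "poisson (blaschke_factor a) a = 0"
    using poisson_holomorphic[OF c] a by (auto simp: blaschke_factor_def)
  assume z: "norm \<zeta> = 1"
  have "1 - cnj a * \<zeta> = \<zeta> * cnj (\<zeta> - a)"
    using z complex_norm_square[of \<zeta>] by (simp add: algebra_simps)
  then have "norm (1 - cnj a * \<zeta>) = norm (a - \<zeta>)"
    using z by (simp add: norm_mult norm_minus_commute del: complex_cnj_diff)
  moreover have "a \<noteq> \<zeta>" using z a by auto
  ultimately show "norm (blaschke_factor a \<zeta>) = 1"
    using nz[of \<zeta>] z a by (simp add: blaschke_factor_def norm_mult norm_divide)
qed

section \<open>Outer functions with integrable logarithm\<close>

text \<open>
If \<open>P \<eta> \<le> c\<close> near the circle, then \<open>\<integral> max(0, \<eta> - c)\<close> is at most the mean distance between \<open>\<eta>\<close> and its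
dilated Poisson integrals, which tends to 0. So the values of \<open>P \<eta>\<close> near the circle approach the
essential supremum of \<open>\<eta>\<close>.
\<close>

lemma AE_le_if_poisson_le:
  fixes \<eta> :: "complex \<Rightarrow> real"
  assumes \<eta>: "integrable \<mu> \<eta>" and s: "0 \<le> s" "s < 1"
    and le: "\<And>z. s \<le> norm z \<Longrightarrow> norm z < 1 \<Longrightarrow> poisson \<eta> z \<le> c"
  shows "AE \<zeta> in \<mu>. \<eta> \<zeta> \<le> c"
proof -
  define r where "r k = max s (rad k)" for k
  have r: "0 \<le> r k" "r k < 1" "s \<le> r k" for k using s rad(1,2)[of k] by (auto simp: r_def)
  have "r \<longlonglongrightarrow> max s 1" unfolding r_def by (intro tendsto_max tendsto_const rad)
  then have r1: "r \<longlonglongrightarrow> 1" using s by (simp add: max_def)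
  let ?h = "\<lambda>\<zeta>. max 0 (\<eta> \<zeta> - c)"
  have hi: "integrable \<mu> ?h" using \<eta> by (intro integrable_max) auto
  have "(LINT \<zeta>|\<mu>. ?h \<zeta>) \<le> (LINT \<zeta>|\<mu>. norm (poisson \<eta> (of_real (r k) * \<zeta>) - \<eta> \<zeta>))" for k
  proof (rule integral_mono[OF hi])
    show "integrable \<mu> (\<lambda>\<zeta>. norm (poisson \<eta> (of_real (r k) * \<zeta>) - \<eta> \<zeta>))"
      by (intro integrable_norm Bochner_Integration.integrable_diff integrable_poisson_radial \<eta> r)
    fix \<zeta> assume "\<zeta> \<in> space \<mu>"
    then have "norm (of_real (r k) * \<zeta>) = r k" using r by (simp add: norm_mult)
    then have "poisson \<eta> (of_real (r k) * \<zeta>) \<le> c" using r by (intro le) auto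
    then show "?h \<zeta> \<le> norm (poisson \<eta> (of_real (r k) * \<zeta>) - \<eta> \<zeta>)" by auto
  qed
  then have "(LINT \<zeta>|\<mu>. ?h \<zeta>) \<le> 0"
    using poisson_radial_L1[OF \<eta> r(1,2) r1] by (intro LIMSEQ_le_const) auto
  then have "(LINT \<zeta>|\<mu>. ?h \<zeta>) = 0" by (intro antisym Bochner_Integration.integral_nonneg) auto
  then have "AE \<zeta> in \<mu>. ?h \<zeta> = 0" using hi by (subst (asm) integral_nonneg_eq_0_iff_AE) auto
  then show ?thesis by eventually_elim auto
qed

text \<open>
When \<open>log \<eta>\<close> is unbounded below, the outer function is the infinite product of outer functions with the moduli
\<open>max(\<eta>, t\<^sub>j\<^sub>+\<^sub>1) / max(\<eta>, t\<^sub>j) \<le> 1\<close> for a fast decreasing sequence \<open>t\<^sub>j\<close>. Integrability of \<open>log \<eta>\<close> is what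
brings their values at the origin close to 1.
\<close>

theorem outer_function_exists_integrable_log:
  fixes \<eta> :: "complex \<Rightarrow> real"
  assumes \<eta>: "\<eta> \<in> Linf" "AE \<zeta> in \<mu>. 0 < \<eta> \<zeta>" and ln: "integrable \<mu> (\<lambda>\<zeta>. ln (\<eta> \<zeta>))"
  obtains F where "F \<in> Hinf" "AE \<zeta> in \<mu>. norm (F \<zeta>) = \<eta> \<zeta>"
proof -
  note m[measurable] = Linf_measurable[OF \<eta>(1)]
  obtain M where M: "M > 0" "AE \<zeta> in \<mu>. norm (\<eta> \<zeta>) \<le> M" using \<eta>(1) by (rule LinfE)
  define t where "t n = 1 / (real n + 1)" for n
  have t: "0 < t n" "t n \<le> 1" for n by (auto simp: t_def)
  have tmono: "t n \<le> t k" if "k \<le> n" for k n using that by (auto simp: t_def intro!: divide_left_mono)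
  have t0: "t \<longlonglongrightarrow> 0" unfolding t_def by real_asymp
  define v where "v n \<zeta> = ln (max (\<eta> \<zeta>) (t n))" for n \<zeta>
  have vm[measurable]: "v n \<in> borel_measurable \<mu>" for n unfolding v_def by measurable
  have vb: "AE \<zeta> in \<mu>. \<bar>v n \<zeta>\<bar> \<le> \<bar>ln (t n)\<bar> + \<bar>ln (max M 1)\<bar>" for n
    using M(2)
  proof eventually_elim
    case (elim \<zeta>)
    have "ln (t n) \<le> v n \<zeta>" unfolding v_def using t[of n] by (subst ln_le_cancel_iff) auto
    moreover have "v n \<zeta> \<le> ln (max M 1)"
      unfolding v_def using t[of n] elim by (subst ln_le_cancel_iff) (auto simp: max_def)
    ultimately show ?case by linarith
  qed
  have vi: "integrable \<mu> (v n)" for n using vb by (intro integrable_circle_bounded) auto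
  have ge: "AE \<zeta> in \<mu>. ln (\<eta> \<zeta>) \<le> v n \<zeta>" for n
    using \<eta>(2) by eventually_elim (auto simp: v_def)
  have "(\<lambda>n. LINT \<zeta>|\<mu>. norm (v n \<zeta> - ln (\<eta> \<zeta>))) \<longlonglongrightarrow> 0"
  proof (rule L1_tendsto_dominated[where w = "\<lambda>\<zeta>. \<bar>ln (\<eta> \<zeta>)\<bar>"])
    show "AE \<zeta> in \<mu>. (\<lambda>n. v n \<zeta>) \<longlonglongrightarrow> ln (\<eta> \<zeta>)"
      using \<eta>(2)
    proof eventually_elim
      case (elim \<zeta>)
      have "(\<lambda>n. max (\<eta> \<zeta>) (t n)) \<longlonglongrightarrow> max (\<eta> \<zeta>) 0" by (intro tendsto_max tendsto_const t0)
      then show ?case unfolding v_def using elim by (intro tendsto_ln) auto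
    qed
    show "AE \<zeta> in \<mu>. norm (v n \<zeta> - ln (\<eta> \<zeta>)) \<le> \<bar>ln (\<eta> \<zeta>)\<bar>" for n
      using \<eta>(2)
    proof eventually_elim
      case (elim \<zeta>)
      show ?case
      proof (cases "t n \<le> \<eta> \<zeta>")
        case False
        then have "ln (\<eta> \<zeta>) \<le> ln (t n)" "ln (t n) \<le> 0" using elim t[of n] by auto
        then show ?thesis using False by (simp add: v_def max_def)
      qed (auto simp: v_def max_def)
    qed
  qed (use ln in auto)
  then have "eventually (\<lambda>n. (LINT \<zeta>|\<mu>. norm (v n \<zeta> - ln (\<eta> \<zeta>))) < (1/4) ^ j) sequentially" for j
    by (rule order_tendstoD) simp
  then have "\<exists>N. \<forall>j. \<forall>n\<ge>N j. (LINT \<zeta>|\<mu>. norm (v n \<zeta> - ln (\<eta> \<zeta>))) < (1/4) ^ j"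
    unfolding eventually_sequentially by (intro choice allI)
  \<comment> \<open>An increasing choice of indices makes all the quotients of moduli at most 1.\<close>
  then obtain N where N: "\<And>j n. n \<ge> N j \<Longrightarrow> (LINT \<zeta>|\<mu>. norm (v n \<zeta> - ln (\<eta> \<zeta>))) < (1/4) ^ j" by blast
  define \<sigma> where "\<sigma> j = j + (\<Sum>i\<le>j. N i)" for j
  have \<sigma>: "N j \<le> \<sigma> j" "j \<le> \<sigma> j" "\<sigma> j \<le> \<sigma> (Suc j)" for j
    unfolding \<sigma>_def using member_le_sum[of j "{..j}" N] by auto
  define u where "u j \<zeta> = v (\<sigma> (Suc j)) \<zeta> - v (\<sigma> j) \<zeta>" for j \<zeta>
  have um[measurable]: "u j \<in> borel_measurable \<mu>" for j unfolding u_def by measurable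
  have "\<exists>K. AE \<zeta> in \<mu>. \<bar>u j \<zeta>\<bar> \<le> K" for j
  proof -
    have "AE \<zeta> in \<mu>. \<bar>u j \<zeta>\<bar> \<le> (\<bar>ln (t (\<sigma> (Suc j)))\<bar> + \<bar>ln (max M 1)\<bar>) + (\<bar>ln (t (\<sigma> j))\<bar> + \<bar>ln (max M 1)\<bar>)"
      unfolding u_def using vb[of "\<sigma> (Suc j)"] vb[of "\<sigma> j"]
      by eventually_elim (rule order_trans[OF abs_triangle_ineq4], rule add_mono)
    then show ?thesis by blast
  qed
  then have "\<exists>b. b \<in> Hinf \<and> (AE \<zeta> in \<mu>. norm (b \<zeta>) = exp (u j \<zeta>)) \<and> poisson b 0 = of_real (exp (LINT \<zeta>|\<mu>. u j \<zeta>))" for j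
    using outer_function_exists[OF um[of j]] by metis
  then obtain b where b: "\<And>j. b j \<in> Hinf" "\<And>j. AE \<zeta> in \<mu>. norm (b j \<zeta>) = exp (u j \<zeta>)"
    "\<And>j. poisson (b j) 0 = of_real (exp (LINT \<zeta>|\<mu>. u j \<zeta>))" by metis
  have ule: "u j \<zeta> \<le> 0" for j \<zeta>
    unfolding u_def v_def using t tmono[OF \<sigma>(3)[of j]] by (simp add: less_max_iff_disj)
  obtain B where B: "B \<in> Hinf" "AE \<zeta> in \<mu>. (\<lambda>n. \<Prod>j<n. b j \<zeta>) \<longlonglongrightarrow> B \<zeta>"
  proof (rule contractive_product_converges[of b])
    show "AE \<zeta> in \<mu>. norm (b j \<zeta>) \<le> 1" for j using b(2)[of j] by eventually_elim (use ule in simp)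
    show "1 - (1/4) ^ j \<le> Re (poisson (b j) 0)" for j
    proof -
      have "(LINT \<zeta>|\<mu>. - u j \<zeta>) \<le> (LINT \<zeta>|\<mu>. norm (v (\<sigma> j) \<zeta> - ln (\<eta> \<zeta>)))"
      proof (rule integral_mono_AE)
        show "AE \<zeta> in \<mu>. - u j \<zeta> \<le> norm (v (\<sigma> j) \<zeta> - ln (\<eta> \<zeta>))"
          using ge[of "\<sigma> (Suc j)"] by eventually_elim (auto simp: u_def)
      qed (use vi ln in \<open>auto simp: u_def\<close>)
      also have "\<dots> < (1/4) ^ j" by (rule N[OF \<sigma>(1)])
      finally have "1 - (1/4) ^ j \<le> 1 + (LINT \<zeta>|\<mu>. u j \<zeta>)" using vi by (simp add: u_def)
      also have "\<dots> \<le> exp (LINT \<zeta>|\<mu>. u j \<zeta>)" by (rule exp_ge_add_one_self)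
      finally show ?thesis by (simp add: b(3))
    qed
  qed (use b in blast)+
  obtain F0 where F0: "F0 \<in> Hinf" "AE \<zeta> in \<mu>. norm (F0 \<zeta>) = exp (v (\<sigma> 0) \<zeta>)"
    by (rule outer_function_exists[OF vm vb])
  have "AE \<zeta> in \<mu>. \<forall>j. norm (b j \<zeta>) = exp (u j \<zeta>)" using b(2) by (simp add: AE_all_countable)
  then have "AE \<zeta> in \<mu>. norm (F0 \<zeta> * B \<zeta>) = \<eta> \<zeta>"
    using B(2) F0(2) \<eta>(2)
  proof eventually_elim
    case (elim \<zeta>)
    have "(\<lambda>n. norm (F0 \<zeta> * (\<Prod>j<n. b j \<zeta>))) \<longlonglongrightarrow> norm (F0 \<zeta> * B \<zeta>)"
      by (intro tendsto_norm tendsto_mult_left elim)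
    moreover have "norm (F0 \<zeta> * (\<Prod>j<n. b j \<zeta>)) = max (\<eta> \<zeta>) (t (\<sigma> n))" for n
    proof -
      have "norm (F0 \<zeta> * (\<Prod>j<n. b j \<zeta>)) = exp (v (\<sigma> 0) \<zeta> + (\<Sum>j<n. u j \<zeta>))"
        using elim by (simp add: norm_mult prod_norm[symmetric] exp_add exp_sum)
      also have "v (\<sigma> 0) \<zeta> + (\<Sum>j<n. u j \<zeta>) = v (\<sigma> n) \<zeta>"
        unfolding u_def by (subst sum_lessThan_telescope[of "\<lambda>j. v (\<sigma> j) \<zeta>"]) simp
      finally show ?thesis using t[of "\<sigma> n"] by (simp add: v_def less_max_iff_disj)
    qed
    moreover have "(\<lambda>n. max (\<eta> \<zeta>) (t (\<sigma> n))) \<longlonglongrightarrow> max (\<eta> \<zeta>) 0"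
    proof (intro tendsto_max tendsto_const filterlim_compose[OF t0])
      show "filterlim \<sigma> at_top sequentially"
        using \<sigma>(2) by (intro filterlim_at_top_mono[OF filterlim_ident]) auto
    qed
    ultimately show ?case using elim(4) LIMSEQ_unique by (auto simp: max_def)
  qed
  then show ?thesis using that Hinf_mult[OF F0(1) B(1)] by blast
qed

section \<open>Inner multipliers for bounded real functions\<close>

text \<open>
Let \<open>W\<close> be outer with modulus \<open>e\<close> on \<open>A\<close> and \<open>1/e\<close> off \<open>A\<close>. The meromorphic function \<open>1 / (1 + W)\<close> is nearly 1 on
\<open>A\<close> and nearly 0 off \<open>A\<close>, so it imitates the indicator of \<open>A\<close>. Its poles are removed by multiplication with the
inner factor \<open>\<phi>\<close> of \<open>1 + W\<close>, and the result is \<open>h\<close>, the reciprocal of the outer factor. If \<open>A\<close> is small, \<open>W(0)\<close>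
is large and \<open>\<phi>(0)\<close> is close to 1.
\<close>

lemma small_set_inner:
  assumes A[measurable]: "A \<in> sets \<mu>" and e: "0 < e" "e \<le> 1/2"
  obtains \<phi> h p where "\<phi> \<in> Hinf" "AE \<zeta> in \<mu>. norm (\<phi> \<zeta>) = 1" "h \<in> Hinf"
    "poisson \<phi> 0 = of_real p" "1 - measure \<mu> A * ln (1/e) - e \<le> p"
    "AE \<zeta> in \<mu>. norm (\<phi> \<zeta> * of_real (indicator A \<zeta>) - h \<zeta>) \<le> 2 * e"
proof -
  let ?m = "measure \<mu> A"
  have iA: "integrable \<mu> (indicator A :: complex \<Rightarrow> real)"
    by (intro integrable_circle_bounded[of _ 1] borel_measurable_indicator A AE_I2) (simp add: indicator_def)
  have As: "A \<inter> sphere 0 1 = A" using sets.sets_into_space[OF A] by auto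
  define uW where "uW \<zeta> = ln e * (2 * indicator A \<zeta> - 1)" for \<zeta>
  have uWm: "uW \<in> borel_measurable \<mu>" unfolding uW_def by measurable
  have "AE \<zeta> in \<mu>. \<bar>uW \<zeta>\<bar> \<le> \<bar>ln e\<bar>" by (intro AE_I2) (auto simp: uW_def indicator_def)
  then obtain W where W: "W \<in> Hinf" "AE \<zeta> in \<mu>. norm (W \<zeta>) = exp (uW \<zeta>)"
    and W0: "poisson W 0 = of_real (exp (LINT \<zeta>|\<mu>. uW \<zeta>))"
    using outer_function_exists[OF uWm] by metis
  have [measurable]: "W \<in> borel_measurable \<mu>" using W(1) by (rule Hinf_measurable)
  have iuW: "(LINT \<zeta>|\<mu>. uW \<zeta>) = ln e * (2 * ?m - 1)"
    unfolding uW_def using iA As by (simp add: circle.prob_space[simplified])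
  have W1H: "(\<lambda>\<zeta>. 1 + W \<zeta>) \<in> Hinf" by (intro Hinf_add Hinf_const W)
  define v where "v \<zeta> = - ln (norm (1 + W \<zeta>))" for \<zeta>
  have vm: "v \<in> borel_measurable \<mu>" unfolding v_def by measurable
  have WA: "AE \<zeta> in \<mu>. (\<zeta> \<in> A \<longrightarrow> norm (W \<zeta>) = e) \<and> (\<zeta> \<notin> A \<longrightarrow> norm (W \<zeta>) = 1 / e)"
    using W(2) by eventually_elim (use e in \<open>auto simp: uW_def exp_minus field_simps\<close>)
  have bounds: "AE \<zeta> in \<mu>. (\<zeta> \<in> A \<longrightarrow> 1 - e \<le> norm (1 + W \<zeta>) \<and> norm (1 + W \<zeta>) \<le> 1 + e) \<and>
     (\<zeta> \<notin> A \<longrightarrow> 1 / e - 1 \<le> norm (1 + W \<zeta>) \<and> norm (1 + W \<zeta>) \<le> (1 + e) / e)"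
    using WA
  proof eventually_elim
    case (elim \<zeta>)
    have "norm (1 + W \<zeta>) \<le> 1 + norm (W \<zeta>)" using norm_triangle_ineq[of 1 "W \<zeta>"] by simp
    moreover have "1 - norm (W \<zeta>) \<le> norm (1 + W \<zeta>)" using norm_diff_ineq[of 1 "W \<zeta>"] by simp
    moreover have "norm (W \<zeta>) - 1 \<le> norm (1 + W \<zeta>)" using norm_diff_ineq[of "W \<zeta>" 1] by (simp add: add.commute)
    moreover have "(1 + e) / e = 1 + 1 / e" using e by (simp add: field_simps)
    ultimately show ?case using elim by auto
  qed
  have e2: "2 \<le> 1 / e" using e by (simp add: field_simps)
  have pos: "AE \<zeta> in \<mu>. 1 / 2 \<le> norm (1 + W \<zeta>)"
    using bounds by eventually_elim (use e e2 in force)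
  have vlow: "AE \<zeta> in \<mu>. - (ln (1 + e) - (1 - indicator A \<zeta>) * ln e) \<le> v \<zeta>"
    using bounds pos
  proof eventually_elim
    case (elim \<zeta>)
    show ?case
    proof (cases "\<zeta> \<in> A")
      case True
      then have "ln (norm (1 + W \<zeta>)) \<le> ln (1 + e)" using elim by (subst ln_le_cancel_iff) auto
      then show ?thesis using True by (simp add: v_def)
    next
      case False
      then have "ln (norm (1 + W \<zeta>)) \<le> ln ((1 + e) / e)" using elim e by (subst ln_le_cancel_iff) auto
      also have "\<dots> = ln (1 + e) - ln e" using e by (simp add: ln_div)
      finally show ?thesis using False by (simp add: v_def)
    qed
  qed
  have "AE \<zeta> in \<mu>. \<bar>v \<zeta>\<bar> \<le> ln 2 + (ln (1 + e) + \<bar>ln e\<bar>)"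
    using vlow pos
  proof eventually_elim
    case (elim \<zeta>)
    have "ln (1 / 2) \<le> ln (norm (1 + W \<zeta>))" using elim(2) by (subst ln_le_cancel_iff) auto
    then have "v \<zeta> \<le> ln 2" by (simp add: v_def ln_div)
    moreover have "ln (1 + e) - (1 - indicator A \<zeta>) * ln e \<le> ln (1 + e) + \<bar>ln e\<bar>"
      by (auto simp: indicator_def)
    moreover have "0 \<le> ln (1 + e)" "0 \<le> ln (2::real)" using e by auto
    ultimately show ?case using elim(1) by linarith
  qed
  note vb = this
  obtain h where h: "h \<in> Hinf" "AE \<zeta> in \<mu>. norm (h \<zeta>) = exp (v \<zeta>)"
    and h0: "poisson h 0 = of_real (exp (LINT \<zeta>|\<mu>. v \<zeta>))"
    by (rule outer_function_exists[OF vm vb])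
  define \<phi> where "\<phi> \<zeta> = (1 + W \<zeta>) * h \<zeta>" for \<zeta>
  have \<phi>H: "\<phi> \<in> Hinf" unfolding \<phi>_def by (intro Hinf_mult W1H h)
  have nh: "AE \<zeta> in \<mu>. norm (h \<zeta>) = 1 / norm (1 + W \<zeta>)"
    using h(2) pos
  proof eventually_elim
    case (elim \<zeta>)
    then have "0 < norm (1 + W \<zeta>)" by linarith
    then show ?case using elim by (simp add: v_def exp_minus inverse_eq_divide)
  qed
  have \<phi>1: "AE \<zeta> in \<mu>. norm (\<phi> \<zeta>) = 1"
    using nh pos
  proof eventually_elim
    case (elim \<zeta>)
    then have "0 < norm (1 + W \<zeta>)" by linarith
    then show ?case using elim by (simp add: \<phi>_def norm_mult)
  qed
  define p where "p = (1 + exp (LINT \<zeta>|\<mu>. uW \<zeta>)) * exp (LINT \<zeta>|\<mu>. v \<zeta>)"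
  have "poisson \<phi> 0 = poisson (\<lambda>\<zeta>. 1 + W \<zeta>) 0 * poisson h 0"
    unfolding \<phi>_def[abs_def] by (intro poisson_mult W1H h) simp
  also have "poisson (\<lambda>\<zeta>. 1 + W \<zeta>) 0 = poisson (\<lambda>_. 1) 0 + poisson W 0"
    by (intro poisson_add Hinf_integrable W Hinf_const) simp
  also have "poisson (\<lambda>_. 1 :: complex) 0 = 1" by (simp add: poisson_0 circle.prob_space[simplified])
  finally have p: "poisson \<phi> 0 = of_real p" by (simp add: W0 h0 p_def)
  have iv: "integrable \<mu> v" using vm vb by (intro integrable_circle_bounded) auto
  have "(LINT \<zeta>|\<mu>. - (ln (1 + e) - (1 - indicator A \<zeta>) * ln e)) \<le> (LINT \<zeta>|\<mu>. v \<zeta>)"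
    using iA iv vlow by (intro integral_mono_AE) auto
  also have "(LINT \<zeta>|\<mu>. - (ln (1 + e) - (1 - indicator A \<zeta>) * ln e)) = - ln (1 + e) + (1 - ?m) * ln e"
    using iA As by (simp add: circle.prob_space[simplified])
  finally have v1: "- ln (1 + e) + (1 - ?m) * ln e \<le> (LINT \<zeta>|\<mu>. v \<zeta>)" .
  \<comment> \<open>Since \<open>W(0) > 0\<close>, \<open>\<phi>(0) = (1 + W(0)) h(0) \<ge> W(0) h(0)\<close>; the logarithm of the last product is at least
    \<open>(2 m - 1) ln e + (1 - m) ln e - ln (1 + e) = m ln e - ln (1 + e)\<close> with \<open>m\<close> the measure of \<open>A\<close>.\<close>
  have "1 - ?m * ln (1/e) - e \<le> 1 + (?m * ln e - ln (1 + e))"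
    using ln_add_one_self_le_self[of e] e by (simp add: ln_div)
  also have "\<dots> \<le> exp (?m * ln e - ln (1 + e))" by (rule exp_ge_add_one_self)
  also have "\<dots> = exp (ln e * (2 * ?m - 1)) * exp (- ln (1 + e) + (1 - ?m) * ln e)"
    by (simp add: algebra_simps flip: exp_add)
  also have "\<dots> \<le> (1 + exp (LINT \<zeta>|\<mu>. uW \<zeta>)) * exp (LINT \<zeta>|\<mu>. v \<zeta>)"
    unfolding iuW using v1 by (intro mult_mono) auto
  finally have pge: "1 - ?m * ln (1/e) - e \<le> p" by (simp add: p_def)
  have "AE \<zeta> in \<mu>. norm (\<phi> \<zeta> * of_real (indicator A \<zeta>) - h \<zeta>) \<le> 2 * e"
    using nh WA bounds
  proof eventually_elim
    case (elim \<zeta>)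
    show ?case
    proof (cases "\<zeta> \<in> A")
      case True
      have "\<phi> \<zeta> * of_real (indicator A \<zeta>) - h \<zeta> = W \<zeta> * h \<zeta>" using True by (simp add: \<phi>_def algebra_simps)
      also have "norm \<dots> = e * (1 / norm (1 + W \<zeta>))" using elim True by (simp add: norm_mult)
      also have "\<dots> \<le> e * (1 / (1 / 2))"
        using elim True e by (intro mult_left_mono divide_left_mono mult_pos_pos) auto
      finally show ?thesis by simp
    next
      case False
      have "1 / (2 * e) \<le> norm (1 + W \<zeta>)"
      proof -
        have "1 / (2 * e) = 1 / e - 1 / (2 * e)" using e by (simp add: field_simps)
        also have "\<dots> \<le> 1 / e - 1" using e by (simp add: field_simps)
        finally show ?thesis using elim False by auto
      qed
      then have "1 / norm (1 + W \<zeta>) \<le> 1 / (1 / (2 * e))"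
        using e by (intro divide_left_mono mult_pos_pos) (auto intro: order_less_le_trans[of 0 "1 / (2 * e)"])
      then show ?thesis using elim False by simp
    qed
  qed
  then show ?thesis using that[OF \<phi>H \<phi>1 h(1) p pge] by blast
qed

lemma small_simple_function_inner:
  fixes c :: "nat \<Rightarrow> real"
  assumes A: "\<And>i. i < N \<Longrightarrow> A i \<in> sets \<mu>" and c: "\<And>i. i < N \<Longrightarrow> \<bar>c i\<bar> \<le> C" and e: "0 < e" "e \<le> 1/2"
    and small: "\<And>i. i < N \<Longrightarrow> measure \<mu> (A i) * ln (1/e) \<le> e"
  shows "\<exists>\<phi> h p. \<phi> \<in> Hinf \<and> (AE \<zeta> in \<mu>. norm (\<phi> \<zeta>) = 1) \<and> h \<in> Hinf \<and> poisson \<phi> 0 = of_real p \<and>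
    (1 - 2 * e) ^ N \<le> p \<and>
    (AE \<zeta> in \<mu>. norm (\<phi> \<zeta> * of_real (\<Sum>i<N. c i * indicator (A i) \<zeta>) - h \<zeta>) \<le> real N * (C * (2 * e)))"
  using A c small
proof (induction N)
  case 0
  show ?case
    by (intro exI[of _ "\<lambda>_. 1"] exI[of _ "\<lambda>_. 0"] exI[of _ 1])
       (simp add: Hinf_const poisson_0 circle.prob_space[simplified])
next
  case (Suc N)
  obtain \<phi> h p where IH: "\<phi> \<in> Hinf" "AE \<zeta> in \<mu>. norm (\<phi> \<zeta>) = 1" "h \<in> Hinf" "poisson \<phi> 0 = of_real p"
    "(1 - 2 * e) ^ N \<le> p"
    "AE \<zeta> in \<mu>. norm (\<phi> \<zeta> * of_real (\<Sum>i<N. c i * indicator (A i) \<zeta>) - h \<zeta>) \<le> real N * (C * (2 * e))"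
    using Suc.IH[OF Suc.prems(1) Suc.prems(2) Suc.prems(3), OF less_SucI less_SucI less_SucI] by blast
  obtain \<psi> k q where S: "\<psi> \<in> Hinf" "AE \<zeta> in \<mu>. norm (\<psi> \<zeta>) = 1" "k \<in> Hinf"
    "poisson \<psi> 0 = of_real q" "1 - measure \<mu> (A N) * ln (1/e) - e \<le> q"
    "AE \<zeta> in \<mu>. norm (\<psi> \<zeta> * of_real (indicator (A N) \<zeta>) - k \<zeta>) \<le> 2 * e"
    by (rule small_set_inner[OF Suc.prems(1)[OF lessI] e])
  have "poisson (\<lambda>\<zeta>. \<phi> \<zeta> * \<psi> \<zeta>) 0 = of_real (p * q)"
    using IH S by (simp add: poisson_mult)
  moreover have "(1 - 2 * e) ^ Suc N \<le> p * q"
  proof -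
    have "1 - 2 * e \<le> q" using S(5) Suc.prems(3)[of N] by simp
    moreover have "0 \<le> (1 - 2 * e) ^ N" using e by simp
    moreover have "0 \<le> p" using \<open>0 \<le> (1 - 2 * e) ^ N\<close> IH(5) by linarith
    ultimately have "(1 - 2 * e) ^ N * (1 - 2 * e) \<le> p * q" using IH(5) e by (intro mult_mono) auto
    then show ?thesis by (simp add: mult.commute)
  qed
  moreover have "AE \<zeta> in \<mu>. norm (\<phi> \<zeta> * \<psi> \<zeta>) = 1"
    using IH(2) S(2) by eventually_elim (simp add: norm_mult)
  moreover have "AE \<zeta> in \<mu>. norm (\<phi> \<zeta> * \<psi> \<zeta> * of_real (\<Sum>i<Suc N. c i * indicator (A i) \<zeta>)
      - (\<psi> \<zeta> * h \<zeta> + of_real (c N) * (\<phi> \<zeta> * k \<zeta>))) \<le> real (Suc N) * (C * (2 * e))"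
    using IH(2,6) S(2,6)
  proof eventually_elim
    case (elim \<zeta>)
    have "\<phi> \<zeta> * \<psi> \<zeta> * of_real (\<Sum>i<Suc N. c i * indicator (A i) \<zeta>) - (\<psi> \<zeta> * h \<zeta> + of_real (c N) * (\<phi> \<zeta> * k \<zeta>))
       = \<psi> \<zeta> * (\<phi> \<zeta> * of_real (\<Sum>i<N. c i * indicator (A i) \<zeta>) - h \<zeta>)
         + of_real (c N) * (\<phi> \<zeta> * (\<psi> \<zeta> * of_real (indicator (A N) \<zeta>) - k \<zeta>))"
      by (simp only: sum.lessThan_Suc of_real_add of_real_mult) (simp add: algebra_simps)
    also have "norm \<dots> \<le> real N * (C * (2 * e)) + C * (2 * e)"
    proof (rule norm_triangle_mono)
      show "norm (\<psi> \<zeta> * (\<phi> \<zeta> * of_real (\<Sum>i<N. c i * indicator (A i) \<zeta>) - h \<zeta>)) \<le> real N * (C * (2 * e))"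
        using elim by (simp only: norm_mult mult_1)
      have "norm (of_real (c N) * (\<phi> \<zeta> * (\<psi> \<zeta> * of_real (indicator (A N) \<zeta>) - k \<zeta>)))
         = \<bar>c N\<bar> * norm (\<psi> \<zeta> * of_real (indicator (A N) \<zeta>) - k \<zeta>)"
        using elim by (simp only: norm_mult norm_of_real mult_1)
      also have "\<dots> \<le> C * (2 * e)"
        using elim Suc.prems(2)[of N] by (intro mult_mono) auto
      finally show "norm (of_real (c N) * (\<phi> \<zeta> * (\<psi> \<zeta> * of_real (indicator (A N) \<zeta>) - k \<zeta>))) \<le> C * (2 * e)" .
    qed
    finally show ?case by (simp add: algebra_simps)
  qed
  moreover have "(\<lambda>\<zeta>. \<phi> \<zeta> * \<psi> \<zeta>) \<in> Hinf" "(\<lambda>\<zeta>. \<psi> \<zeta> * h \<zeta> + of_real (c N) * (\<phi> \<zeta> * k \<zeta>)) \<in> Hinf"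
    by (intro Hinf_add Hinf_mult Hinf_const IH S)+
  ultimately show ?case
    by (intro exI[of _ "\<lambda>\<zeta>. \<phi> \<zeta> * \<psi> \<zeta>"] exI[of _ "\<lambda>\<zeta>. \<psi> \<zeta> * h \<zeta> + of_real (c N) * (\<phi> \<zeta> * k \<zeta>)"]
        exI[of _ "p * q"]) blast
qed

text \<open>
Counting the multiples of \<open>\<delta>\<close> below \<open>x\<close> gives a step function that differs from \<open>x\<close> by at most \<open>\<delta>\<close>. The
statement separates the case in which all thresholds are passed, because only there is the sum exact, which
makes the induction work.
\<close>

lemma layer_sum_nonneg:
  fixes x \<delta> :: real
  assumes "0 \<le> x" "0 < \<delta>"
  defines "S \<equiv> \<lambda>n. \<Sum>i<n. \<delta> * of_bool (real (Suc i) * \<delta> < x)"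
  shows "(real n * \<delta> < x \<longrightarrow> S n = real n * \<delta>) \<and> (x \<le> real n * \<delta> \<longrightarrow> x - \<delta> \<le> S n \<and> S n \<le> x)"
proof (induction n)
  case 0
  then show ?case using assms by (simp add: S_def)
next
  case (Suc n)
  have S: "S (Suc n) = S n + \<delta> * of_bool (real (Suc n) * \<delta> < x)"
    by (simp only: S_def sum.lessThan_Suc)
  have le: "real n * \<delta> \<le> real (Suc n) * \<delta>" using assms by (intro mult_right_mono) auto
  have eq: "real (Suc n) * \<delta> = real n * \<delta> + \<delta>" by (simp add: algebra_simps)
  consider "real (Suc n) * \<delta> < x" | "real n * \<delta> < x" "x \<le> real (Suc n) * \<delta>" | "x \<le> real n * \<delta>"
    by linarith
  then show ?case
  proof cases
    case 1
    then show ?thesis using Suc S le eq by simp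
  next
    case 2
    then show ?thesis using Suc S le eq by simp
  next
    case 3
    then have "\<not> real (Suc n) * \<delta> < x" using le by linarith
    then show ?thesis using Suc S 3 le by simp
  qed
qed

lemma layer_sum:
  fixes x \<delta> :: real
  assumes x: "\<bar>x\<bar> \<le> real n * \<delta>" and d: "0 < \<delta>"
  shows "\<bar>x - ((\<Sum>i<n. \<delta> * of_bool (real (Suc i) * \<delta> < x)) - (\<Sum>i<n. \<delta> * of_bool (real (Suc i) * \<delta> < - x)))\<bar> \<le> \<delta>"
proof -
  have z: "(\<Sum>i<n. \<delta> * of_bool (real (Suc i) * \<delta> < y)) = 0" if "y \<le> 0" for y
  proof (intro sum.neutral ballI)
    fix i
    have "0 \<le> real (Suc i) * \<delta>" using d by (intro mult_nonneg_nonneg) auto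
    then have "\<not> real (Suc i) * \<delta> < y" using that by linarith
    then show "\<delta> * of_bool (real (Suc i) * \<delta> < y) = 0" by simp
  qed
  show ?thesis
  proof (cases "0 \<le> x")
    case True
    then show ?thesis using layer_sum_nonneg[OF True d, of n] x z[of "- x"] by auto
  next
    case False
    then show ?thesis using layer_sum_nonneg[of "- x" \<delta> n] d x z[of x] by auto
  qed
qed

text \<open>
\<open>P u\<close> is the real part of an analytic function \<open>V\<close>. On the circle, the conjugate of a polynomial of degree less
than \<open>N\<close> is \<open>\<zeta>\<^sup>-\<^sup>N\<close> times a polynomial, and \<open>V(r \<zeta>)\<close> is uniformly close to its Taylor polynomials.
\<close>

lemma poisson_radial_trig:
  fixes u :: "complex \<Rightarrow> real"
  assumes u: "integrable \<mu> u" and r: "0 \<le> r" "r < 1" and e: "0 < e"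
  obtains N p where "p \<in> Hinf"
    "\<And>\<zeta>. norm \<zeta> = 1 \<Longrightarrow> norm (of_real (poisson u (of_real r * \<zeta>)) - p \<zeta> / \<zeta> ^ N) \<le> e"
proof -
  let ?I = "LINT \<zeta>|\<mu>. \<bar>u \<zeta>\<bar>" and ?C = "cauchy_transform u" and ?a = "fourier_coeff u"
  have "(\<lambda>N. r ^ N * (1 / (1 - r) * ?I)) \<longlonglongrightarrow> 0"
    using r by (intro tendsto_mult_left_zero LIMSEQ_power_zero) auto
  then have "eventually (\<lambda>N. r ^ N * (1 / (1 - r) * ?I) < e) sequentially"
    using e by (rule order_tendstoD)
  then obtain N where N: "r ^ N / (1 - r) * ?I < e" by (auto simp: eventually_sequentially)
  define p where "p \<zeta> = \<zeta> ^ N * (?C (of_real r * \<zeta>) - of_real (LINT \<zeta>|\<mu>. u \<zeta>))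
      + (\<Sum>n<N. cnj (?a n) * of_real (r ^ n) * \<zeta> ^ (N - n))" for \<zeta>
  have "p \<in> Hinf"
    unfolding p_def
    by (intro Hinf_add Hinf_mult Hinf_diff Hinf_power Hinf_const Hinf_sum Hinf_dilation cauchy_transform_holomorphic u r)
  moreover have "norm (of_real (poisson u (of_real r * \<zeta>)) - p \<zeta> / \<zeta> ^ N) \<le> e" if \<zeta>: "norm \<zeta> = 1" for \<zeta>
  proof -
    define z where "z = of_real r * \<zeta>"
    have z: "norm z < 1" "norm z = r" unfolding z_def using r \<zeta> by (auto simp: norm_mult)
    have nz: "\<zeta> \<noteq> 0" using \<zeta> by auto
    have c: "cnj \<zeta> = 1 / \<zeta>" using \<zeta> by (rule cnj_eq_inverse_circle)
    have "of_real (poisson u z) = (schwarz_integral u z + cnj (schwarz_integral u z)) / 2"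
      using Re_schwarz_integral[OF u z(1)] by (simp add: complex_add_cnj)
    also have "\<dots> = ?C z - of_real (LINT \<zeta>|\<mu>. u \<zeta>) + cnj (?C z)"
      by (simp add: schwarz_integral_def field_simps)
    finally have P: "of_real (poisson u z) = ?C z - of_real (LINT \<zeta>|\<mu>. u \<zeta>) + cnj (?C z)" .
    have "(\<Sum>n<N. cnj (?a n) * of_real (r ^ n) * \<zeta> ^ (N - n)) / \<zeta> ^ N = cnj (\<Sum>n<N. ?a n * z ^ n)"
      unfolding cnj_sum sum_divide_distrib
    proof (intro sum.cong refl)
      fix n assume "n \<in> {..<N}"
      then have "\<zeta> ^ (N - n) / \<zeta> ^ N = cnj \<zeta> ^ n"
        using nz unfolding c by (simp add: power_diff power_divide)
      then show "cnj (?a n) * of_real (r ^ n) * \<zeta> ^ (N - n) / \<zeta> ^ N = cnj (?a n * z ^ n)"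
        by (simp add: z_def power_mult_distrib flip: times_divide_eq_right)
    qed
    then have "p \<zeta> / \<zeta> ^ N = ?C z - of_real (LINT \<zeta>|\<mu>. u \<zeta>) + cnj (\<Sum>n<N. ?a n * z ^ n)"
      using nz unfolding p_def z_def[symmetric] by (simp add: add_divide_distrib)
    then have "of_real (poisson u z) - p \<zeta> / \<zeta> ^ N = cnj (?C z - (\<Sum>n<N. ?a n * z ^ n))"
      unfolding P by simp
    also have "norm \<dots> \<le> r ^ N / (1 - r) * ?I"
      using cauchy_transform_remainder[OF u z(1), of N] unfolding z(2) complex_mod_cnj .
    finally show ?thesis using N unfolding z_def by linarith
  qed
  ultimately show ?thesis using that by blast
qed

text \<open>
Write \<open>\<eta> = P \<eta> (r \<zeta>) + g\<close>. The first term is nearly a trigonometric polynomial. The remainder \<open>g\<close> is bounded and,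
for \<open>r\<close> close to 1, as small in mean as desired, so its level sets above a fixed height have small measure. The
number of layers is chosen first; only then are \<open>e\<close> and finally \<open>r\<close> fixed, since the admissible
measure of the level sets depends on \<open>e\<close>.
\<close>

theorem inner_multiplier_approx:
  fixes \<eta> :: "complex \<Rightarrow> real"
  assumes \<eta>: "\<eta> \<in> Linf" and \<epsilon>: "0 < \<epsilon>"
  shows "\<exists>\<phi> h n p. \<phi> \<in> Hinf \<and> (AE \<zeta> in \<mu>. norm (\<phi> \<zeta>) = 1) \<and> h \<in> Hinf \<and> poisson \<phi> 0 = of_real p \<and>
    1 - \<epsilon> \<le> p \<and> (AE \<zeta> in \<mu>. norm (\<phi> \<zeta> * of_real (\<eta> \<zeta>) - h \<zeta> / \<zeta> ^ n) \<le> \<epsilon>)"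
proof -
  note \<eta>m[measurable] = Linf_measurable[OF \<eta>] and \<eta>i = Linf_integrable[OF \<eta>]
  obtain M where M: "M > 0" "AE \<zeta> in \<mu>. norm (\<eta> \<zeta>) \<le> M" using \<eta> by (rule LinfE)
  define L where "L = 2 * M"
  have L: "L > 0" using M by (simp add: L_def)
  obtain N where N0: "real N > 4 * L / \<epsilon>" using reals_Archimedean2 by blast
  have "0 < 4 * L / \<epsilon>" using L \<epsilon> by simp
  then have N: "real N > 0" using N0 by linarith
  define \<delta> where "\<delta> = L / real N"
  have \<delta>: "\<delta> > 0" "\<delta> \<le> \<epsilon> / 4" "real N * \<delta> = L"
    using L N N0 \<epsilon> by (auto simp: \<delta>_def field_simps)
  define e where "e = min (1/2) (min (\<epsilon> / (4 * N)) (\<epsilon> / (16 * L)))"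
  have e: "0 < e" "e \<le> 1/2" "e \<le> \<epsilon> / (4 * N)" "e \<le> \<epsilon> / (16 * L)"
    unfolding e_def using N L \<epsilon> by auto
  have e1: "4 * real N * e \<le> \<epsilon>" using e(3) N by (simp add: field_simps)
  have e2: "real (2 * N) * (\<delta> * (2 * e)) \<le> \<epsilon> / 4"
  proof -
    have "real (2 * N) * (\<delta> * (2 * e)) = 4 * (real N * \<delta>) * e" by simp
    also have "\<dots> = 4 * L * e" by (simp only: \<delta>(3))
    also have "\<dots> \<le> 4 * L * (\<epsilon> / (16 * L))" using e L by (intro mult_left_mono) auto
    also have "\<dots> = \<epsilon> / 4" using L by simp
    finally show ?thesis .
  qed
  have ln: "ln (1 / e) > 0" using e by simp
  have "(\<lambda>k. LINT \<zeta>|\<mu>. norm (poisson \<eta> (of_real (rad k) * \<zeta>) - \<eta> \<zeta>)) \<longlonglongrightarrow> 0"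
    by (rule poisson_radial_L1[OF \<eta>i rad(1,2,4)])
  then have "eventually (\<lambda>k. (LINT \<zeta>|\<mu>. norm (poisson \<eta> (of_real (rad k) * \<zeta>) - \<eta> \<zeta>)) < \<delta> * e / ln (1 / e)) sequentially"
    using \<delta> e ln by (intro order_tendstoD) auto
  then obtain k where k: "(LINT \<zeta>|\<mu>. norm (poisson \<eta> (of_real (rad k) * \<zeta>) - \<eta> \<zeta>)) < \<delta> * e / ln (1 / e)"
    by (auto simp: eventually_sequentially)
  let ?P = "\<lambda>\<zeta>. poisson \<eta> (of_real (rad k) * \<zeta>)"
  define g where "g \<zeta> = \<eta> \<zeta> - ?P \<zeta>" for \<zeta>
  have gm[measurable]: "g \<in> borel_measurable \<mu>" unfolding g_def by measurable
  have gi: "integrable \<mu> g" unfolding g_def using \<eta>i integrable_poisson_radial[OF \<eta>i rad(1,2)] by simp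
  have gb: "AE \<zeta> in \<mu>. \<bar>g \<zeta>\<bar> \<le> real N * \<delta>"
    using M(2) AE_circle_norm
  proof eventually_elim
    case (elim \<zeta>)
    have "norm (?P \<zeta>) \<le> M" using norm_poisson_le_bound[OF \<eta>m M(2) norm_radial_less[OF rad(1,2) elim(2)]] .
    then show ?case using elim(1) unfolding \<delta>(3) L_def g_def by simp
  qed
  \<comment> \<open>The first \<open>N\<close> sets are the layers of the positive part of \<open>g\<close>, the last \<open>N\<close> those of its negative part.\<close>
  define A where "A i = (if i < N then {\<zeta> \<in> space \<mu>. real (Suc i) * \<delta> < g \<zeta>}
     else {\<zeta> \<in> space \<mu>. real (Suc (i - N)) * \<delta> < - g \<zeta>})" for i
  define c where "c i = (if i < N then \<delta> else - \<delta>)" for i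
  have Am: "A i \<in> sets \<mu>" for i
  proof -
    have "{\<zeta> \<in> space \<mu>. x < g \<zeta>} \<in> sets \<mu>" "{\<zeta> \<in> space \<mu>. x < - g \<zeta>} \<in> sets \<mu>" for x by measurable
    then show ?thesis unfolding A_def by (auto simp only: split: if_split)
  qed
  have small: "measure \<mu> (A i) * ln (1/e) \<le> e" for i
  proof -
    have sub: "A i \<subseteq> {\<zeta> \<in> space \<mu>. \<bar>g \<zeta>\<bar> \<ge> \<delta>}"
    proof
      fix \<zeta> assume z: "\<zeta> \<in> A i"
      have d: "\<delta> \<le> real (Suc n) * \<delta>" for n using \<delta> by simp
      show "\<zeta> \<in> {\<zeta> \<in> space \<mu>. \<bar>g \<zeta>\<bar> \<ge> \<delta>}"
      proof (cases "i < N")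
        case True
        then have "\<zeta> \<in> space \<mu>" "real (Suc i) * \<delta> < g \<zeta>" using z by (auto simp: A_def simp del: of_nat_Suc)
        then show ?thesis using d[of i] by (auto simp del: of_nat_Suc)
      next
        case False
        then have "\<zeta> \<in> space \<mu>" "real (Suc (i - N)) * \<delta> < - g \<zeta>"
          using z by (auto simp: A_def simp del: of_nat_Suc of_nat_diff)
        then show ?thesis using d[of "i - N"] by (auto simp del: of_nat_Suc of_nat_diff)
      qed
    qed
    have "measure \<mu> (A i) \<le> measure \<mu> {\<zeta> \<in> space \<mu>. \<bar>g \<zeta>\<bar> \<ge> \<delta>}"
    proof (rule circle.finite_measure_mono[OF sub])
      show "{\<zeta> \<in> space \<mu>. \<bar>g \<zeta>\<bar> \<ge> \<delta>} \<in> sets \<mu>" by measurable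
    qed
    also have "\<dots> \<le> (LINT \<zeta>|\<mu>. \<bar>g \<zeta>\<bar>) / \<delta>"
      using gi \<delta> sets.top[of \<mu>] by (intro integral_Markov_inequality_measure[where A = "space \<mu>"]) auto
    also have "(LINT \<zeta>|\<mu>. \<bar>g \<zeta>\<bar>) = (LINT \<zeta>|\<mu>. norm (?P \<zeta> - \<eta> \<zeta>))"
      by (simp add: g_def abs_minus_commute)
    also have "\<dots> / \<delta> \<le> (\<delta> * e / ln (1 / e)) / \<delta>" using k \<delta> by (intro divide_right_mono) auto
    also have "\<dots> = e / ln (1 / e)" using \<delta> by simp
    finally show ?thesis using ln by (simp add: pos_le_divide_eq)
  qed
  have cb: "\<bar>c i\<bar> \<le> \<delta>" for i using \<delta>(1) by (simp add: c_def)
  obtain \<phi> h p where \<phi>: "\<phi> \<in> Hinf" "AE \<zeta> in \<mu>. norm (\<phi> \<zeta>) = 1" "h \<in> Hinf" "poisson \<phi> 0 = of_real p"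
    and p: "(1 - 2 * e) ^ (2 * N) \<le> p"
    and happ: "AE \<zeta> in \<mu>. norm (\<phi> \<zeta> * of_real (\<Sum>i<2 * N. c i * indicator (A i) \<zeta>) - h \<zeta>) \<le> real (2 * N) * (\<delta> * (2 * e))"
    using small_simple_function_inner[of "2 * N" A c \<delta> e, OF Am cb e(1,2) small] by blast
  have p1: "1 - \<epsilon> \<le> p"
  proof -
    \<comment> \<open>Bernoulli's inequality for the product of the \<open>2 N\<close> inner functions.\<close>
    have "1 - \<epsilon> \<le> 1 + real (2 * N) * (- (2 * e))" using e1 by simp
    also have "\<dots> \<le> (1 + - (2 * e)) ^ (2 * N)" using e by (intro Bernoulli_inequality) auto
    finally show ?thesis using p by simp
  qed
  have e4: "0 < \<epsilon> / 4" using \<epsilon> by simp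
  obtain n q where q: "q \<in> Hinf" "\<And>\<zeta>. norm \<zeta> = 1 \<Longrightarrow> norm (of_real (?P \<zeta>) - q \<zeta> / \<zeta> ^ n) \<le> \<epsilon> / 4"
    by (rule poisson_radial_trig[OF \<eta>i rad(1)[of k] rad(2)[of k] e4]) blast
  have s: "(\<Sum>i<2 * N. c i * indicator (A i) \<zeta>) = (\<Sum>i<N. \<delta> * of_bool (real (Suc i) * \<delta> < g \<zeta>))
    - (\<Sum>i<N. \<delta> * of_bool (real (Suc i) * \<delta> < - g \<zeta>))" if "norm \<zeta> = 1" for \<zeta>
  proof -
    have "(\<Sum>i<2 * N. c i * indicator (A i) \<zeta>) = (\<Sum>i<N. c i * indicator (A i) \<zeta>) + (\<Sum>i<N. c (i + N) * indicator (A (i + N)) \<zeta>)"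
    proof -
      have "(\<Sum>i<N + K. f i) = (\<Sum>i<N. f i) + (\<Sum>i<K. f (i + N))" for K and f :: "nat \<Rightarrow> real"
        by (induction K) (simp_all add: add.commute add.assoc)
      from this[of "\<lambda>i. c i * indicator (A i) \<zeta>" N] show ?thesis by (simp only: mult_2)
    qed
    also have "(\<Sum>i<N. c i * indicator (A i) \<zeta>) = (\<Sum>i<N. \<delta> * of_bool (real (Suc i) * \<delta> < g \<zeta>))"
      using that by (intro sum.cong) (auto simp: c_def A_def indicator_def)
    also have "(\<Sum>i<N. c (i + N) * indicator (A (i + N)) \<zeta>) = - (\<Sum>i<N. \<delta> * of_bool (real (Suc i) * \<delta> < - g \<zeta>))"
      using that unfolding sum_negf[symmetric] by (intro sum.cong) (auto simp: c_def A_def indicator_def)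
    finally show ?thesis by simp
  qed
  have "AE \<zeta> in \<mu>. norm (\<phi> \<zeta> * of_real (\<eta> \<zeta>) - (\<zeta> ^ n * h \<zeta> + \<phi> \<zeta> * q \<zeta>) / \<zeta> ^ n) \<le> \<epsilon>"
    using \<phi>(2) happ gb AE_circle_norm
  proof eventually_elim
    case (elim \<zeta>)
    let ?s = "\<Sum>i<2 * N. c i * indicator (A i) \<zeta>"
    have "\<bar>g \<zeta> - ?s\<bar> \<le> \<delta>" unfolding s[OF elim(4)] by (rule layer_sum[OF elim(3) \<delta>(1)])
    then have 1: "norm (\<phi> \<zeta> * of_real (g \<zeta> - ?s)) \<le> \<epsilon> / 4" using elim(1) \<delta>(2) by (simp only: norm_mult norm_of_real) simp
    have 2: "norm (\<phi> \<zeta> * of_real ?s - h \<zeta>) \<le> \<epsilon> / 4" using elim(2) e2 by linarith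
    have 3: "norm (\<phi> \<zeta> * (of_real (?P \<zeta>) - q \<zeta> / \<zeta> ^ n)) \<le> \<epsilon> / 4" using elim(1) q(2)[OF elim(4)] by (simp only: norm_mult mult_1)
    have nz: "\<zeta> \<noteq> 0" using elim(4) by auto
    have "\<phi> \<zeta> * of_real (\<eta> \<zeta>) - (\<zeta> ^ n * h \<zeta> + \<phi> \<zeta> * q \<zeta>) / \<zeta> ^ n =
      \<phi> \<zeta> * of_real (g \<zeta> - ?s) + (\<phi> \<zeta> * of_real ?s - h \<zeta>) + \<phi> \<zeta> * (of_real (?P \<zeta>) - q \<zeta> / \<zeta> ^ n)"
      using nz by (simp add: g_def add_divide_distrib algebra_simps del: of_real_sum)
    also have "norm \<dots> \<le> \<epsilon> / 4 + \<epsilon> / 4 + \<epsilon> / 4" by (intro norm_triangle_mono 1 2 3)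
    also have "\<dots> \<le> \<epsilon>" using \<epsilon> by simp
    finally show ?case .
  qed
  moreover have "(\<lambda>\<zeta>. \<zeta> ^ n * h \<zeta> + \<phi> \<zeta> * q \<zeta>) \<in> Hinf" by (intro Hinf_add Hinf_mult Hinf_power \<phi> q)
  ultimately show ?thesis
    using \<phi> p1 by (intro exI[of _ \<phi>] exI[of _ "\<lambda>\<zeta>. \<zeta> ^ n * h \<zeta> + \<phi> \<zeta> * q \<zeta>"] exI[of _ n] exI[of _ p]) blast
qed

section \<open>Closedness of bounded analytic plus continuous functions\<close>

text \<open>
The negative frequencies of \<open>\<zeta>\<^sup>-\<^sup>n h(\<zeta>)\<close> form a trigonometric polynomial, written as the conjugate of a
polynomial so that its Poisson integral is the conjugate of the same polynomial in the disc.
\<close>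

lemma Hinf_divide_power_eq:
  assumes h: "h \<in> Hinf"
  shows "\<exists>g q. g \<in> Hinf \<and> q holomorphic_on UNIV \<and> (\<forall>\<zeta>. norm \<zeta> = 1 \<longrightarrow> h \<zeta> / \<zeta> ^ n = g \<zeta> + cnj (q \<zeta>))"
proof (induction n)
  case 0
  show ?case using h by (intro exI[of _ h] exI[of _ "\<lambda>_. 0"]) auto
next
  case (Suc n)
  then obtain g q where gq: "g \<in> Hinf" "q holomorphic_on UNIV"
    "\<And>\<zeta>. norm \<zeta> = 1 \<Longrightarrow> h \<zeta> / \<zeta> ^ n = g \<zeta> + cnj (q \<zeta>)" by blast
  let ?g = "\<lambda>\<zeta>. (g \<zeta> - poisson g 0) / \<zeta>" and ?q = "\<lambda>\<zeta>. \<zeta> * q \<zeta> + cnj (poisson g 0) * \<zeta>"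
  have "h \<zeta> / \<zeta> ^ Suc n = ?g \<zeta> + cnj (?q \<zeta>)" if \<zeta>: "norm \<zeta> = 1" for \<zeta>
  proof -
    have nz: "\<zeta> \<noteq> 0" using \<zeta> by auto
    have c: "cnj \<zeta> = 1 / \<zeta>" using \<zeta> by (rule cnj_eq_inverse_circle)
    have "h \<zeta> / \<zeta> ^ Suc n = (h \<zeta> / \<zeta> ^ n) / \<zeta>" by (simp add: field_simps)
    also have "\<dots> = (g \<zeta> + cnj (q \<zeta>)) / \<zeta>" by (simp only: gq(3)[OF \<zeta>])
    also have "\<dots> = ?g \<zeta> + cnj (?q \<zeta>)" by (simp add: c add_divide_distrib diff_divide_distrib)
    finally show ?thesis .
  qed
  moreover have "?q holomorphic_on UNIV" by (intro holomorphic_intros gq)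
  ultimately show ?case using Hinf_divide_id[OF gq(1)] by blast
qed

text \<open>
The point is the control of \<open>c\<close> by the norm of the sum. With \<open>d = h / \<zeta>\<^sup>n = g + cnj q\<close>, the function
\<open>c(\<zeta>) = cnj(q(\<zeta>)) + P g (s \<zeta>)\<close> differs from \<open>P d (s \<zeta>)\<close>, which obeys the bound for \<open>d\<close>, only by
\<open>cnj(q(\<zeta>) - q(s \<zeta>))\<close>, and this is small for \<open>s\<close> close to 1.
\<close>

lemma bounded_Hinf_divide_power_split:
  assumes h: "h \<in> Hinf" and \<epsilon>: "0 < \<epsilon>" and b: "AE \<zeta> in \<mu>. norm (h \<zeta> / \<zeta> ^ n) \<le> \<epsilon>"
  obtains c where "continuous_on (sphere 0 1) c" "\<And>\<zeta>. norm \<zeta> = 1 \<Longrightarrow> norm (c \<zeta>) \<le> 2 * \<epsilon>"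
    "(\<lambda>\<zeta>. h \<zeta> / \<zeta> ^ n - c \<zeta>) \<in> Hinf"
proof -
  obtain g q where g: "g \<in> Hinf" and q: "q holomorphic_on UNIV"
    and eq: "\<And>\<zeta>. norm \<zeta> = 1 \<Longrightarrow> h \<zeta> / \<zeta> ^ n = g \<zeta> + cnj (q \<zeta>)"
    using Hinf_divide_power_eq[OF h, of n] by blast
  have [measurable]: "h \<in> borel_measurable \<mu>" using h by (rule Hinf_measurable)
  have qc: "continuous_on S q" for S using q holomorphic_on_imp_continuous_on continuous_on_subset by blast
  have qh: "q holomorphic_on S" for S using q holomorphic_on_subset by blast
  have "uniformly_continuous_on (cball 0 1) q" by (intro compact_uniformly_continuous qc) auto
  then obtain d where d: "d > 0" "\<And>x y. x \<in> cball 0 1 \<Longrightarrow> y \<in> cball 0 1 \<Longrightarrow> dist x y < d \<Longrightarrow> dist (q x) (q y) < \<epsilon>"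
    using \<epsilon> unfolding uniformly_continuous_on_def by metis
  define s where "s = 1 - min 1 d / 2"
  have s: "0 \<le> s" "s < 1" "1 - s < d" using d(1) by (auto simp: s_def min_def)
  let ?g = "\<lambda>\<zeta>. poisson g (of_real s * \<zeta>)"
  define c where "c \<zeta> = cnj (q \<zeta>) + ?g \<zeta>" for \<zeta>
  note gs = holomorphic_dilation[OF Hinf_holomorphic[OF g] s(1,2)]
  have "continuous_on (sphere 0 1) c"
    unfolding c_def by (intro continuous_intros qc continuous_on_subset[OF gs(1)]) auto
  moreover have "norm (c \<zeta>) \<le> 2 * \<epsilon>" if \<zeta>: "norm \<zeta> = 1" for \<zeta>
  proof -
    define z where "z = of_real s * \<zeta>"
    have z: "norm z < 1" unfolding z_def using s \<zeta> by (simp add: norm_mult)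
    have "norm (poisson (\<lambda>\<zeta>. h \<zeta> / \<zeta> ^ n) z) \<le> \<epsilon>"
      using b z by (intro norm_poisson_le_bound) measurable
    also have "poisson (\<lambda>\<zeta>. h \<zeta> / \<zeta> ^ n) z = poisson (\<lambda>\<zeta>. g \<zeta> + cnj (q \<zeta>)) z"
      unfolding poisson_eq_kernel using eq by (intro Bochner_Integration.integral_cong) auto
    also have "\<dots> = poisson g z + poisson (\<lambda>\<zeta>. cnj (q \<zeta>)) z"
      using z by (intro poisson_add Hinf_integrable g integrable_circle_continuous continuous_intros qc)
    also have "poisson (\<lambda>\<zeta>. cnj (q \<zeta>)) z = cnj (poisson q z)"
      using z by (intro poisson_bounded_linear bounded_linear_cnj integrable_circle_continuous qc)
    also have "poisson q z = q z" using z by (intro poisson_holomorphic qc qh)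
    finally have 1: "norm (poisson g z + cnj (q z)) \<le> \<epsilon>" .
    have "dist \<zeta> z < d"
    proof -
      have "\<zeta> - z = of_real (1 - s) * \<zeta>" by (simp add: z_def algebra_simps)
      then have "norm (\<zeta> - z) = 1 - s" using \<zeta> s by (simp only: norm_mult norm_of_real) simp
      then show ?thesis using s by (simp add: dist_norm)
    qed
    then have "norm (cnj (q \<zeta> - q z)) \<le> \<epsilon>" using d(2)[of \<zeta> z] z \<zeta> by (simp add: dist_norm del: complex_cnj_diff)
    moreover have "c \<zeta> = cnj (q \<zeta> - q z) + (poisson g z + cnj (q z))"
      by (simp add: c_def z_def)
    ultimately show ?thesis using norm_triangle_mono[OF _ 1, of "cnj (q \<zeta> - q z)" \<epsilon>] by simp
  qed
  moreover have "(\<lambda>\<zeta>. h \<zeta> / \<zeta> ^ n - c \<zeta>) \<in> Hinf"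
  proof (rule Hinf_cong_AE)
    show "(\<lambda>\<zeta>. g \<zeta> - ?g \<zeta>) \<in> Hinf" by (intro Hinf_diff g Hinf_dilation Hinf_holomorphic s)
    have "c \<in> borel_measurable \<mu>" using calculation(1) by (rule borel_measurable_circle_continuous)
    then show "(\<lambda>\<zeta>. h \<zeta> / \<zeta> ^ n - c \<zeta>) \<in> borel_measurable \<mu>" by measurable
    show "AE \<zeta> in \<mu>. g \<zeta> - ?g \<zeta> = h \<zeta> / \<zeta> ^ n - c \<zeta>"
      using eq by (intro AE_I2) (auto simp: c_def)
  qed
  ultimately show ?thesis using that by blast
qed

text \<open>
The differences of consecutive approximants are split with control of the norms, so that the continuous parts form
a uniformly convergent series.
\<close>

theorem Hinf_plus_continuous_closed:
  fixes n :: "nat \<Rightarrow> nat"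
  assumes f: "f \<in> Linf" and h: "\<And>j. h j \<in> Hinf"
    and lim: "\<And>j. AE \<zeta> in \<mu>. norm (f \<zeta> - h j \<zeta> / \<zeta> ^ n j) \<le> (1/2) ^ j"
  obtains c where "continuous_on (sphere 0 1) c" "(\<lambda>\<zeta>. f \<zeta> - c \<zeta>) \<in> Hinf"
proof -
  have [measurable]: "f \<in> borel_measurable \<mu>" "h j \<in> borel_measurable \<mu>" for j
    using f h by (auto intro: Linf_measurable Hinf_measurable)
  let ?k = "\<lambda>j \<zeta>. h j \<zeta> / \<zeta> ^ n j"
  obtain B where B: "B > 0" "AE \<zeta> in \<mu>. norm (f \<zeta>) \<le> B" using f by (rule LinfE)
  have k0: "AE \<zeta> in \<mu>. norm (?k 0 \<zeta>) \<le> B + 1"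
    using B(2) lim[of 0]
  proof eventually_elim
    case (elim \<zeta>)
    then show ?case using norm_triangle_ineq4[of "f \<zeta>" "f \<zeta> - ?k 0 \<zeta>"] by simp
  qed
  have B1: "0 < B + 1" using B(1) by simp
  obtain c0 where c0: "continuous_on (sphere 0 1) c0" "\<And>\<zeta>. norm \<zeta> = 1 \<Longrightarrow> norm (c0 \<zeta>) \<le> 2 * (B + 1)"
    "(\<lambda>\<zeta>. ?k 0 \<zeta> - c0 \<zeta>) \<in> Hinf"
    by (rule bounded_Hinf_divide_power_split[OF h B1 k0]) blast
  define Q where "Q j c \<longleftrightarrow> continuous_on (sphere 0 1) c \<and> (\<forall>\<zeta>. norm \<zeta> = 1 \<longrightarrow> norm (c \<zeta>) \<le> 4 * (1/2) ^ j) \<and>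
      (\<lambda>\<zeta>. (?k (Suc j) \<zeta> - ?k j \<zeta>) - c \<zeta>) \<in> Hinf" for j c
  have "\<exists>c. Q j c" for j
  proof -
    \<comment> \<open>Over a common power of \<open>\<zeta>\<close> the difference of two approximants is again a quotient of this form.\<close>
    define H where "H \<zeta> = h (Suc j) \<zeta> * \<zeta> ^ n j - h j \<zeta> * \<zeta> ^ n (Suc j)" for \<zeta>
    have H: "H \<in> Hinf" unfolding H_def by (intro Hinf_diff Hinf_mult Hinf_power h)
    have Heq: "?k (Suc j) \<zeta> - ?k j \<zeta> = H \<zeta> / \<zeta> ^ (n (Suc j) + n j)" if "norm \<zeta> = 1" for \<zeta>
    proof -
      have "\<zeta> \<noteq> 0" using that by auto
      then show ?thesis by (simp add: H_def power_add field_simps)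
    qed
    have Hb: "AE \<zeta> in \<mu>. norm (H \<zeta> / \<zeta> ^ (n (Suc j) + n j)) \<le> 2 * (1/2) ^ j"
      using lim[of j] lim[of "Suc j"] AE_circle_norm
    proof eventually_elim
      case (elim \<zeta>)
      have "norm (?k (Suc j) \<zeta> - ?k j \<zeta>) = norm ((f \<zeta> - ?k j \<zeta>) - (f \<zeta> - ?k (Suc j) \<zeta>))" by simp
      also have "\<dots> \<le> (1/2) ^ j + (1/2) ^ Suc j"
        by (rule order_trans[OF norm_triangle_ineq4], rule add_mono) (use elim in auto)
      also have "\<dots> \<le> 2 * (1/2) ^ j" by simp
      finally show ?case unfolding Heq[OF elim(3)] .
    qed
    have pos: "0 < 2 * (1/2::real) ^ j" by simp
    obtain c where c: "continuous_on (sphere 0 1) c" "\<And>\<zeta>. norm \<zeta> = 1 \<Longrightarrow> norm (c \<zeta>) \<le> 2 * (2 * (1/2) ^ j)"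
      "(\<lambda>\<zeta>. H \<zeta> / \<zeta> ^ (n (Suc j) + n j) - c \<zeta>) \<in> Hinf"
      by (rule bounded_Hinf_divide_power_split[OF H pos Hb]) blast
    have [measurable]: "c \<in> borel_measurable \<mu>" using c(1) by (rule borel_measurable_circle_continuous)
    have "(\<lambda>\<zeta>. (?k (Suc j) \<zeta> - ?k j \<zeta>) - c \<zeta>) \<in> Hinf"
    proof (rule Hinf_cong_AE[OF c(3)])
      show "AE \<zeta> in \<mu>. H \<zeta> / \<zeta> ^ (n (Suc j) + n j) - c \<zeta> = (?k (Suc j) \<zeta> - ?k j \<zeta>) - c \<zeta>"
        using Heq by (intro AE_I2) auto
    qed measurable
    then show ?thesis unfolding Q_def using c by auto
  qed
  then obtain c where "\<And>j. Q j (c j)" by metis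
  then have c: "\<And>j. continuous_on (sphere 0 1) (c j)" "\<And>j \<zeta>. norm \<zeta> = 1 \<Longrightarrow> norm (c j \<zeta>) \<le> 4 * (1/2) ^ j"
    "\<And>j. (\<lambda>\<zeta>. (?k (Suc j) \<zeta> - ?k j \<zeta>) - c j \<zeta>) \<in> Hinf" unfolding Q_def by blast+
  have sm: "summable (\<lambda>j. 4 * (1/2 :: real) ^ j)" by (intro summable_mult summable_geometric) simp
  have unif: "uniform_limit (sphere 0 1) (\<lambda>J \<zeta>. \<Sum>j<J. c j \<zeta>) (\<lambda>\<zeta>. \<Sum>j. c j \<zeta>) sequentially"
    using c(2) sm by (intro Weierstrass_m_test) auto
  have cont: "continuous_on (sphere 0 1) (\<lambda>\<zeta>. \<Sum>j. c j \<zeta>)"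
    by (rule uniform_limit_theorem[OF _ unif]) (auto intro!: always_eventually continuous_intros c)
  define C where "C \<zeta> = c0 \<zeta> + (\<Sum>j. c j \<zeta>)" for \<zeta>
  have Ccont: "continuous_on (sphere 0 1) C" unfolding C_def by (intro continuous_intros c0 cont)
  have Cm[measurable]: "C \<in> borel_measurable \<mu>" using Ccont by (rule borel_measurable_circle_continuous)
  define S where "S J \<zeta> = ?k J \<zeta> - (c0 \<zeta> + (\<Sum>j<J. c j \<zeta>))" for J \<zeta>
  have SH: "S J \<in> Hinf" for J
  proof (induction J)
    case 0
    then show ?case using c0(3) by (simp add: S_def[abs_def])
  next
    case (Suc J)
    have "S (Suc J) = (\<lambda>\<zeta>. S J \<zeta> + ((?k (Suc J) \<zeta> - ?k J \<zeta>) - c J \<zeta>))"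
      by (intro ext) (simp add: S_def algebra_simps)
    then show ?case using Hinf_add[OF Suc c(3)] by simp
  qed
  have sb: "norm (\<Sum>j<J. c j \<zeta>) \<le> 8" if "norm \<zeta> = 1" for J \<zeta>
  proof -
    have "norm (\<Sum>j<J. c j \<zeta>) \<le> (\<Sum>j<J. 4 * (1/2) ^ j)" using c(2)[OF that] by (rule sum_norm_le)
    also have "\<dots> \<le> (\<Sum>j. 4 * (1/2) ^ j)" using sm by (intro sum_le_suminf) auto
    also have "\<dots> = 8" by (subst suminf_mult) (auto simp: suminf_geometric intro: summable_geometric)
    finally show ?thesis .
  qed
  have slim: "(\<lambda>J. \<Sum>j<J. c j \<zeta>) \<longlonglongrightarrow> (\<Sum>j. c j \<zeta>)" if "norm \<zeta> = 1" for \<zeta>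
    using tendsto_uniform_limitI[OF unif, of \<zeta>] that by simp
  have sb': "norm (\<Sum>j. c j \<zeta>) \<le> 8" if "norm \<zeta> = 1" for \<zeta>
    using sb[OF that] slim[OF that] by (intro LIMSEQ_le_const2[OF tendsto_norm]) auto
  have all: "AE \<zeta> in \<mu>. \<forall>j. norm (f \<zeta> - ?k j \<zeta>) \<le> (1/2) ^ j" using lim by (simp add: AE_all_countable)
  have L: "(\<lambda>J. LINT \<zeta>|\<mu>. norm (S J \<zeta> - (f \<zeta> - C \<zeta>))) \<longlonglongrightarrow> 0"
  proof (rule L1_tendsto_dominated[where w = "\<lambda>_. 17"])
    show "S J \<in> borel_measurable \<mu>" for J using SH by (rule Hinf_measurable)
    show "AE \<zeta> in \<mu>. (\<lambda>J. S J \<zeta>) \<longlonglongrightarrow> f \<zeta> - C \<zeta>"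
      using all AE_circle_norm
    proof eventually_elim
      case (elim \<zeta>)
      have "(\<lambda>J. ?k J \<zeta> - f \<zeta>) \<longlonglongrightarrow> 0"
      proof (rule Lim_null_comparison)
        show "eventually (\<lambda>J. norm (?k J \<zeta> - f \<zeta>) \<le> (1/2) ^ J) sequentially"
          using elim by (intro always_eventually) (simp add: norm_minus_commute)
        show "(\<lambda>J. (1/2::real) ^ J) \<longlonglongrightarrow> 0" by (intro LIMSEQ_power_zero) simp
      qed
      then have "(\<lambda>J. ?k J \<zeta>) \<longlonglongrightarrow> f \<zeta>" by (rule LIM_zero_cancel)
      then show ?case unfolding S_def C_def by (intro tendsto_intros slim elim)
    qed
    show "AE \<zeta> in \<mu>. norm (S J \<zeta> - (f \<zeta> - C \<zeta>)) \<le> 17" for J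
      using all AE_circle_norm
    proof eventually_elim
      case (elim \<zeta>)
      have "(1/2::real) ^ J \<le> 1" by (intro power_le_one) auto
      then have "norm (f \<zeta> - ?k J \<zeta>) \<le> 1" using elim(1) order_trans by blast
      moreover have e: "S J \<zeta> - (f \<zeta> - C \<zeta>) = (\<Sum>j. c j \<zeta>) - (f \<zeta> - ?k J \<zeta>) - (\<Sum>j<J. c j \<zeta>)"
        by (simp add: S_def C_def)
      moreover have "norm ((\<Sum>j. c j \<zeta>) - (f \<zeta> - ?k J \<zeta>) - (\<Sum>j<J. c j \<zeta>)) \<le> (norm (\<Sum>j. c j \<zeta>) + norm (f \<zeta> - ?k J \<zeta>)) + norm (\<Sum>j<J. c j \<zeta>)"
        by (rule order_trans[OF norm_triangle_ineq4], rule add_mono[OF norm_triangle_ineq4]) simp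
      ultimately show ?case unfolding e using sb[OF elim(2), of J] sb'[OF elim(2)] by linarith
    qed
  qed (auto)
  have "AE \<zeta> in \<mu>. norm (f \<zeta> - C \<zeta>) \<le> B + (2 * (B + 1) + 8)"
    using B(2) AE_circle_norm
  proof eventually_elim
    case (elim \<zeta>)
    have "norm (C \<zeta>) \<le> 2 * (B + 1) + 8" unfolding C_def using c0(2) sb' elim by (intro norm_triangle_mono) auto
    then show ?case using elim norm_triangle_ineq4[of "f \<zeta>" "C \<zeta>"] by linarith
  qed
  then have "(\<lambda>\<zeta>. f \<zeta> - C \<zeta>) \<in> Linf" by (intro LinfI) auto
  then have "(\<lambda>\<zeta>. f \<zeta> - C \<zeta>) \<in> Hinf" using Hinf_L1_limit[OF SH _ L] by blast
  then show ?thesis using that Ccont by blast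
qed

section \<open>The Garsia norm of a bounded function\<close>

lemma sup_norm_real:
  fixes f :: "complex \<Rightarrow> 'a::{banach, second_countable_topology}"
  assumes f: "f \<in> Linf"
  obtains M where "0 \<le> M" "sup_norm f = ereal M" "AE \<zeta> in \<mu>. norm (f \<zeta>) \<le> M"
    "\<And>c. c < M \<Longrightarrow> \<not> (AE \<zeta> in \<mu>. norm (f \<zeta>) \<le> c)"
proof -
  note iff = sup_norm_le_ereal_iff[OF Linf_measurable[OF f]]
  have neg: "\<not> sup_norm f \<le> ereal c" if "c < 0" for c
  proof
    assume "sup_norm f \<le> ereal c"
    then have "AE \<zeta> in \<mu>. norm (f \<zeta>) \<le> c" by (simp add: iff)
    then have "AE \<zeta> in \<mu>. False" by eventually_elim (use that norm_ge_zero in \<open>smt (verit)\<close>)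
    then show False by simp
  qed
  have "sup_norm f < \<infinity>" using f by (simp add: Linf_def)
  moreover have "sup_norm f \<noteq> - \<infinity>" using neg[of "-1"] by auto
  ultimately obtain M where M: "sup_norm f = ereal M" by (cases "sup_norm f") auto
  show ?thesis
  proof (rule that[OF _ M])
    show "0 \<le> M" using neg[of M] M by fastforce
    show "AE \<zeta> in \<mu>. norm (f \<zeta>) \<le> M" using iff[of M] M by simp
    show "\<not> (AE \<zeta> in \<mu>. norm (f \<zeta>) \<le> c)" if "c < M" for c using iff[of c] M that by simp
  qed
qed

lemma sup_norm_cong_AE:
  fixes f :: "complex \<Rightarrow> 'a::real_normed_vector" and g :: "complex \<Rightarrow> 'b::real_normed_vector"
  assumes "f \<in> borel_measurable \<mu>" "g \<in> borel_measurable \<mu>" "AE \<zeta> in \<mu>. norm (f \<zeta>) = norm (g \<zeta>)"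
  shows "sup_norm f = sup_norm g"
proof -
  note [measurable] = assms(1,2)
  have "AE \<zeta> in \<mu>. ereal (norm (f \<zeta>)) = ereal (norm (g \<zeta>))" using assms(3) by eventually_elim simp
  then show ?thesis unfolding sup_norm_def by (intro esssup_AE_cong) measurable
qed

lemma integrable_norm_power2:
  fixes f :: "complex \<Rightarrow> 'a::{banach, second_countable_topology}"
  assumes f: "f \<in> Linf"
  shows "integrable \<mu> (\<lambda>\<zeta>. (norm (f \<zeta>))\<^sup>2)"
proof -
  note [measurable] = Linf_measurable[OF f]
  obtain B where B: "AE \<zeta> in \<mu>. norm (f \<zeta>) \<le> B" using f by (rule LinfE)
  show ?thesis
  proof (rule integrable_circle_bounded)
    show "AE \<zeta> in \<mu>. norm ((norm (f \<zeta>))\<^sup>2) \<le> B\<^sup>2"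
      using B by eventually_elim (unfold real_norm_def power_abs abs_norm_cancel, rule power_mono, auto)
  qed measurable
qed

lemma poisson_norm_power2_le:
  fixes f :: "complex \<Rightarrow> 'a::{banach, second_countable_topology}"
  assumes f: "f \<in> Linf" and M: "AE \<zeta> in \<mu>. norm (f \<zeta>) \<le> M" and z: "norm z < 1"
  shows "poisson (\<lambda>\<zeta>. (norm (f \<zeta>))\<^sup>2) z \<le> M\<^sup>2"
proof -
  have "AE \<zeta> in \<mu>. (norm (f \<zeta>))\<^sup>2 \<le> M\<^sup>2" using M by eventually_elim (rule power_mono, auto)
  then have "poisson (\<lambda>\<zeta>. (norm (f \<zeta>))\<^sup>2) z \<le> poisson (\<lambda>_. M\<^sup>2) z"
    using z by (intro poisson_mono integrable_norm_power2 f) auto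
  then show ?thesis using z by (simp add: poisson_const_real)
qed

lemma garsia_norm_le:
  assumes f: "f \<in> Linf" and M: "0 \<le> M" "AE \<zeta> in \<mu>. norm (f \<zeta>) \<le> M"
  shows "garsia_norm f \<le> ereal M"
  unfolding garsia_norm_def
proof (rule SUP_least)
  fix z :: complex assume "z \<in> ball 0 1"
  then have "garsia_fun f z \<le> M\<^sup>2"
    using poisson_norm_power2_le[OF f M(2), of z] zero_le_power2[of "norm (poisson f z)"] unfolding garsia_fun_def by (simp, linarith)
  then show "ereal (sqrt (garsia_fun f z)) \<le> ereal M"
    using M(1) by (simp add: real_le_lsqrt)
qed

text \<open>
The Garsia norm is at most \<open>M\<close>, so a sequence of points along which \<open>P(\<bar>f\<bar>\<^sup>2) - \<bar>P f\<bar>\<^sup>2\<close> tends to \<open>M\<^sup>2\<close>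
suffices. The first term is bounded below by integrating \<open>2 M \<eta> - M\<^sup>2 \<le> \<eta>\<^sup>2\<close>, which is linear in \<open>\<eta>\<close>.
\<close>

lemma G_extremalI:
  fixes z :: "nat \<Rightarrow> complex"
  assumes f: "f \<in> Linf" and \<eta>: "\<eta> \<in> Linf" and \<eta>0: "AE \<zeta> in \<mu>. 0 \<le> \<eta> \<zeta>" and eq: "AE \<zeta> in \<mu>. norm (f \<zeta>) = \<eta> \<zeta>"
    and M: "0 \<le> M" "sup_norm \<eta> = ereal M"
    and z: "\<And>n. norm (z n) < 1" "\<And>n. M - 1 / (real n + 1) \<le> poisson \<eta> (z n)"
    and small: "\<And>n. norm (poisson f (z n)) \<le> 1 / (real n + 1)"
  shows "G_extremal f"
proof -
  note fm[measurable] = Linf_measurable[OF f] and \<eta>m[measurable] = Linf_measurable[OF \<eta>]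
  have "AE \<zeta> in \<mu>. norm (f \<zeta>) = norm (\<eta> \<zeta>)" using eq \<eta>0 by eventually_elim simp
  then have s: "sup_norm f = ereal M" using sup_norm_cong_AE[OF fm \<eta>m] M by simp
  then have fM: "AE \<zeta> in \<mu>. norm (f \<zeta>) \<le> M" using sup_norm_le_ereal_iff[OF fm, of M] by simp
  have lower: "M\<^sup>2 - 2 * M / (real n + 1) - (1 / (real n + 1))\<^sup>2 \<le> garsia_fun f (z n)" for n
  proof -
    have "poisson (\<lambda>\<zeta>. 2 * M * \<eta> \<zeta> - M\<^sup>2) (z n) \<le> poisson (\<lambda>\<zeta>. (norm (f \<zeta>))\<^sup>2) (z n)"
    proof (rule poisson_mono)
      show "AE \<zeta> in \<mu>. 2 * M * \<eta> \<zeta> - M\<^sup>2 \<le> (norm (f \<zeta>))\<^sup>2"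
        using eq
      proof eventually_elim
        case (elim \<zeta>)
        have "0 \<le> (\<eta> \<zeta> - M)\<^sup>2" by simp
        then show ?case using elim by (simp add: power2_eq_square algebra_simps)
      qed
      show "integrable \<mu> (\<lambda>\<zeta>. 2 * M * \<eta> \<zeta> - M\<^sup>2)" using Linf_integrable[OF \<eta>] by simp
    qed (intro integrable_norm_power2 f z)+
    also have "poisson (\<lambda>\<zeta>. 2 * M * \<eta> \<zeta> - M\<^sup>2) (z n) = poisson (\<lambda>\<zeta>. 2 * M * \<eta> \<zeta>) (z n) - poisson (\<lambda>_. M\<^sup>2) (z n)"
      using z Linf_integrable[OF \<eta>] by (intro poisson_diff) auto
    also have "poisson (\<lambda>\<zeta>. 2 * M * \<eta> \<zeta>) (z n) = 2 * M * poisson \<eta> (z n)"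
      using z Linf_integrable[OF \<eta>] by (intro poisson_bounded_linear bounded_linear_mult_right)
    also have "poisson (\<lambda>_. M\<^sup>2) (z n) = M\<^sup>2" using z by (simp add: poisson_const_real)
    finally have "2 * M * poisson \<eta> (z n) - M\<^sup>2 \<le> poisson (\<lambda>\<zeta>. (norm (f \<zeta>))\<^sup>2) (z n)" .
    moreover have "2 * M * (M - 1 / (real n + 1)) \<le> 2 * M * poisson \<eta> (z n)"
      using z(2) M(1) by (intro mult_left_mono) auto
    moreover have "2 * M * (M - 1 / (real n + 1)) = 2 * M\<^sup>2 - 2 * M / (real n + 1)"
      by (simp add: power2_eq_square algebra_simps)
    moreover have "(norm (poisson f (z n)))\<^sup>2 \<le> (1 / (real n + 1))\<^sup>2" using small by (intro power_mono) auto
    ultimately show ?thesis unfolding garsia_fun_def by linarith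
  qed
  have upper: "garsia_fun f (z n) \<le> M\<^sup>2" for n
    using poisson_norm_power2_le[OF f fM z(1), of n] zero_le_power2[of "norm (poisson f (z n))"] unfolding garsia_fun_def by linarith
  have "(\<lambda>n. garsia_fun f (z n)) \<longlonglongrightarrow> M\<^sup>2"
  proof (rule tendsto_sandwich)
    show "(\<lambda>n. M\<^sup>2 - 2 * M / (real n + 1) - (1 / (real n + 1))\<^sup>2) \<longlonglongrightarrow> M\<^sup>2" by real_asymp
    show "(\<lambda>n. M\<^sup>2) \<longlonglongrightarrow> M\<^sup>2" by simp
  qed (use lower upper in auto)
  then have "(\<lambda>n. ereal (sqrt (garsia_fun f (z n)))) \<longlonglongrightarrow> ereal (sqrt (M\<^sup>2))"
    by (intro tendsto_intros) 
  moreover have "ereal (sqrt (garsia_fun f (z n))) \<le> garsia_norm f" for n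
    unfolding garsia_norm_def using z by (intro SUP_upper) auto
  ultimately have "ereal (sqrt (M\<^sup>2)) \<le> garsia_norm f" by (blast intro: LIMSEQ_le_const2)
  then have "garsia_norm f = ereal M"
    using garsia_norm_le[OF f M(1) fM] M(1) by (intro antisym) auto
  then show ?thesis using f s by (simp add: G_extremal_def)
qed

lemma sup_norm_points:
  fixes \<delta> :: "nat \<Rightarrow> real"
  assumes \<eta>: "\<eta> \<in> Linf" and \<eta>0: "AE \<zeta> in \<mu>. 0 \<le> \<eta> \<zeta>" and M: "sup_norm \<eta> = ereal M"
    and \<delta>: "\<And>n. 0 < \<delta> n" "\<And>n. \<delta> n < 1"
  obtains z where "\<And>n. norm (z n) < 1" "\<And>n. 1 - \<delta> n \<le> norm (z n)"
    "\<And>n. M - 1 / (real n + 1) \<le> poisson \<eta> (z n)"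
proof -
  have "\<exists>z. norm z < 1 \<and> 1 - \<delta> n \<le> norm z \<and> M - 1 / (real n + 1) \<le> poisson \<eta> z" for n
  proof (rule ccontr)
    assume *: "\<not> ?thesis"
    have "AE \<zeta> in \<mu>. \<eta> \<zeta> \<le> M - 1 / (real n + 1)"
    proof (rule AE_le_if_poisson_le[OF Linf_integrable[OF \<eta>], of "1 - \<delta> n"])
      show "poisson \<eta> z \<le> M - 1 / (real n + 1)" if "1 - \<delta> n \<le> norm z" "norm z < 1" for z
        using * that by force
    qed (use \<delta>[of n] in auto)
    then have "AE \<zeta> in \<mu>. norm (\<eta> \<zeta>) \<le> M - 1 / (real n + 1)" using \<eta>0 by eventually_elim simp
    then have "sup_norm \<eta> \<le> ereal (M - 1 / (real n + 1))"
      using sup_norm_le_ereal_iff[OF Linf_measurable[OF \<eta>]] by blast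
    then show False using M by simp
  qed
  then show ?thesis using that by metis
qed

section \<open>Extremal functions of prescribed modulus\<close>

text \<open>
The product of all \<open>\<phi>\<^sub>j\<close> and of the Blaschke factors of all \<open>z\<^sub>j\<close>. It keeps each \<open>\<phi>\<^sub>j\<close> as a factor in \<open>H\<^sup>\<infinity>\<close>,
and every analytic multiple of it vanishes at every \<open>z\<^sub>j\<close>.
\<close>

lemma inner_with_factors_and_zeros:
  fixes z :: "nat \<Rightarrow> complex"
  assumes \<phi>: "\<And>j. \<phi> j \<in> Hinf" "\<And>j. AE \<zeta> in \<mu>. norm (\<phi> j \<zeta>) = 1" "\<And>j. poisson (\<phi> j) 0 = of_real (p j)"
    and p: "\<And>j. 1 - (1/4) ^ j / 2 \<le> p j"
    and z: "\<And>j. norm (z j) < 1" "\<And>j. 1 - (1/4) ^ j / 2 \<le> norm (z j)"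
  obtains U where "U \<in> Hinf" "AE \<zeta> in \<mu>. norm (U \<zeta>) = 1"
    "\<And>j F. F \<in> Hinf \<Longrightarrow> poisson (\<lambda>\<zeta>. U \<zeta> * F \<zeta>) (z j) = 0"
    "\<And>j. \<exists>k. k \<in> Hinf \<and> (AE \<zeta> in \<mu>. norm (k \<zeta>) \<le> 1) \<and> (AE \<zeta> in \<mu>. U \<zeta> = \<phi> j \<zeta> * k \<zeta>)"
proof -
  have q: "(1/4::real) ^ j \<le> 1" for j by (intro power_le_one) auto
  \<comment> \<open>The halves leave room for two factors per index: their values at 0 multiply to at least \<open>1 - 4\<^sup>-\<^sup>j\<close>.\<close>
  have z0: "z j \<noteq> 0" for j using z(2)[of j] q[of j] by auto
  let ?B = "\<lambda>j. blaschke_factor (z j)"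
  note B = blaschke_factor[OF z(1) z0]
  define b where "b j \<zeta> = ?B j \<zeta> * \<phi> j \<zeta>" for j \<zeta>
  have bH: "b j \<in> Hinf" for j unfolding b_def by (intro Hinf_mult B \<phi>)
  have b1: "AE \<zeta> in \<mu>. norm (b j \<zeta>) = 1" for j
    using \<phi>(2)[of j] AE_circle_norm by eventually_elim (simp add: b_def norm_mult B)
  have b1': "AE \<zeta> in \<mu>. norm (b j \<zeta>) \<le> 1" for j
    using b1[of j] by eventually_elim simp
  have b0: "1 - (1/4) ^ j \<le> Re (poisson (b j) 0)" for j
  proof -
    have "poisson (b j) 0 = of_real (norm (z j) * p j)"
      unfolding b_def[abs_def] using B(1,3)[of j] \<phi>(1,3)[of j] by (simp add: poisson_mult)
    moreover have "(1 - (1/4) ^ j / 2) * (1 - (1/4) ^ j / 2) \<le> norm (z j) * p j"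
      using p[of j] z(2)[of j] q[of j] by (intro mult_mono) auto
    moreover have "1 - (1/4) ^ j \<le> (1 - (1/4) ^ j / 2) * (1 - (1/4::real) ^ j / 2)"
      by (simp add: algebra_simps)
    ultimately show ?thesis by simp
  qed
  obtain U where U: "U \<in> Hinf" "AE \<zeta> in \<mu>. (\<lambda>N. \<Prod>j<N. b j \<zeta>) \<longlonglongrightarrow> U \<zeta>"
    by (rule contractive_product_converges[OF bH b1' b0])
  have "AE \<zeta> in \<mu>. \<forall>j. norm (b j \<zeta>) = 1" using b1 by (simp add: AE_all_countable)
  then have U1: "AE \<zeta> in \<mu>. norm (U \<zeta>) = 1"
    using U(2)
  proof eventually_elim
    case (elim \<zeta>)
    have "norm (\<Prod>j<N. b j \<zeta>) = 1" for N using elim by (simp add: prod_norm[symmetric])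
    then show ?case using tendsto_norm[OF elim(2)] by (simp add: LIMSEQ_const_iff)
  qed
  have "\<exists>k. k \<in> Hinf \<and> (AE \<zeta> in \<mu>. norm (k \<zeta>) \<le> 1) \<and> (AE \<zeta> in \<mu>. U \<zeta> = b j \<zeta> * k \<zeta>)" for j
    using contractive_product_factor[OF bH b1' b0 U(2), of j] by blast
  then obtain k where k: "\<And>j. k j \<in> Hinf" "\<And>j. AE \<zeta> in \<mu>. norm (k j \<zeta>) \<le> 1" "\<And>j. AE \<zeta> in \<mu>. U \<zeta> = b j \<zeta> * k j \<zeta>"
    by metis
  show ?thesis
  proof (rule that[OF U(1) U1])
    fix j F assume F: "F \<in> Hinf"
    have H: "(\<lambda>\<zeta>. \<phi> j \<zeta> * k j \<zeta> * F \<zeta>) \<in> Hinf" by (intro Hinf_mult \<phi> k F)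
    have "poisson (\<lambda>\<zeta>. U \<zeta> * F \<zeta>) (z j) = poisson (\<lambda>\<zeta>. ?B j \<zeta> * (\<phi> j \<zeta> * k j \<zeta> * F \<zeta>)) (z j)"
    proof (rule poisson_cong_AE)
      show "(\<lambda>\<zeta>. U \<zeta> * F \<zeta>) \<in> borel_measurable \<mu>" by (intro Hinf_measurable Hinf_mult U F)
      show "(\<lambda>\<zeta>. ?B j \<zeta> * (\<phi> j \<zeta> * k j \<zeta> * F \<zeta>)) \<in> borel_measurable \<mu>" by (intro Hinf_measurable Hinf_mult B H)
      show "AE \<zeta> in \<mu>. U \<zeta> * F \<zeta> = ?B j \<zeta> * (\<phi> j \<zeta> * k j \<zeta> * F \<zeta>)"
        using k(3)[of j] by eventually_elim (simp add: b_def)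
    qed
    also have "\<dots> = 0" using poisson_mult[OF B(1) H z(1)] B(4) by simp
    finally show "poisson (\<lambda>\<zeta>. U \<zeta> * F \<zeta>) (z j) = 0" .
  next
    fix j
    show "\<exists>k. k \<in> Hinf \<and> (AE \<zeta> in \<mu>. norm (k \<zeta>) \<le> 1) \<and> (AE \<zeta> in \<mu>. U \<zeta> = \<phi> j \<zeta> * k \<zeta>)"
    proof (intro exI conjI)
      show "(\<lambda>\<zeta>. ?B j \<zeta> * k j \<zeta>) \<in> Hinf" by (intro Hinf_mult B k)
      show "AE \<zeta> in \<mu>. norm (?B j \<zeta> * k j \<zeta>) \<le> 1"
        using k(2)[of j] AE_circle_norm by eventually_elim (simp add: norm_mult B)
      show "AE \<zeta> in \<mu>. U \<zeta> = \<phi> j \<zeta> * (?B j \<zeta> * k j \<zeta>)"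
        using k(3)[of j] by eventually_elim (simp add: b_def)
    qed
  qed
qed

text \<open>
For \<open>f = U \<eta>\<close>, which is not analytic, \<open>P f\<close> need not vanish at \<open>z\<^sub>j\<close>. But \<open>P(U M)\<close> does, and near these points
\<open>\<eta>\<close> is close to the constant \<open>M\<close> in the mean with respect to the Poisson kernel:
\<open>\<bar>P f (z\<^sub>j)\<bar> = \<bar>P(U (\<eta> - M))(z\<^sub>j)\<bar> \<le> M - P \<eta> (z\<^sub>j)\<close>.
\<close>

theorem extremal_Hinf_plus_C:
  assumes \<eta>: "\<eta> \<in> Linf" and \<eta>0: "AE \<zeta> in \<mu>. 0 \<le> \<eta> \<zeta>"
  shows "\<exists>f. G_extremal f \<and> f \<in> Hinf_plus_C \<and> (AE \<zeta> in \<mu>. \<eta> \<zeta> = norm (f \<zeta>))"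
proof -
  note \<eta>m[measurable] = Linf_measurable[OF \<eta>]
  obtain M where M: "0 \<le> M" "sup_norm \<eta> = ereal M" "AE \<zeta> in \<mu>. norm (\<eta> \<zeta>) \<le> M"
    using \<eta> by (rule sup_norm_real)
  have q: "0 < (1/4::real) ^ j / 2" "(1/4::real) ^ j / 2 < 1" for j
    using power_le_one[of "1/4::real" j] by auto
  obtain z where z: "\<And>n. norm (z n) < 1" "\<And>n. 1 - (1/4) ^ n / 2 \<le> norm (z n)"
    "\<And>n. M - 1 / (real n + 1) \<le> poisson \<eta> (z n)"
    by (rule sup_norm_points[where \<delta> = "\<lambda>n. (1/4) ^ n / 2", OF \<eta> \<eta>0 M(2) q]) blast
  define Q where "Q j \<phi> h n p \<longleftrightarrow> \<phi> \<in> Hinf \<and> (AE \<zeta> in \<mu>. norm (\<phi> \<zeta>) = 1) \<and> h \<in> Hinf \<and> poisson \<phi> 0 = of_real p \<and>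
    1 - (1/4) ^ j / 2 \<le> p \<and> (AE \<zeta> in \<mu>. norm (\<phi> \<zeta> * of_real (\<eta> \<zeta>) - h \<zeta> / \<zeta> ^ n) \<le> (1/4) ^ j / 2)"
    for j \<phi> h n p
  have "\<exists>\<phi> h n p. Q j \<phi> h n p" for j
    unfolding Q_def by (rule inner_multiplier_approx[OF \<eta> q(1)])
  then obtain \<phi> h n p where "\<And>j. Q j (\<phi> j) (h j) (n j) (p j)" by metis
  then have \<phi>: "\<And>j. \<phi> j \<in> Hinf" "\<And>j. AE \<zeta> in \<mu>. norm (\<phi> j \<zeta>) = 1" "\<And>j. h j \<in> Hinf"
    "\<And>j. poisson (\<phi> j) 0 = of_real (p j)" "\<And>j. 1 - (1/4) ^ j / 2 \<le> p j"
    "\<And>j. AE \<zeta> in \<mu>. norm (\<phi> j \<zeta> * of_real (\<eta> \<zeta>) - h j \<zeta> / \<zeta> ^ n j) \<le> (1/4) ^ j / 2"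
    unfolding Q_def by blast+
  obtain U where U: "U \<in> Hinf" "AE \<zeta> in \<mu>. norm (U \<zeta>) = 1"
    and Uz: "\<And>j F. F \<in> Hinf \<Longrightarrow> poisson (\<lambda>\<zeta>. U \<zeta> * F \<zeta>) (z j) = 0"
    and Uk: "\<And>j. \<exists>k. k \<in> Hinf \<and> (AE \<zeta> in \<mu>. norm (k \<zeta>) \<le> 1) \<and> (AE \<zeta> in \<mu>. U \<zeta> = \<phi> j \<zeta> * k \<zeta>)"
    by (rule inner_with_factors_and_zeros[OF \<phi>(1,2,4,5) z(1,2)]) blast
  obtain k where k: "\<And>j. k j \<in> Hinf" "\<And>j. AE \<zeta> in \<mu>. norm (k j \<zeta>) \<le> 1" "\<And>j. AE \<zeta> in \<mu>. U \<zeta> = \<phi> j \<zeta> * k j \<zeta>"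
    using Uk by metis
  note Um[measurable] = Hinf_measurable[OF U(1)]
  define f where "f \<zeta> = U \<zeta> * of_real (\<eta> \<zeta>)" for \<zeta>
  have fm[measurable]: "f \<in> borel_measurable \<mu>" unfolding f_def by measurable
  have nf: "AE \<zeta> in \<mu>. norm (f \<zeta>) = \<eta> \<zeta>"
    using U(2) \<eta>0 by eventually_elim (simp add: f_def norm_mult)
  then have "AE \<zeta> in \<mu>. norm (f \<zeta>) \<le> M" using M(3) by eventually_elim simp
  then have fL: "f \<in> Linf" by (intro LinfI) auto
  have "norm (poisson f (z j)) \<le> 1 / (real j + 1)" for j
  proof -
    let ?g = "\<lambda>\<zeta>. U \<zeta> * of_real (\<eta> \<zeta> - M)"
    have UM: "(\<lambda>\<zeta>. U \<zeta> * of_real M) \<in> Hinf" by (intro Hinf_mult U Hinf_const)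
    have gi: "integrable \<mu> ?g"
    proof -
      have "integrable \<mu> (\<lambda>\<zeta>. f \<zeta> - U \<zeta> * of_real M)"
        by (intro Bochner_Integration.integrable_diff Linf_integrable[OF fL] Hinf_integrable[OF UM])
      then show ?thesis by (simp add: f_def algebra_simps)
    qed
    have "poisson f (z j) = poisson (\<lambda>\<zeta>. ?g \<zeta> + U \<zeta> * of_real M) (z j)"
      by (simp add: f_def[abs_def] algebra_simps)
    also have "\<dots> = poisson ?g (z j) + poisson (\<lambda>\<zeta>. U \<zeta> * of_real M) (z j)"
      by (intro poisson_add gi Hinf_integrable[OF UM] z)
    also have "poisson (\<lambda>\<zeta>. U \<zeta> * of_real M) (z j) = 0" by (intro Uz Hinf_const)
    finally have "norm (poisson f (z j)) = norm (poisson ?g (z j))" by simp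
    also have "\<dots> \<le> poisson (\<lambda>\<zeta>. norm (?g \<zeta>)) (z j)" by (intro norm_poisson_le z)
    also have "\<dots> = poisson (\<lambda>\<zeta>. M - \<eta> \<zeta>) (z j)"
    proof (rule poisson_cong_AE)
      show "AE \<zeta> in \<mu>. norm (?g \<zeta>) = M - \<eta> \<zeta>"
        using U(2) M(3)
      proof eventually_elim
        case (elim \<zeta>)
        have "norm (?g \<zeta>) = \<bar>\<eta> \<zeta> - M\<bar>" using elim by (simp only: norm_mult norm_of_real mult_1)
        then show ?case using elim by simp
      qed
    qed measurable
    also have "\<dots> = M - poisson \<eta> (z j)"
      using z Linf_integrable[OF \<eta>] by (simp add: poisson_diff poisson_const_real)
    finally show ?thesis using z(3)[of j] by linarith
  qed
  then have "G_extremal f" using z by (intro G_extremalI[OF fL \<eta> \<eta>0 nf M(1,2)])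
  moreover have "f \<in> Hinf_plus_C"
  proof -
    have lim: "AE \<zeta> in \<mu>. norm (f \<zeta> - (k j \<zeta> * h j \<zeta>) / \<zeta> ^ n j) \<le> (1/2) ^ j" for j
      using \<phi>(6)[of j] k(2,3)[of j]
    proof eventually_elim
      case (elim \<zeta>)
      have "f \<zeta> - (k j \<zeta> * h j \<zeta>) / \<zeta> ^ n j = k j \<zeta> * (\<phi> j \<zeta> * of_real (\<eta> \<zeta>) - h j \<zeta> / \<zeta> ^ n j)"
        using elim by (simp add: f_def algebra_simps)
      also have "norm \<dots> \<le> 1 * ((1/4) ^ j / 2)"
        unfolding norm_mult using elim by (intro mult_mono) auto
      also have "\<dots> \<le> (1/2) ^ j"
      proof -
        have "(1/4::real) ^ j \<le> (1/2) ^ j" by (intro power_mono) auto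
        moreover have "0 \<le> (1/2::real) ^ j" by simp
        ultimately show ?thesis by linarith
      qed
      finally show ?case .
    qed
    obtain c where c: "continuous_on (sphere 0 1) c" "(\<lambda>\<zeta>. f \<zeta> - c \<zeta>) \<in> Hinf"
      by (rule Hinf_plus_continuous_closed[OF fL Hinf_mult[OF k(1) \<phi>(3)] lim])
    then show ?thesis unfolding Hinf_plus_C_def
      by (intro CollectI exI[of _ "\<lambda>\<zeta>. f \<zeta> - c \<zeta>"] exI[of _ c]) auto
  qed
  moreover have "AE \<zeta> in \<mu>. \<eta> \<zeta> = norm (f \<zeta>)" using nf by eventually_elim simp
  ultimately show ?thesis by blast
qed

theorem extremal_Hinf:
  assumes \<eta>: "\<eta> \<in> Linf" "AE \<zeta> in \<mu>. 0 < \<eta> \<zeta>" and ln: "integrable \<mu> (\<lambda>\<zeta>. ln (\<eta> \<zeta>))"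
  shows "\<exists>f. G_extremal f \<and> f \<in> Hinf \<and> (AE \<zeta> in \<mu>. \<eta> \<zeta> = norm (f \<zeta>))"
proof -
  have \<eta>0: "AE \<zeta> in \<mu>. 0 \<le> \<eta> \<zeta>" using \<eta>(2) by eventually_elim simp
  obtain F where F: "F \<in> Hinf" "AE \<zeta> in \<mu>. norm (F \<zeta>) = \<eta> \<zeta>"
    by (rule outer_function_exists_integrable_log[OF \<eta> ln])
  obtain M where M: "0 \<le> M" "sup_norm \<eta> = ereal M" "AE \<zeta> in \<mu>. norm (\<eta> \<zeta>) \<le> M"
    using \<eta>(1) by (rule sup_norm_real)
  have q: "0 < (1/4::real) ^ j / 2" "(1/4::real) ^ j / 2 < 1" for j
    using power_le_one[of "1/4::real" j] by auto
  obtain z where z: "\<And>n. norm (z n) < 1" "\<And>n. 1 - (1/4) ^ n / 2 \<le> norm (z n)"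
    "\<And>n. M - 1 / (real n + 1) \<le> poisson \<eta> (z n)"
    by (rule sup_norm_points[where \<delta> = "\<lambda>n. (1/4) ^ n / 2", OF \<eta>(1) \<eta>0 M(2) q]) blast
  obtain U where U: "U \<in> Hinf" "AE \<zeta> in \<mu>. norm (U \<zeta>) = 1"
    and Uz: "\<And>j F. F \<in> Hinf \<Longrightarrow> poisson (\<lambda>\<zeta>. U \<zeta> * F \<zeta>) (z j) = 0"
  proof (rule inner_with_factors_and_zeros[of "\<lambda>_ _. 1" "\<lambda>_. 1" z])
    show "poisson (\<lambda>_. 1) 0 = complex_of_real 1" by (simp add: poisson_0 circle.prob_space[simplified])
  qed (use z in \<open>auto simp: Hinf_const\<close>)
  have H: "(\<lambda>\<zeta>. U \<zeta> * F \<zeta>) \<in> Hinf" by (intro Hinf_mult U F)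
  have nf: "AE \<zeta> in \<mu>. norm (U \<zeta> * F \<zeta>) = \<eta> \<zeta>"
    using U(2) F(2) by eventually_elim (simp add: norm_mult)
  have "G_extremal (\<lambda>\<zeta>. U \<zeta> * F \<zeta>)"
    using z Uz[OF F(1)] by (intro G_extremalI[OF Hinf_Linf[OF H] \<eta>(1) \<eta>0 nf M(1,2)]) auto
  moreover have "AE \<zeta> in \<mu>. \<eta> \<zeta> = norm (U \<zeta> * F \<zeta>)" using nf by eventually_elim simp
  ultimately show ?thesis using H by blast
qed

section \<open>Integrability of the logarithm of an analytic function\<close>

lemma poisson_kernel_lower:
  assumes "norm z < 1" "norm \<zeta> = 1"
  shows "(1 - (norm z)\<^sup>2) / 4 \<le> poisson_kernel z \<zeta>"
proof -
  have "norm (\<zeta> - z) \<le> 2" using norm_triangle_ineq4[of \<zeta> z] assms by simp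
  then have "(norm (\<zeta> - z))\<^sup>2 \<le> 2\<^sup>2" by (intro power_mono) auto
  moreover have "\<zeta> \<noteq> z" using assms by auto
  moreover have "(norm z)\<^sup>2 < 1" using assms by (simp add: power_less_one_iff)
  ultimately show ?thesis unfolding poisson_kernel_def by (intro divide_left_mono mult_pos_pos) auto
qed

text \<open>
For \<open>t > 0\<close> let \<open>g\<close> be outer with modulus \<open>1 / max(\<bar>f\<bar>, t)\<close>. Then \<open>f g\<close> is bounded by 1, so at a point \<open>z\<^sub>0\<close> with
\<open>P f (z\<^sub>0) \<noteq> 0\<close> multiplicativity gives \<open>log \<bar>P f (z\<^sub>0)\<bar> \<le> P(log max(\<bar>f\<bar>, t))(z\<^sub>0)\<close>. The bound does not
depend on \<open>t\<close>, and monotone convergence as \<open>t \<rightarrow> 0\<close> concludes.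
\<close>

theorem Hinf_log_integral_finite:
  assumes f: "f \<in> Hinf" and nz: "\<not> (AE \<zeta> in \<mu>. f \<zeta> = 0)"
  shows "(\<integral>\<^sup>+\<zeta>. e2ennreal (- ext_ln (norm (f \<zeta>))) \<partial>\<mu>) < \<infinity>"
proof -
  note fm[measurable] = Hinf_measurable[OF f]
  obtain z0 where z0: "norm z0 < 1" "poisson f z0 \<noteq> 0"
    using AE_eq_0_if_poisson_0[OF Hinf_integrable[OF f]] nz by blast
  obtain M0 where M0: "AE \<zeta> in \<mu>. norm (f \<zeta>) \<le> M0" using Hinf_Linf[OF f] by (rule LinfE)
  define M where "M = max M0 1"
  have M: "M \<ge> 1" "AE \<zeta> in \<mu>. norm (f \<zeta>) \<le> M"
    unfolding M_def using M0 by (auto elim!: eventually_mono)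
  then have lnM: "0 \<le> ln M" by simp
  define t where "t n = 1 / (real n + 1)" for n
  have t: "0 < t n" "t n \<le> 1" for n by (auto simp: t_def)
  define v where "v n \<zeta> = ln (max (norm (f \<zeta>)) (t n))" for n \<zeta>
  have vm[measurable]: "v n \<in> borel_measurable \<mu>" for n unfolding v_def by measurable
  have vle: "AE \<zeta> in \<mu>. v n \<zeta> \<le> ln M" for n
    using M(2)
  proof eventually_elim
    case (elim \<zeta>)
    then show ?case unfolding v_def using t[of n] M(1) by (subst ln_le_cancel_iff) (auto simp: max_def)
  qed
  have vb: "AE \<zeta> in \<mu>. \<bar>v n \<zeta>\<bar> \<le> \<bar>ln (t n)\<bar> + \<bar>ln M\<bar>" for n
    using vle[of n]
  proof eventually_elim
    case (elim \<zeta>)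
    have "ln (t n) \<le> v n \<zeta>" unfolding v_def using t[of n] by (subst ln_le_cancel_iff) auto
    then show ?case using elim by linarith
  qed
  have vi: "integrable \<mu> (v n)" for n using vb by (intro integrable_circle_bounded) auto
  define K where "K = (1 - (norm z0)\<^sup>2) / 4"
  have K: "K > 0" unfolding K_def using z0 by (simp add: power_less_one_iff)
  define L where "L = ln (norm (poisson f z0))"
  have Pv: "L \<le> poisson (v n) z0" for n
  proof -
    have um: "(\<lambda>\<zeta>. - v n \<zeta>) \<in> borel_measurable \<mu>" by measurable
    have ub: "AE \<zeta> in \<mu>. \<bar>- v n \<zeta>\<bar> \<le> \<bar>ln (t n)\<bar> + \<bar>ln M\<bar>" using vb[of n] by simp
    obtain g where g: "g \<in> Hinf" "AE \<zeta> in \<mu>. norm (g \<zeta>) = exp (- v n \<zeta>)"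
      "\<And>z. norm z < 1 \<Longrightarrow> norm (poisson g z) = exp (poisson (\<lambda>\<zeta>. - v n \<zeta>) z)"
      by (rule outer_function_exists[OF um ub]) blast
    have "AE \<zeta> in \<mu>. norm (f \<zeta> * g \<zeta>) \<le> 1"
      using g(2)
    proof eventually_elim
      case (elim \<zeta>)
      have p: "max (norm (f \<zeta>)) (t n) > 0" using t[of n] by simp
      have "norm (f \<zeta> * g \<zeta>) = norm (f \<zeta>) / max (norm (f \<zeta>)) (t n)"
        using p elim by (simp add: norm_mult v_def exp_minus divide_inverse)
      also have "\<dots> \<le> 1" using p by (simp add: divide_le_eq_1)
      finally show ?case .
    qed
    then have "norm (poisson (\<lambda>\<zeta>. f \<zeta> * g \<zeta>) z0) \<le> 1"
      using z0 by (intro norm_poisson_le_bound Hinf_measurable[OF Hinf_mult[OF f g(1)]])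
    then have "norm (poisson f z0) * exp (poisson (\<lambda>\<zeta>. - v n \<zeta>) z0) \<le> 1"
      using z0 by (simp add: poisson_mult f g norm_mult)
    moreover have "poisson (\<lambda>\<zeta>. - v n \<zeta>) z0 = - poisson (v n) z0"
      using z0 vi by (intro poisson_bounded_linear bounded_linear_minus bounded_linear_ident)
    ultimately have "norm (poisson f z0) \<le> exp (poisson (v n) z0)"
      by (simp add: exp_minus field_simps)
    then have "ln (norm (poisson f z0)) \<le> ln (exp (poisson (v n) z0))"
      using z0 by (subst ln_le_cancel_iff) auto
    then show ?thesis unfolding L_def by simp
  qed
  define w where "w n \<zeta> = max 0 (ln M - v n \<zeta>)" for n \<zeta>
  have wm[measurable]: "w n \<in> borel_measurable \<mu>" for n unfolding w_def by measurable
  have wv: "AE \<zeta> in \<mu>. w n \<zeta> = ln M - v n \<zeta>" for n using vle[of n] by eventually_elim (simp add: w_def)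
  have wi: "integrable \<mu> (w n)" for n unfolding w_def using vi by (intro integrable_max) auto
  have w0: "0 \<le> w n \<zeta>" for n \<zeta> by (simp add: w_def)
  have wint: "(LINT \<zeta>|\<mu>. w n \<zeta>) \<le> (ln M - L) / K" for n
  proof -
    have "K * (LINT \<zeta>|\<mu>. w n \<zeta>) = (LINT \<zeta>|\<mu>. K * w n \<zeta>)" by simp
    also have "\<dots> \<le> poisson (w n) z0"
      unfolding poisson_eq_kernel
    proof (rule integral_mono)
      show "K * w n \<zeta> \<le> poisson_kernel z0 \<zeta> *\<^sub>R w n \<zeta>" if "\<zeta> \<in> space \<mu>" for \<zeta>
        unfolding K_def real_scaleR_def using that poisson_kernel_lower[OF z0(1)] w0
        by (intro mult_right_mono) auto
    qed (use wi integrable_poisson_kernel_mult[OF wi z0(1)] in auto)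
    also have "\<dots> = poisson (\<lambda>\<zeta>. ln M - v n \<zeta>) z0" by (intro poisson_cong_AE wv) measurable
    also have "\<dots> = ln M - poisson (v n) z0" using z0 vi by (simp add: poisson_diff poisson_const_real)
    also have "\<dots> \<le> ln M - L" using Pv by simp
    finally show ?thesis using K by (simp add: field_simps)
  qed
  have tmono: "t n \<le> t k" if "k \<le> n" for k n using that by (auto simp: t_def intro!: divide_left_mono)
  have "incseq (\<lambda>n \<zeta>. ennreal (w n \<zeta>))"
  proof (intro monoI le_funI ennreal_leI)
    fix m n \<zeta> assume "m \<le> (n::nat)"
    then have "max (norm (f \<zeta>)) (t n) \<le> max (norm (f \<zeta>)) (t m)" using tmono by (intro max.mono) auto
    then have "v n \<zeta> \<le> v m \<zeta>" unfolding v_def using t[of n] by (subst ln_le_cancel_iff) auto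
    then show "w m \<zeta> \<le> w n \<zeta>" by (simp add: w_def)
  qed
  then have "(\<integral>\<^sup>+\<zeta>. (SUP n. ennreal (w n \<zeta>)) \<partial>\<mu>) = (SUP n. \<integral>\<^sup>+\<zeta>. ennreal (w n \<zeta>) \<partial>\<mu>)"
    by (intro nn_integral_monotone_convergence_SUP) auto
  also have "\<dots> = (SUP n. ennreal (LINT \<zeta>|\<mu>. w n \<zeta>))"
    using wi w0 by (intro SUP_cong refl nn_integral_eq_integral) auto
  also have "\<dots> \<le> ennreal ((ln M - L) / K)" using wint by (intro SUP_least ennreal_leI)
  finally have fin: "(\<integral>\<^sup>+\<zeta>. (SUP n. ennreal (w n \<zeta>)) \<partial>\<mu>) < \<infinity>"
    by (simp add: order_le_less_trans)
  have t0: "t \<longlonglongrightarrow> 0" unfolding t_def by real_asymp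
  have "e2ennreal (- ext_ln (norm (f \<zeta>))) \<le> (SUP n. ennreal (w n \<zeta>))" for \<zeta>
  proof (cases "f \<zeta> = 0")
    case False
    then have "eventually (\<lambda>n. t n < norm (f \<zeta>)) sequentially" using order_tendstoD(2)[OF t0] by simp
    then obtain n where "t n < norm (f \<zeta>)" by (auto simp: eventually_sequentially)
    then have "v n \<zeta> = ln (norm (f \<zeta>))" by (simp add: v_def max_def)
    then have "- ln (norm (f \<zeta>)) \<le> w n \<zeta>" using lnM by (simp add: w_def le_max_iff_disj)
    then have "ennreal (- ln (norm (f \<zeta>))) \<le> ennreal (w n \<zeta>)" by (rule ennreal_leI)
    also have "\<dots> \<le> (SUP n. ennreal (w n \<zeta>))" by (intro SUP_upper) auto
    finally show ?thesis using False by (simp add: ext_ln_def e2ennreal_ereal)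
  next
    case True
    have "ennreal (ln (real n + 1)) \<le> (SUP n. ennreal (w n \<zeta>))" for n
    proof -
      have "v n \<zeta> = - ln (real n + 1)" using True t[of n] by (simp add: v_def t_def max_def ln_div)
      then have "ln (real n + 1) \<le> w n \<zeta>" using lnM by (simp add: w_def le_max_iff_disj)
      then have "ennreal (ln (real n + 1)) \<le> ennreal (w n \<zeta>)" by (rule ennreal_leI)
      also have "\<dots> \<le> (SUP n. ennreal (w n \<zeta>))" by (intro SUP_upper) auto
      finally show ?thesis .
    qed
    moreover have "(\<lambda>n. ennreal (ln (real n + 1))) \<longlonglongrightarrow> top"
    proof -
      have "filterlim (\<lambda>n. ln (real n + 1)) at_top sequentially" by real_asymp
      then show ?thesis by (rule ennreal_tendsto_top_eq_at_top[THEN iffD2])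
    qed
    ultimately have "top \<le> (SUP n. ennreal (w n \<zeta>))" by (intro LIMSEQ_le_const2) auto
    then show ?thesis by (rule order_trans[rotated]) simp
  qed
  then have "(\<integral>\<^sup>+\<zeta>. e2ennreal (- ext_ln (norm (f \<zeta>))) \<partial>\<mu>) \<le> (\<integral>\<^sup>+\<zeta>. (SUP n. ennreal (w n \<zeta>)) \<partial>\<mu>)"
    by (intro nn_integral_mono)
  then show ?thesis using fin by (rule order_le_less_trans)
qed

lemma log_integral_positive_part_finite:
  fixes \<eta> :: "complex \<Rightarrow> real"
  assumes \<eta>: "\<eta> \<in> Linf"
  shows "(\<integral>\<^sup>+\<zeta>. e2ennreal (ext_ln (\<eta> \<zeta>)) \<partial>\<mu>) < \<infinity>"
proof -
  obtain B where B: "B > 0" "AE \<zeta> in \<mu>. norm (\<eta> \<zeta>) \<le> B" using \<eta> by (rule LinfE)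
  have "(\<integral>\<^sup>+\<zeta>. e2ennreal (ext_ln (\<eta> \<zeta>)) \<partial>\<mu>) \<le> (\<integral>\<^sup>+\<zeta>. ennreal \<bar>ln B\<bar> \<partial>\<mu>)"
  proof (rule nn_integral_mono_AE)
    show "AE \<zeta> in \<mu>. e2ennreal (ext_ln (\<eta> \<zeta>)) \<le> ennreal \<bar>ln B\<bar>"
      using B(2)
    proof eventually_elim
      case (elim \<zeta>)
      show ?case
      proof (cases "\<eta> \<zeta> > 0")
        case True
        then have "ln (\<eta> \<zeta>) \<le> ln B" using elim B(1) by (subst ln_le_cancel_iff) auto
        then show ?thesis using True by (simp add: ext_ln_def e2ennreal_ereal ennreal_leI)
      qed (simp add: ext_ln_def e2ennreal_neg)
    qed
  qed
  also have "\<dots> < \<infinity>" by (simp add: circle.emeasure_space_1[simplified])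
  finally show ?thesis .
qed

text \<open>
The positive part of the logarithm of a bounded function has finite integral, so the difference of the two
integrals is never of the form \<open>\<infinity> - \<infinity>\<close>.
\<close>

lemma ext_log_integral_gt_MInf_iff:
  fixes \<eta> :: "complex \<Rightarrow> real"
  assumes \<eta>: "\<eta> \<in> Linf"
  shows "ext_integral \<mu> (\<lambda>\<zeta>. ext_ln (\<eta> \<zeta>)) > - \<infinity> \<longleftrightarrow> (\<integral>\<^sup>+\<zeta>. e2ennreal (- ext_ln (\<eta> \<zeta>)) \<partial>\<mu>) < \<infinity>"
proof -
  let ?a = "\<integral>\<^sup>+\<zeta>. e2ennreal (ext_ln (\<eta> \<zeta>)) \<partial>\<mu>" and ?b = "\<integral>\<^sup>+\<zeta>. e2ennreal (- ext_ln (\<eta> \<zeta>)) \<partial>\<mu>"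
  obtain a where a: "?a = ennreal a" "0 \<le> a"
    using log_integral_positive_part_finite[OF \<eta>] by (cases ?a) auto
  show ?thesis
    unfolding ext_integral_def a(1) using a(2)
    by (cases ?b) (auto simp: enn2ereal_ennreal)
qed

lemma integrable_log_if_finite:
  fixes \<eta> :: "complex \<Rightarrow> real"
  assumes \<eta>: "\<eta> \<in> Linf" and fin: "(\<integral>\<^sup>+\<zeta>. e2ennreal (- ext_ln (\<eta> \<zeta>)) \<partial>\<mu>) < \<infinity>"
  shows "AE \<zeta> in \<mu>. 0 < \<eta> \<zeta>" "integrable \<mu> (\<lambda>\<zeta>. ln (\<eta> \<zeta>))"
proof -
  note \<eta>m[measurable] = Linf_measurable[OF \<eta>]
  have [measurable]: "(\<lambda>\<zeta>. ext_ln (\<eta> \<zeta>)) \<in> borel_measurable \<mu>" unfolding ext_ln_def by measurable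
  have "AE \<zeta> in \<mu>. e2ennreal (- ext_ln (\<eta> \<zeta>)) \<noteq> \<infinity>"
    using fin by (intro nn_integral_noteq_infinite) auto
  then show pos: "AE \<zeta> in \<mu>. 0 < \<eta> \<zeta>"
    by eventually_elim (auto simp: ext_ln_def split: if_splits)
  have "(\<integral>\<^sup>+\<zeta>. ennreal (norm (ln (\<eta> \<zeta>))) \<partial>\<mu>) \<le>
     (\<integral>\<^sup>+\<zeta>. e2ennreal (ext_ln (\<eta> \<zeta>)) + e2ennreal (- ext_ln (\<eta> \<zeta>)) \<partial>\<mu>)"
  proof (rule nn_integral_mono_AE)
    show "AE \<zeta> in \<mu>. ennreal (norm (ln (\<eta> \<zeta>))) \<le> e2ennreal (ext_ln (\<eta> \<zeta>)) + e2ennreal (- ext_ln (\<eta> \<zeta>))"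
      using pos
    proof eventually_elim
      case (elim \<zeta>)
      then show ?case by (cases "0 \<le> ln (\<eta> \<zeta>)") (auto simp: ext_ln_def e2ennreal_ereal)
    qed
  qed
  also have "\<dots> = (\<integral>\<^sup>+\<zeta>. e2ennreal (ext_ln (\<eta> \<zeta>)) \<partial>\<mu>) + (\<integral>\<^sup>+\<zeta>. e2ennreal (- ext_ln (\<eta> \<zeta>)) \<partial>\<mu>)"
    by (intro nn_integral_add) measurable
  also have "\<dots> < \<infinity>" using fin log_integral_positive_part_finite[OF \<eta>] by simp
  finally show "integrable \<mu> (\<lambda>\<zeta>. ln (\<eta> \<zeta>))" by (intro integrableI_bounded) auto
qed

section \<open>Norm-attaining functions\<close>

lemma constant_modulus_norm_attaining:
  fixes \<eta> :: "complex \<Rightarrow> real"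
  assumes \<eta>: "\<eta> \<in> Linf" and \<eta>0: "AE \<zeta> in \<mu>. 0 \<le> \<eta> \<zeta>" and c: "AE \<zeta> in \<mu>. \<eta> \<zeta> = c"
  shows "\<exists>f. G_extremal f \<and> f \<in> BMO_na \<inter> Linf \<and> (AE \<zeta> in \<mu>. \<eta> \<zeta> = norm (f \<zeta>))"
proof -
  note \<eta>m[measurable] = Linf_measurable[OF \<eta>]
  have "AE \<zeta> in \<mu>. 0 \<le> c" using \<eta>0 c by eventually_elim simp
  then have c0: "0 \<le> c" by simp
  define f where "f \<zeta> = of_real c * \<zeta>" for \<zeta> :: complex
  have fh: "continuous_on (cball 0 1) f" "f holomorphic_on ball 0 1"
    unfolding f_def by (auto intro!: continuous_intros holomorphic_intros)
  have fL: "f \<in> Linf" using Hinf_continuous_holomorphic[OF fh] by (rule Hinf_Linf)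
  note fm[measurable] = Linf_measurable[OF fL]
  have fn: "AE \<zeta> in \<mu>. norm (f \<zeta>) = c" using AE_circle_norm by eventually_elim (use c0 in \<open>simp add: f_def norm_mult\<close>)
  then have fc: "AE \<zeta> in \<mu>. norm (f \<zeta>) \<le> c" by eventually_elim simp
  have g0: "garsia_fun f 0 = c\<^sup>2"
  proof -
    have "poisson (\<lambda>\<zeta>. (norm (f \<zeta>))\<^sup>2) 0 = poisson (\<lambda>_. c\<^sup>2) 0"
    proof (rule poisson_cong_AE)
      show "AE \<zeta> in \<mu>. (norm (f \<zeta>))\<^sup>2 = c\<^sup>2" using fn by eventually_elim simp
    qed measurable
    moreover have "poisson f 0 = 0" using poisson_holomorphic[OF fh, of 0] by (simp add: f_def)
    ultimately show ?thesis by (simp add: garsia_fun_def poisson_const_real)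
  qed
  have "ereal (sqrt (garsia_fun f 0)) \<le> garsia_norm f"
    unfolding garsia_norm_def by (intro SUP_upper) auto
  then have gn: "garsia_norm f = ereal c"
    using garsia_norm_le[OF fL c0 fc] g0 c0 by (intro antisym) auto
  have "sup_norm f = esssup \<mu> (\<lambda>_. ereal c)"
    unfolding sup_norm_def using fn by (intro esssup_AE_cong) (auto elim: eventually_mono)
  also have "\<dots> = ereal c" by (intro esssup_const) (simp add: circle.emeasure_space_1[simplified])
  finally have "G_extremal f" using fL gn by (simp add: G_extremal_def)
  moreover have "f \<in> BMO_na"
  proof -
    have "f \<in> BMO" using gn integrable_norm_power2[OF fL] fm by (simp add: BMO_def L2_def)
    moreover have "(garsia_norm f)\<^sup>2 = ereal (garsia_fun f 0)" by (simp add: gn g0 power2_eq_square)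
    ultimately show ?thesis unfolding BMO_na_def by (intro CollectI conjI bexI[of _ 0]) auto
  qed
  moreover have "AE \<zeta> in \<mu>. \<eta> \<zeta> = norm (f \<zeta>)" using fn c by eventually_elim simp
  ultimately show ?thesis using fL by blast
qed

lemma norm_attaining_constant_modulus:
  assumes f: "G_extremal f" "f \<in> BMO_na"
  shows "\<exists>c. AE \<zeta> in \<mu>. norm (f \<zeta>) = c"
proof -
  have fL: "f \<in> Linf" using f by (simp add: G_extremal_def)
  note fm[measurable] = Linf_measurable[OF fL]
  obtain M where M: "0 \<le> M" "sup_norm f = ereal M" "AE \<zeta> in \<mu>. norm (f \<zeta>) \<le> M"
    using fL by (rule sup_norm_real)
  obtain z0 where z0: "norm z0 < 1" "(garsia_norm f)\<^sup>2 = ereal (garsia_fun f z0)"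
    using f(2) by (auto simp: BMO_na_def)
  have "garsia_fun f z0 = M\<^sup>2"
    using z0(2) f(1) M(2) by (simp add: G_extremal_def power2_eq_square)
  then have P: "M\<^sup>2 \<le> poisson (\<lambda>\<zeta>. (norm (f \<zeta>))\<^sup>2) z0"
    unfolding garsia_fun_def using zero_le_power2[of "norm (poisson f z0)"] by linarith
  note i = integrable_norm_power2[OF fL]
  let ?g = "\<lambda>\<zeta>. M\<^sup>2 - (norm (f \<zeta>))\<^sup>2"
  have g0: "AE \<zeta> in \<mu>. 0 \<le> ?g \<zeta>" using M(3) by eventually_elim (simp add: power_mono)
  then have kg: "AE \<zeta> in \<mu>. 0 \<le> poisson_kernel z0 \<zeta> *\<^sub>R ?g \<zeta>"
    using AE_circle_norm
    by eventually_elim (auto intro!: mult_nonneg_nonneg less_imp_le[OF poisson_kernel_bounds(1)] z0)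
  have ig: "integrable \<mu> ?g" using i by simp
  have "(LINT \<zeta>|\<mu>. poisson_kernel z0 \<zeta> *\<^sub>R ?g \<zeta>) = M\<^sup>2 - poisson (\<lambda>\<zeta>. (norm (f \<zeta>))\<^sup>2) z0"
    unfolding poisson_eq_kernel[symmetric]
    using z0 i poisson_diff[of "\<lambda>_. M\<^sup>2" "\<lambda>\<zeta>. (norm (f \<zeta>))\<^sup>2" z0] by (simp add: poisson_const_real)
  then have "(LINT \<zeta>|\<mu>. poisson_kernel z0 \<zeta> *\<^sub>R ?g \<zeta>) = 0"
    using P integral_nonneg_AE[OF kg] by linarith
  then have "AE \<zeta> in \<mu>. poisson_kernel z0 \<zeta> *\<^sub>R ?g \<zeta> = 0"
    using integral_nonneg_eq_0_iff_AE[OF integrable_poisson_kernel_mult[OF ig z0(1)] kg] by simp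
  then have "AE \<zeta> in \<mu>. norm (f \<zeta>) = M"
    using AE_circle_norm
  proof eventually_elim
    case (elim \<zeta>)
    then have "(norm (f \<zeta>))\<^sup>2 = M\<^sup>2" using poisson_kernel_bounds(1)[OF z0(1) elim(2)] by simp
    then show ?case using M(1) by (simp add: power2_eq_iff_nonneg)
  qed
  then show ?thesis by blast
qed

theorem theorem2p1:
  fixes \<eta> :: "complex \<Rightarrow> real"
  assumes "\<eta> \<in> Linf"
    and "AE \<zeta> in circle_measure. 0 \<le> \<eta> \<zeta>"
    and "\<not> (AE \<zeta> in circle_measure. \<eta> \<zeta> = 0)"
  shows "(\<exists>f. G_extremal f \<and> f \<in> Hinf_plus_C \<and> (AE \<zeta> in circle_measure. \<eta> \<zeta> = norm (f \<zeta>))) \<and>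
    ((\<exists>f. G_extremal f \<and> f \<in> Hinf \<and> (AE \<zeta> in circle_measure. \<eta> \<zeta> = norm (f \<zeta>))) \<longleftrightarrow>
       ext_integral circle_measure (\<lambda>\<zeta>. ext_ln (\<eta> \<zeta>)) > - \<infinity>) \<and>
    ((\<exists>f. G_extremal f \<and> f \<in> BMO_na \<inter> Linf \<and> (AE \<zeta> in circle_measure. \<eta> \<zeta> = norm (f \<zeta>))) \<longleftrightarrow>
       (\<exists>c. AE \<zeta> in circle_measure. \<eta> \<zeta> = c))"
proof (intro conjI iffI)
  note \<eta>m[measurable] = Linf_measurable[OF assms(1)]
  show "\<exists>f. G_extremal f \<and> f \<in> Hinf_plus_C \<and> (AE \<zeta> in \<mu>. \<eta> \<zeta> = norm (f \<zeta>))"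
    using assms by (intro extremal_Hinf_plus_C)
next
  assume "\<exists>f. G_extremal f \<and> f \<in> Hinf \<and> (AE \<zeta> in \<mu>. \<eta> \<zeta> = norm (f \<zeta>))"
  then obtain f where f: "f \<in> Hinf" "AE \<zeta> in \<mu>. \<eta> \<zeta> = norm (f \<zeta>)" by blast
  have "\<not> (AE \<zeta> in \<mu>. f \<zeta> = 0)"
  proof
    assume "AE \<zeta> in \<mu>. f \<zeta> = 0"
    with f(2) have "AE \<zeta> in \<mu>. \<eta> \<zeta> = 0" by eventually_elim simp
    then show False using assms(3) by simp
  qed
  then have "(\<integral>\<^sup>+\<zeta>. e2ennreal (- ext_ln (norm (f \<zeta>))) \<partial>\<mu>) < \<infinity>"
    by (rule Hinf_log_integral_finite[OF f(1)])
  also have "(\<integral>\<^sup>+\<zeta>. e2ennreal (- ext_ln (norm (f \<zeta>))) \<partial>\<mu>) = (\<integral>\<^sup>+\<zeta>. e2ennreal (- ext_ln (\<eta> \<zeta>)) \<partial>\<mu>)"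
    using f(2) by (intro nn_integral_cong_AE) (auto elim!: eventually_mono)
  finally show "ext_integral \<mu> (\<lambda>\<zeta>. ext_ln (\<eta> \<zeta>)) > - \<infinity>"
    by (simp only: ext_log_integral_gt_MInf_iff[OF assms(1)])
next
  assume "ext_integral \<mu> (\<lambda>\<zeta>. ext_ln (\<eta> \<zeta>)) > - \<infinity>"
  then have "(\<integral>\<^sup>+\<zeta>. e2ennreal (- ext_ln (\<eta> \<zeta>)) \<partial>\<mu>) < \<infinity>"
    by (simp only: ext_log_integral_gt_MInf_iff[OF assms(1)])
  note integrable_log_if_finite[OF assms(1) this]
  then show "\<exists>f. G_extremal f \<and> f \<in> Hinf \<and> (AE \<zeta> in \<mu>. \<eta> \<zeta> = norm (f \<zeta>))"
    by (intro extremal_Hinf assms(1))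
next
  assume "\<exists>f. G_extremal f \<and> f \<in> BMO_na \<inter> Linf \<and> (AE \<zeta> in \<mu>. \<eta> \<zeta> = norm (f \<zeta>))"
  then obtain f where f: "G_extremal f" "f \<in> BMO_na" and eq: "AE \<zeta> in \<mu>. \<eta> \<zeta> = norm (f \<zeta>)" by blast
  obtain c where "AE \<zeta> in \<mu>. norm (f \<zeta>) = c" using norm_attaining_constant_modulus[OF f] by blast
  with eq have "AE \<zeta> in \<mu>. \<eta> \<zeta> = c" by eventually_elim simp
  then show "\<exists>c. AE \<zeta> in \<mu>. \<eta> \<zeta> = c" by blast
next
  assume "\<exists>c. AE \<zeta> in \<mu>. \<eta> \<zeta> = c"
  then obtain c where "AE \<zeta> in \<mu>. \<eta> \<zeta> = c" by blast
  then show "\<exists>f. G_extremal f \<and> f \<in> BMO_na \<inter> Linf \<and> (AE \<zeta> in \<mu>. \<eta> \<zeta> = norm (f \<zeta>))"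
    by (rule constant_modulus_norm_attaining[OF assms(1,2)])
qed

end
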